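(* Let $n\in\{2,3,\dots\}$, $p\in(n/(n-1),\infty)$ and $q=np/(n+p)$. Let $T_p$ be a constant such that $\|u\|_{L^p(\mathbb{R}^n)}\le T_p\|\nabla u\|_{L^q(\mathbb{R}^n)}$ for all $u\in W^{1,q}(\mathbb{R}^n)$. Let $\Omega\subset\mathbb{R}^n$ be a domain with minimally smooth boundary, let $\sigma>0$, and equip $W^{1,q}(\Omega)$ with the norm $\|u\|_{W^{1,q}(\Omega)}:=\big(\|\nabla u\|_{L^q(\Omega)}^q+\sigma\|u\|_{L^q(\Omega)}^q\big)^{1/q}$. Let $\tau>0$, $\xi\in(0,1)$, let $\varepsilon>0$ be admissible for $\Omega$, let $\rho$ be a mollifier, and let $E^i=E^i_{\Omega_i,\tau,\xi}$ be the extension operators for the associated special Lipschitz domains $\Omega_i$ (all as in the context). For each $i\in\mathbb{N}$ let $A_{q,\tau,\xi}(\Omega_i)$ and $A'_{q,\tau,\xi}(\Omega_i)$ be constants with $$\|E^i v\|_{L^q(\mathbb{R}^n)}\le A_{q,\tau,\xi}(\Omega_i)\|v\|_{L^q(\Omega_i)},\qquad\|\nabla(E^iv)\|_{L^q(\mathbb{R}^n)}\le A'_{q,\tau,\xi}(\Omega_i)\|\nabla v\|_{L^q(\Omega_i)}\qquad\forall v\in W^{1,q}(\Omega_i),$$ with $A:=\sup_i A_{q,\tau,\xi}(\Omega_i)<\infty$ and $A':=\sup_iA'_{q,\tau,\xi}(\Omega_i)<\infty$. Let $N$ be the overlap number of $\Omega$, let $b_\varepsilon>0$ satisfy $b_\varepsilon\ge\int_{\mathbb{R}^n}|\partial_{x_j}\rho_{\frac14\varepsilon}(x)|\,dx$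 for all $j\in\{1,\dots,n\}$, put $R:=b_\varepsilon(6NA+NA'+3)n^{1/q}/(NA'+1)$, and $$A_q(\Omega):=\begin{cases}NA'+1,&R\le\sigma^{1/q},\\[2pt] b_\varepsilon(6NA+NA'+3)\,n^{1/q}/\sigma^{1/q},&R>\sigma^{1/q}.\end{cases}$$ Then $$\|u\|_{L^p(\Omega)}\le C_p(\Omega)\,\|u\|_{W^{1,q}(\Omega)}\qquad\forall u\in W^{1,q}(\Omega)$$ holds for $$C_p(\Omega)=2^{\frac{q-1}{q}}\,T_p\,A_q(\Omega).$$
   Context: **Norms and notation.** $\|\nabla u\|_{L^q(\Omega)}:=\big(\sum_{j=1}^n\int_\Omega|\partial_{x_j}u|^q\,dx\big)^{1/q}$. For $S\subset\mathbb{R}^n$ and $\delta>0$, $S^{\delta}:=\{x\in\mathbb{R}^n: B(x,\delta)\subset S\}$, where $B(x,\delta)$ is the open ball; $S^c$ is the complement and $\overline S$ the closure; $\mathrm{dist}(x,S)=\inf\{|x-y|:y\in S\}$ with $|\cdot|$ Euclidean. **Mollifier.** A nonnegative $\rho\in C^\infty(\mathbb{R}^n)$ with $\rho(x)=0$ for $|x|\ge1$ and $\int_{\mathbb{R}^n}\rho=1$; $\rho_\delta(x):=\delta^{-n}\rho(x/\delta)$. **Special Lipschitz domain.** A set $\Omega'=\{(x',x_n)\in\mathbb{R}^n: x_n>\phi(x')\}$, $x'=(x_1,\dots,x_{n-1})$, where $\phi:\mathbb{R}^{n-1}\to\mathbb{R}$ satisfies $|\phi(x)-\phi(y)|\le M|x-y|$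 for all $x,y\in\mathbb{R}^{n-1}$, for some $M>0$; $M=M_{\Omega'}$ is called the Lipschitz constant (Lipschitz bound) of $\Omega'$. **Domain with minimally smooth boundary.** An open set $\Omega\subset\mathbb{R}^n$ for which there exist $\varepsilon>0$, $N\in\mathbb{N}$, $M>0$ and a sequence $\{U_i\}_{i\in\mathbb{N}}$ of open subsets of $\mathbb{R}^n$ such that (1) for any $x\in\partial\Omega$, $B(x,\varepsilon)\subset U_i$ for some $i$; (2) no point of $\mathbb{R}^n$ belongs to more than $N$ of the $U_i$; (3) for any $i$ there is a special Lipschitz domain $\Omega_i$ with Lipschitz bound not more than $M$ such that $U_i\cap\Omega=U_i\cap\Omega_i$. $N$ is the overlap number of $\Omega$. The sets $U_i,\Omega_i$ are fixed. **Admissible $\varepsilon$.** $\varepsilon>0$ is admissible for $\Omega$ if $U_i^{\frac34\varepsilon}$ is nonempty for all $i\in\mathbb{N}$ and every $x$ with $\mathrm{dist}(x,\partial\Omega)\le\varepsilon/2$ lies in $U_i^{\frac12\varepsilon}$ for some $i$. **Regularized distance.** For a closed set $S\subset\mathbb{R}^n$ and $\xi\in(0,1)$, $\mathrm{RD}_{S,\xi}\in C^\infty(S^c)$ denotes a function (which exists by a result of Fraenkel) such that for all $x\in S^c$: $(1+\xi)^{-2}\mathrm{dist}(x,S)\le\mathrm{RD}_{S,\xi}(x)\le(1-\xi)^{-2}\mathrm{dist}(x,S)$ and $|\partial^\alpha\mathrm{RD}_{S,\xi}(x)|\le P_\alpha(\xi\,\mathrm{dist}(x,S))^{1-|\alpha|}$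 for all multi-indices $|\alpha|\ge1$, with constants $P_\alpha$ depending only on $\alpha$ (not on $S$ or $\xi$). **Extension operator for a special Lipschitz domain $\Omega'$.** Let $\psi:\mathbb{R}\to\mathbb{R}$ satisfy $\int_1^\infty\psi(t)\,dt=1$ and $\int_1^\infty t^m\psi(t)\,dt=0$ for all $m\in\mathbb{N}=\{1,2,\dots\}$, and let $A_0,A_1$ be constants with $|\psi(t)|\le A_0/t^2$ and $|\psi(t)|\le A_1/t^3$ for $t\ge1$. Put $g^*_{\Omega',\tau,\xi}:=(1+\tau)(1+\xi)^2\sqrt{1+M_{\Omega'}^2}\;\mathrm{RD}_{\overline{\Omega'},\xi}$. Then $E_{\Omega',\tau,\xi}$ is defined by $(E_{\Omega',\tau,\xi}u)(x',x_n)=u(x',x_n)$ for $(x',x_n)\in\overline{\Omega'}$ and $(E_{\Omega',\tau,\xi}u)(x',x_n)=\int_1^\infty u\big(x',x_n+t\,g^*_{\Omega',\tau,\xi}(x',x_n)\big)\psi(t)\,dt$ for $(x',x_n)\in(\overline{\Omega'})^c$. Write $E^i=E^i_{\Omega_i,\tau,\xi}:=E_{\Omega_i,\tau,\xi}$. **Explicit values used in the paper for the constants.** With $P$ the constant $P_\alpha$ for $|\alpha|=1$, $Q=\frac{q(1+\tau)(1+\xi)^2}{(q+1)\tau^{1+1/q}(1-\xi)^2}\sqrt{1+M_{\Omega'}^2}$ and $B=A_1P(1+\xi)^2(1+\tau)\sqrt{1+M_{\Omega'}^2}$, the paper takes $A_{q,\tau,\xi}(\Omega')=\{(A_0Q)^q+1\}^{1/q}$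 and $A'_{q,\tau,\xi}(\Omega')=\max\{2^{q-1}(A_0Q)^q+1,\,[(n-1)2^{q-1}(BQ)^q+\{(A_0+B)Q\}^q+1]^{1/q}\}$. **Extension operator for $\Omega$.** Let $\chi_i$ be the characteristic function of $U_i^{\frac34\varepsilon}$ and $\lambda_i^\varepsilon:=\chi_i*\rho_{\frac14\varepsilon}$. Let $\chi_0,\chi_+,\chi_-$ be the characteristic functions of $\{x:\mathrm{dist}(x,\Omega)<\tfrac14\varepsilon\}$, $\{x:\mathrm{dist}(x,\partial\Omega)<\tfrac34\varepsilon\}$, $\{x\in\Omega:\mathrm{dist}(x,\partial\Omega)>\tfrac14\varepsilon\}$, and $\lambda_0^\varepsilon:=\chi_0*\rho_{\frac14\varepsilon}$, $\lambda_\pm^\varepsilon:=\chi_\pm*\rho_{\frac14\varepsilon}$, $\Lambda_\pm^\varepsilon:=\lambda_0^\varepsilon\lambda_\pm^\varepsilon/(\lambda_+^\varepsilon+\lambda_-^\varepsilon)$ (understood as $0$ where $\lambda_0^\varepsilon=0$). The extension operator of $\Omega$ is $$(E_{\Omega,\tau,\xi,\varepsilon}u)(x):=\Lambda_+^\varepsilon(x)\,\frac{\sum_{i}\lambda_i^\varepsilon(x)E^i(\lambda_i^\varepsilon u)(x)}{\sum_i\lambda_i^\varepsilon(x)^2}+\Lambda_-^\varepsilon(x)u(x),\qquad x\in\mathbb{R}^n,$$ where $\lambda_i^\varepsilon u$ is extended by $0$ to $\Omega_i\setminus U_i$, the first term is $0$ where $\Lambda_+^\varepsilon=0$, and the second is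 $0$ outside $\Omega$. The number $A_q(\Omega)$ in the claim is the paper's upper bound for the operator norm of $E=E_{\Omega,\tau,\xi,\varepsilon}$, in the sense $\|\nabla(Eu)\|_{L^q(\mathbb{R}^n)}\le A_q(\Omega)(\|\nabla u\|_{L^q(\Omega)}+\sigma^{1/q}\|u\|_{L^q(\Omega)})$ for all $u\in W^{1,q}(\Omega)$. *)

theory Defs
  imports "HOL-Analysis.Analysis" "HOL-Library.Multiset"
begin

definition partial_deriv :: "'a::euclidean_space \<Rightarrow> ('a \<Rightarrow> real) \<Rightarrow> 'a \<Rightarrow> real" where
  "partial_deriv b f x = frechet_derivative f (at x) b"

primrec partial_derivs :: "'a::euclidean_space list \<Rightarrow> ('a \<Rightarrow> real) \<Rightarrow> 'a \<Rightarrow> real" where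
  "partial_derivs [] f = f"
| "partial_derivs (b # bs) f = partial_deriv b (partial_derivs bs f)"

text \<open>Membership in $C^\infty(S)$, for open \<open>S\<close>: every iterated partial derivative is
  differentiable, hence continuous.\<close>

definition smooth_on :: "'a::euclidean_space set \<Rightarrow> ('a \<Rightarrow> real) \<Rightarrow> bool" where
  "smooth_on S f \<longleftrightarrow>
     (\<forall>bs. set bs \<subseteq> Basis \<longrightarrow> (\<forall>x\<in>S. partial_derivs bs f differentiable (at x)))"

definition mollifier :: "('a::euclidean_space \<Rightarrow> real) \<Rightarrow> bool" where
  "mollifier \<rho> \<longleftrightarrow>
     smooth_on UNIV \<rho> \<and> (\<forall>x. 0 \<le> \<rho> x) \<and> (\<forall>x. 1 \<le> norm x \<longrightarrow> \<rho> x = 0) \<and>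
     has_bochner_integral lebesgue \<rho> 1"

definition mollify_scale :: "('a::euclidean_space \<Rightarrow> real) \<Rightarrow> real \<Rightarrow> 'a \<Rightarrow> real" where
  "mollify_scale \<rho> \<delta> x = \<rho> (x /\<^sub>R \<delta>) / \<delta> ^ DIM('a)"

text \<open>Functions are total on the ambient space; only their values on \<open>\<Omega>\<close> matter.\<close>

definition Lp_space :: "'a::euclidean_space set \<Rightarrow> real \<Rightarrow> ('a \<Rightarrow> real) set" where
  "Lp_space \<Omega> p =
     {u. u \<in> borel_measurable (lebesgue_on \<Omega>) \<and>
         integrable (lebesgue_on \<Omega>) (\<lambda>x. \<bar>u x\<bar> powr p)}"

definition Lp_norm :: "'a::euclidean_space set \<Rightarrow> real \<Rightarrow> ('a \<Rightarrow> real) \<Rightarrow> real" where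
  "Lp_norm \<Omega> p u = (\<integral>x. \<bar>u x\<bar> powr p \<partial>lebesgue_on \<Omega>) powr (1 / p)"

definition locally_integrable :: "'a::euclidean_space set \<Rightarrow> ('a \<Rightarrow> real) \<Rightarrow> bool" where
  "locally_integrable \<Omega> u \<longleftrightarrow>
     (\<forall>K. compact K \<and> K \<subseteq> \<Omega> \<longrightarrow> integrable (lebesgue_on K) u)"

definition test_function :: "'a::euclidean_space set \<Rightarrow> ('a \<Rightarrow> real) \<Rightarrow> bool" where
  "test_function \<Omega> \<eta> \<longleftrightarrow>
     smooth_on UNIV \<eta> \<and> compact (closure {x. \<eta> x \<noteq> 0}) \<and> closure {x. \<eta> x \<noteq> 0} \<subseteq> \<Omega>"

definition has_weak_deriv ::
  "'a::euclidean_space set \<Rightarrow> 'a \<Rightarrow> ('a \<Rightarrow> real) \<Rightarrow> ('a \<Rightarrow> real) \<Rightarrow> bool" where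
  "has_weak_deriv \<Omega> b u g \<longleftrightarrow>
     locally_integrable \<Omega> u \<and> locally_integrable \<Omega> g \<and>
     (\<forall>\<eta>. test_function \<Omega> \<eta> \<longrightarrow>
        (\<integral>x. u x * partial_deriv b \<eta> x \<partial>lebesgue_on \<Omega>) = - (\<integral>x. g x * \<eta> x \<partial>lebesgue_on \<Omega>))"

text \<open>Weak derivatives are unique up to null sets, so the choice below does not affect norms.\<close>

definition weak_deriv ::
  "'a::euclidean_space set \<Rightarrow> 'a \<Rightarrow> ('a \<Rightarrow> real) \<Rightarrow> 'a \<Rightarrow> real" where
  "weak_deriv \<Omega> b u = (SOME g. has_weak_deriv \<Omega> b u g)"

definition sobolev :: "'a::euclidean_space set \<Rightarrow> real \<Rightarrow> ('a \<Rightarrow> real) set" where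
  "sobolev \<Omega> q =
     {u \<in> Lp_space \<Omega> q. \<forall>b\<in>Basis. \<exists>g \<in> Lp_space \<Omega> q. has_weak_deriv \<Omega> b u g}"

definition grad_norm :: "'a::euclidean_space set \<Rightarrow> real \<Rightarrow> ('a \<Rightarrow> real) \<Rightarrow> real" where
  "grad_norm \<Omega> q u =
     (\<Sum>b\<in>Basis. \<integral>x. \<bar>weak_deriv \<Omega> b u x\<bar> powr q \<partial>lebesgue_on \<Omega>) powr (1 / q)"

definition sobolev_norm ::
  "'a::euclidean_space set \<Rightarrow> real \<Rightarrow> real \<Rightarrow> ('a \<Rightarrow> real) \<Rightarrow> real" where
  "sobolev_norm \<Omega> q \<sigma> u = (grad_norm \<Omega> q u powr q + \<sigma> * Lp_norm \<Omega> q u powr q) powr (1 / q)"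

text \<open>$\mathbb{R}^n$ with $n \ge 2$ and coordinates $(x', x_n)$ is \<open>(real ^ 'm) \<times> real\<close>, where
  $n = $ \<open>CARD('m) + 1\<close>; its product norm is the Euclidean one.\<close>

definition special_lipschitz_domain :: "((real ^ 'm) \<times> real) set \<Rightarrow> real \<Rightarrow> bool" where
  "special_lipschitz_domain D M \<longleftrightarrow>
     0 < M \<and> (\<exists>\<phi>. D = {(x', xn). \<phi> x' < xn} \<and> (\<forall>x y. \<bar>\<phi> x - \<phi> y\<bar> \<le> M * norm (x - y)))"

text \<open>The overlap number \<open>N\<close>, the open sets \<open>U i\<close>, the special Lipschitz domains \<open>D i\<close> and their
  Lipschitz constants \<open>M i\<close> are part of the data. The radius \<open>r\<close> is unrelated to the admissible
  $\varepsilon$ below.\<close>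

definition minimally_smooth ::
  "((real ^ 'm) \<times> real) set \<Rightarrow> nat \<Rightarrow> (nat \<Rightarrow> ((real ^ 'm) \<times> real) set) \<Rightarrow>
   (nat \<Rightarrow> ((real ^ 'm) \<times> real) set) \<Rightarrow> (nat \<Rightarrow> real) \<Rightarrow> bool" where
  "minimally_smooth \<Omega> N U D M \<longleftrightarrow>
     open \<Omega> \<and> 1 \<le> N \<and> (\<forall>i. open (U i)) \<and>
     (\<exists>r>0. \<forall>x\<in>frontier \<Omega>. \<exists>i. ball x r \<subseteq> U i) \<and>
     (\<forall>x. finite {i. x \<in> U i} \<and> card {i. x \<in> U i} \<le> N) \<and>
     (\<exists>M0>0. \<forall>i. special_lipschitz_domain (D i) (M i) \<and> M i \<le> M0 \<and> U i \<inter> \<Omega> = U i \<inter> D i)"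

definition shrink :: "'a::metric_space set \<Rightarrow> real \<Rightarrow> 'a set" where
  "shrink S \<delta> = {x. ball x \<delta> \<subseteq> S}"

text \<open>The library sets \<open>infdist x {} = 0\<close>, whereas here the distance to an empty boundary is
  infinite; hence the first conjunct in the premise of the covering condition.\<close>

definition admissible :: "'a::metric_space set \<Rightarrow> (nat \<Rightarrow> 'a set) \<Rightarrow> real \<Rightarrow> bool" where
  "admissible \<Omega> U \<epsilon> \<longleftrightarrow>
     0 < \<epsilon> \<and> (\<forall>i. shrink (U i) (3/4 * \<epsilon>) \<noteq> {}) \<and>
     (\<forall>x. frontier \<Omega> \<noteq> {} \<and> infdist x (frontier \<Omega>) \<le> \<epsilon> / 2 \<longrightarrow>
          (\<exists>i. x \<in> shrink (U i) (1/2 * \<epsilon>)))"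

text \<open>A list \<open>bs\<close> of basis vectors stands for the multi-index \<open>mset bs\<close>, of order \<open>length bs\<close>. For
  smooth functions the order of differentiation is irrelevant. The constants \<open>P\<close> are common to all
  closed sets and all \<open>\<xi>\<close>.\<close>

definition regularized_distance ::
  "('a::euclidean_space multiset \<Rightarrow> real) \<Rightarrow> ('a set \<Rightarrow> real \<Rightarrow> 'a \<Rightarrow> real) \<Rightarrow> bool" where
  "regularized_distance P RD \<longleftrightarrow>
     (\<forall>S \<xi>. closed S \<and> S \<noteq> {} \<and> 0 < \<xi> \<and> \<xi> < 1 \<longrightarrow>
        smooth_on (- S) (RD S \<xi>) \<and>
        (\<forall>x\<in>- S.
           (1 + \<xi>) powi (-2) * infdist x S \<le> RD S \<xi> x \<and>
           RD S \<xi> x \<le> (1 - \<xi>) powi (-2) * infdist x S \<and>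
           (\<forall>bs. set bs \<subseteq> Basis \<and> bs \<noteq> [] \<longrightarrow>
              \<bar>partial_derivs bs (RD S \<xi>) x\<bar>
                \<le> P (mset bs) * (\<xi> * infdist x S) powi (1 - int (length bs)))))"

definition extension_kernel :: "(real \<Rightarrow> real) \<Rightarrow> real \<Rightarrow> real \<Rightarrow> bool" where
  "extension_kernel \<psi> A0 A1 \<longleftrightarrow>
     has_bochner_integral (lebesgue_on {1..}) \<psi> 1 \<and>
     (\<forall>m\<ge>1. has_bochner_integral (lebesgue_on {1..}) (\<lambda>t. t ^ m * \<psi> t) 0) \<and>
     (\<forall>t\<ge>1. \<bar>\<psi> t\<bar> \<le> A0 / t ^ 2) \<and> (\<forall>t\<ge>1. \<bar>\<psi> t\<bar> \<le> A1 / t ^ 3)"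

definition lip_ext ::
  "(((real ^ 'm) \<times> real) set \<Rightarrow> real \<Rightarrow> (real ^ 'm) \<times> real \<Rightarrow> real) \<Rightarrow> (real \<Rightarrow> real) \<Rightarrow>
   ((real ^ 'm) \<times> real) set \<Rightarrow> real \<Rightarrow> real \<Rightarrow> real \<Rightarrow>
   ((real ^ 'm) \<times> real \<Rightarrow> real) \<Rightarrow> (real ^ 'm) \<times> real \<Rightarrow> real" where
  "lip_ext RD \<psi> D M \<tau> \<xi> u = (\<lambda>(x', xn).
     let g = (1 + \<tau>) * (1 + \<xi>) ^ 2 * sqrt (1 + M ^ 2) * RD (closure D) \<xi> (x', xn)
     in if (x', xn) \<in> closure D then u (x', xn)
        else (\<integral>t. u (x', xn + t * g) * \<psi> t \<partial>lebesgue_on {1..}))"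

end

theory Submission
  imports Defs
begin

text \<open>
  Since \<open>u\<close> need only be extended with a controlled gradient, the extension operator may be replaced
  by a more economical one: with cutoffs \<open>lam i\<close> and \<open>\<phi> i\<close> supported in \<open>U i\<close> such that \<open>lam i = 1\<close>
  on the support of \<open>\<phi> i\<close> and \<open>\<Sum>i. \<phi> i = 1\<close> near the boundary of \<open>\<Omega>\<close>, put
  \<open>w = (\<Sum>i. \<phi> i * E i (lam i * u)) + \<theta> * u\<close>, where \<open>\<theta> = 1 - (\<Sum>i. \<phi> i)\<close> on \<open>\<Omega>\<close> and \<open>\<theta> = 0\<close> elsewhere.
  Then \<open>w = u\<close> on \<open>\<Omega>\<close>, so its gradient there is that of \<open>u\<close>, while off \<open>\<Omega>\<close> only the first sum
  contributes. The cutoffs are mollified Lipschitz functions of the distance to the shrunken sets; a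
  Lipschitz constant slightly above \<open>4 / \<epsilon>\<close> suffices, and \<open>4 / \<epsilon> \<le> b\<close> follows from integrating
  \<open>x\<^sub>j * \<partial>\<^sub>j \<rho>\<close> by parts. Instead of Minkowski's inequality, the
  convexity of \<open>x \<mapsto> x\<^sup>q\<close> with weights adapted to \<open>A\<close> and \<open>A'\<close> combines the three error terms.
\<close>

section \<open>Smooth functions\<close>

lemma partial_deriv_eq:
  "(f has_derivative f') (at x) \<Longrightarrow> partial_deriv b f x = f' b"
  by (simp add: partial_deriv_def frechet_derivative_at[symmetric])

lemma partial_deriv_local:
  assumes "open V" "x \<in> V" and eq: "\<And>y. y \<in> V \<Longrightarrow> f y = g y"
  shows "f differentiable (at x) \<longleftrightarrow> g differentiable (at x)"
    and "partial_deriv b f x = partial_deriv b g x"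
proof -
  have *: "(f has_derivative D) (at x) \<longleftrightarrow> (g has_derivative D) (at x)" for D
    using has_derivative_transform_within_open[OF _ assms(1,2)] eq by metis
  show "f differentiable (at x) \<longleftrightarrow> g differentiable (at x)"
    unfolding differentiable_def * ..
  show "partial_deriv b f x = partial_deriv b g x"
    unfolding partial_deriv_def frechet_derivative_def * ..
qed

lemma partial_derivs_local:
  assumes "open V" "x \<in> V" "\<And>y. y \<in> V \<Longrightarrow> f y = g y"
  shows "partial_derivs bs f x = partial_derivs bs g x"
  using assms(2)
proof (induction bs arbitrary: x)
  case (Cons b bs)
  show ?case
    using partial_deriv_local(2)[OF assms(1) Cons.prems Cons.IH] by simp
qed (use assms in simp)

lemma partial_derivs_snoc: "partial_derivs (bs @ [b]) f = partial_derivs bs (partial_deriv b f)"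
  by (induction bs) auto

lemma smooth_on_localI:
  assumes "\<And>x. \<exists>V g. open V \<and> x \<in> V \<and> smooth_on UNIV g \<and> (\<forall>y\<in>V. f y = g y)"
  shows "smooth_on UNIV f"
  unfolding smooth_on_def
proof (intro allI impI ballI)
  fix bs :: "'a list" and x assume bs: "set bs \<subseteq> Basis"
  obtain V g where V: "open V" "x \<in> V" "smooth_on UNIV g" "\<forall>y\<in>V. f y = g y"
    using assms by blast
  have "partial_derivs bs f y = partial_derivs bs g y" if "y \<in> V" for y
    using partial_derivs_local[OF V(1) that] V(4) by blast
  then have "partial_derivs bs f differentiable at x \<longleftrightarrow> partial_derivs bs g differentiable at x"
    by (intro partial_deriv_local(1)[OF V(1,2)])
  then show "partial_derivs bs f differentiable at x"
    using V(3) bs by (auto simp: smooth_on_def)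
qed

lemma smooth_on_differentiable: "smooth_on UNIV f \<Longrightarrow> f differentiable (at x)"
  unfolding smooth_on_def by (drule spec[of _ "[]"]) simp

lemma smooth_on_partial_deriv:
  "smooth_on UNIV f \<Longrightarrow> b \<in> Basis \<Longrightarrow> smooth_on UNIV (partial_deriv b f)"
  unfolding smooth_on_def partial_derivs_snoc[symmetric] by simp

lemma smooth_on_continuous: "smooth_on UNIV f \<Longrightarrow> continuous_on S f"
  using smooth_on_differentiable differentiable_imp_continuous_within
  by (metis continuous_at_imp_continuous_on)

lemma smooth_on_has_derivative:
  assumes "smooth_on UNIV f"
  shows "(f has_derivative (\<lambda>h. \<Sum>b\<in>Basis. (h \<bullet> b) * partial_deriv b f x)) (at x)"
proof -
  let ?D = "frechet_derivative f (at x)"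
  have D: "(f has_derivative ?D) (at x)"
    using smooth_on_differentiable[OF assms] frechet_derivative_works by blast
  then have lin: "linear ?D" by (rule has_derivative_linear)
  have "?D h = (\<Sum>b\<in>Basis. (h \<bullet> b) * partial_deriv b f x)" for h
  proof -
    have "?D h = ?D (\<Sum>b\<in>Basis. (h \<bullet> b) *\<^sub>R b)" by (simp add: euclidean_representation)
    also have "\<dots> = (\<Sum>b\<in>Basis. (h \<bullet> b) *\<^sub>R ?D b)"
      by (simp add: linear_sum[OF lin] linear_scale[OF lin])
    finally show ?thesis by (simp add: partial_deriv_def)
  qed
  then have "?D = (\<lambda>h. \<Sum>b\<in>Basis. (h \<bullet> b) * partial_deriv b f x)" by (rule ext)
  then show ?thesis using D by simp
qed

lemma smooth_on_coinduct:
  assumes "F f"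
    and "\<And>g x. F g \<Longrightarrow> g differentiable (at x)"
    and "\<And>g b. F g \<Longrightarrow> b \<in> Basis \<Longrightarrow> F (partial_deriv b g)"
  shows "smooth_on UNIV f"
proof -
  have "F (partial_derivs bs f)" if "set bs \<subseteq> Basis" for bs
    using that by (induction bs) (auto intro: assms)
  then show ?thesis unfolding smooth_on_def using assms(2) by blast
qed

lemma partial_deriv_add:
  "f differentiable (at x) \<Longrightarrow> g differentiable (at x) \<Longrightarrow>
    partial_deriv b (\<lambda>x. f x + g x) x = partial_deriv b f x + partial_deriv b g x"
  unfolding frechet_derivative_works
  by (subst partial_deriv_eq, erule (1) has_derivative_add) (simp add: partial_deriv_def)

lemma partial_deriv_mult:
  "f differentiable (at x) \<Longrightarrow> g differentiable (at x) \<Longrightarrow>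
    partial_deriv b (\<lambda>x. f x * g x) x = f x * partial_deriv b g x + partial_deriv b f x * g x"
  unfolding frechet_derivative_works
  by (subst partial_deriv_eq, erule (1) has_derivative_mult) (simp add: partial_deriv_def)

lemma partial_deriv_const: "partial_deriv b (\<lambda>x. c) = (\<lambda>x. 0)"
  by (rule ext, subst partial_deriv_eq, rule has_derivative_const) simp

lemma smooth_on_const: "smooth_on UNIV (\<lambda>x. c)"
  by (rule smooth_on_coinduct[where F = "\<lambda>f. \<exists>c. f = (\<lambda>x. c)"]) (auto simp: partial_deriv_const)

lemma smooth_on_inner: "smooth_on UNIV (\<lambda>x. x \<bullet> a)"
proof (rule smooth_on_coinduct[where F = "\<lambda>f. f = (\<lambda>x. x \<bullet> a) \<or> smooth_on UNIV f"])
  have "((\<lambda>x. x \<bullet> a) has_derivative (\<lambda>h. h \<bullet> a)) (at x)" for x :: 'a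
    by (auto intro!: derivative_eq_intros)
  then have D: "(\<lambda>x. x \<bullet> a) differentiable (at x)"
      "partial_deriv b (\<lambda>x. x \<bullet> a) x = b \<bullet> a" for x b :: 'a
    using partial_deriv_eq[of "\<lambda>x. x \<bullet> a" "\<lambda>h. h \<bullet> a"] by (auto simp: differentiable_def)
  show "g differentiable (at x)" if "g = (\<lambda>x. x \<bullet> a) \<or> smooth_on UNIV g" for g x
    using that D smooth_on_differentiable by blast
  show "partial_deriv b g = (\<lambda>x. x \<bullet> a) \<or> smooth_on UNIV (partial_deriv b g)"
    if "g = (\<lambda>x. x \<bullet> a) \<or> smooth_on UNIV g" "b \<in> Basis" for g b
    using that D(2)[of b, THEN ext[of "partial_deriv b (\<lambda>x. x \<bullet> a)" "\<lambda>_. b \<bullet> a"]]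
    by (auto intro: smooth_on_partial_deriv smooth_on_const)
qed simp

lemma smooth_on_add:
  assumes "smooth_on UNIV f" "smooth_on UNIV g"
  shows "smooth_on UNIV (\<lambda>x. f x + g x)"
proof (rule smooth_on_coinduct
    [where F = "\<lambda>h. \<exists>f g. smooth_on UNIV f \<and> smooth_on UNIV g \<and> h = (\<lambda>x. f x + g x)"])
  fix h and b :: 'a assume "b \<in> Basis"
    and "\<exists>f g. smooth_on UNIV f \<and> smooth_on UNIV g \<and> h = (\<lambda>x::'a. f x + g x)"
  then obtain f g where fg: "smooth_on UNIV f" "smooth_on UNIV g" and h: "h = (\<lambda>x. f x + g x)"
    by blast
  have "partial_deriv b h = (\<lambda>x. partial_deriv b f x + partial_deriv b g x)"
    unfolding h using fg by (intro ext partial_deriv_add smooth_on_differentiable)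
  then show "\<exists>f g. smooth_on UNIV f \<and> smooth_on UNIV g \<and> partial_deriv b h = (\<lambda>x. f x + g x)"
    using fg \<open>b \<in> Basis\<close> smooth_on_partial_deriv by blast
qed (use assms in \<open>auto intro!: differentiable_add intro: smooth_on_differentiable\<close>)

lemma smooth_on_sum:
  "(\<And>i. i \<in> I \<Longrightarrow> smooth_on UNIV (f i)) \<Longrightarrow> smooth_on UNIV (\<lambda>x. \<Sum>i\<in>I. f i x)"
  by (induction I rule: infinite_finite_induct) (auto intro: smooth_on_add smooth_on_const)

text \<open>The class of finite sums of products is closed under partial differentiation.\<close>

lemma smooth_on_mult:
  assumes "smooth_on UNIV f" "smooth_on UNIV g"
  shows "smooth_on UNIV (\<lambda>x. f x * g x)"
proof -
  define F :: "('a \<Rightarrow> real) \<Rightarrow> bool" where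
    "F h \<longleftrightarrow> (\<exists>ps. (\<forall>(f, g)\<in>set ps. smooth_on UNIV f \<and> smooth_on UNIV g) \<and>
                     h = (\<lambda>x. \<Sum>(f, g)\<leftarrow>ps. f x * g x))" for h
  have D: "(\<lambda>x. \<Sum>(f, g)\<leftarrow>ps. f x * g x) differentiable (at x)"
    if "\<forall>(f, g)\<in>set ps. smooth_on UNIV f \<and> smooth_on UNIV g" for ps :: "(('a\<Rightarrow>real) \<times> _) list" and x
    using that by (induction ps)
      (auto intro!: differentiable_add differentiable_mult intro: smooth_on_differentiable)
  have P: "F (partial_deriv b (\<lambda>x. \<Sum>(f, g)\<leftarrow>ps. f x * g x))"
    if "\<forall>(f, g)\<in>set ps. smooth_on UNIV f \<and> smooth_on UNIV g" "b \<in> Basis"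
    for ps :: "(('a\<Rightarrow>real) \<times> _) list" and b
    using that(1)
  proof (induction ps)
    case Nil
    then show ?case by (auto simp: F_def partial_deriv_const intro: exI[of _ "[]"])
  next
    case (Cons p ps)
    obtain f g where p: "p = (f, g)" by fastforce
    have fg: "smooth_on UNIV f" "smooth_on UNIV g" using Cons.prems p by auto
    obtain qs where qs: "\<forall>(f, g)\<in>set qs. smooth_on UNIV f \<and> smooth_on UNIV g"
      "partial_deriv b (\<lambda>x. \<Sum>(f, g)\<leftarrow>ps. f x * g x) = (\<lambda>x. \<Sum>(f, g)\<leftarrow>qs. f x * g x)"
      using Cons unfolding F_def by auto
    have "partial_deriv b (\<lambda>x. \<Sum>(f, g)\<leftarrow>p # ps. f x * g x) =
        (\<lambda>x. \<Sum>(f, g)\<leftarrow>(f, partial_deriv b g) # (partial_deriv b f, g) # qs. f x * g x)"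
      using fg Cons.prems D[of ps] fun_cong[OF qs(2)]
      by (auto simp: p partial_deriv_add partial_deriv_mult smooth_on_differentiable
            differentiable_mult intro!: ext)
    moreover have "\<forall>(f, g)\<in>set ((f, partial_deriv b g) # (partial_deriv b f, g) # qs).
        smooth_on UNIV f \<and> smooth_on UNIV g"
      using qs(1) fg \<open>b \<in> Basis\<close> by (auto intro: smooth_on_partial_deriv)
    ultimately show ?case unfolding F_def by blast
  qed
  have "F (\<lambda>x. f x * g x)"
    unfolding F_def by (rule exI[of _ "[(f, g)]"]) (use assms in simp)
  then show ?thesis
  proof (rule smooth_on_coinduct)
    show "\<And>g x. F g \<Longrightarrow> g differentiable (at x)" using D unfolding F_def by blast
    show "F (partial_deriv b g)" if "F g" "b \<in> Basis" for g b
      using that(1) P[OF _ that(2)] unfolding F_def[of g] by blast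
  qed
qed

lemma smooth_on_diff:
  assumes "smooth_on UNIV f" "smooth_on UNIV g"
  shows "smooth_on UNIV (\<lambda>x. f x - g x)"
  using smooth_on_add[OF assms(1) smooth_on_mult[OF smooth_on_const[of "-1"] assms(2)]] by simp

lemma smooth_on_scale:
  assumes "smooth_on UNIV f"
  shows "smooth_on UNIV (\<lambda>x. f (c *\<^sub>R x) * k)"
proof (rule smooth_on_coinduct[where
      F = "\<lambda>h. \<exists>f k. smooth_on UNIV f \<and> h = (\<lambda>x. f (c *\<^sub>R x) * k)"])
  have D: "((\<lambda>x. f (c *\<^sub>R x) * k) has_derivative
      (\<lambda>h. (\<Sum>b\<in>Basis. ((c *\<^sub>R h) \<bullet> b) * partial_deriv b f (c *\<^sub>R x)) * k)) (at x)"
    if "smooth_on UNIV f" for f :: "'a \<Rightarrow> real" and x k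
    by (intro has_derivative_mult_left has_derivative_compose[OF _ smooth_on_has_derivative[OF that]])
       (auto intro!: derivative_eq_intros)
  show "g differentiable (at x)" if "\<exists>f k. smooth_on UNIV f \<and> g = (\<lambda>x. f (c *\<^sub>R x) * k)" for g and x :: 'a
    using that differentiableI[OF D] by blast
  fix g :: "'a \<Rightarrow> real" and b :: 'a assume "\<exists>f k. smooth_on UNIV f \<and> g = (\<lambda>x. f (c *\<^sub>R x) * k)" and b: "b \<in> Basis"
  then obtain f k where f: "smooth_on UNIV f" and g: "g = (\<lambda>x. f (c *\<^sub>R x) * k)" by blast
  have "partial_deriv b g = (\<lambda>x. partial_deriv b f (c *\<^sub>R x) * (c * k))"
  proof
    fix x
    have "(\<Sum>i\<in>Basis. c * (b \<bullet> i) * partial_deriv i f (c *\<^sub>R x)) = c * partial_deriv b f (c *\<^sub>R x)"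
      using b by (simp add: inner_Basis if_distrib if_distribR cong: if_cong)
    then show "partial_deriv b g x = partial_deriv b f (c *\<^sub>R x) * (c * k)"
      unfolding g partial_deriv_eq[OF D[OF f]] by simp
  qed
  then show "\<exists>f k. smooth_on UNIV f \<and> partial_deriv b g = (\<lambda>x. f (c *\<^sub>R x) * k)"
    using smooth_on_partial_deriv[OF f b] by blast
qed (use assms in blast)

lemma partial_deriv_support:
  assumes "x \<notin> closure {x. f x \<noteq> 0}"
  shows "partial_deriv b f x = 0"
proof -
  have "partial_deriv b f x = partial_deriv b (\<lambda>_. 0) x"
  proof (rule partial_deriv_local(2)[of "- closure {x. f x \<noteq> 0}"])
    fix y assume "y \<in> - closure {x. f x \<noteq> 0}"
    then show "f y = 0" using closure_subset[of "{x. f x \<noteq> 0}"] by blast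
  qed (use assms in auto)
  then show ?thesis unfolding partial_deriv_const .
qed

lemma bounded_support_partial_deriv:
  "bounded {x. f x \<noteq> 0} \<Longrightarrow> bounded {x. partial_deriv b f x \<noteq> 0}"
  using partial_deriv_support by (elim bounded_subset[OF bounded_closure]) blast

lemma integrable_continuous_bounded_support:
  fixes k :: "'a::euclidean_space \<Rightarrow> real"
  assumes "continuous_on UNIV k" "bounded {x. k x \<noteq> 0}"
  shows "integrable lborel k"
proof -
  have "integrable lborel (\<lambda>x. indicator (closure {x. k x \<noteq> 0}) x *\<^sub>R k x)"
    using assms by (intro borel_integrable_compact) (auto simp: compact_closure intro: continuous_on_subset)
  moreover have "(\<lambda>x. indicator (closure {x. k x \<noteq> 0}) x *\<^sub>R k x) = k"
    using closure_subset[of "{x. k x \<noteq> 0}"] by (intro ext) (auto simp: indicator_def)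
  ultimately show ?thesis by (simp only:)
qed

lemma integral_continuous_cbox:
  fixes k :: "'a::euclidean_space \<Rightarrow> real"
  assumes "continuous_on UNIV k" "{x. k x \<noteq> 0} \<subseteq> cbox a b"
  shows "integral\<^sup>L lborel k = integral (cbox a b) k"
proof -
  have "integrable lborel k"
    using assms by (intro integrable_continuous_bounded_support) (auto intro: bounded_subset bounded_cbox)
  then have "(k has_integral integral\<^sup>L lborel k) UNIV"
    by (rule has_integral_integral_lborel)
  then have "((\<lambda>x. if x \<in> cbox a b then k x else 0) has_integral integral\<^sup>L lborel k) UNIV"
    by (rule has_integral_eq[rotated]) (use assms(2) in auto)
  then show ?thesis unfolding has_integral_restrict_UNIV by (simp add: integral_unique)
qed

lemma continuous_on_conv_integrand:
  fixes f g :: "'a::euclidean_space \<Rightarrow> real"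
  assumes "continuous_on UNIV f" "continuous_on UNIV g"
  shows "continuous_on S (\<lambda>y. f y * g (x - y))"
  by (intro continuous_intros continuous_on_subset[OF assms(1)] continuous_on_compose2[OF assms(2)]) auto

lemma conv_has_derivative:
  fixes f g :: "'a::euclidean_space \<Rightarrow> real"
  assumes f: "continuous_on UNIV f" and g: "smooth_on UNIV g" and bd: "bounded {z. g z \<noteq> 0}"
  shows "((\<lambda>x. \<integral>y. f y * g (x - y) \<partial>lborel) has_derivative
      (\<lambda>h. \<Sum>b\<in>Basis. (h \<bullet> b) * (\<integral>y. f y * partial_deriv b g (x0 - y) \<partial>lborel))) (at x0)"
proof -
  obtain r where r: "\<And>z. z \<in> closure {z. g z \<noteq> 0} \<Longrightarrow> norm z \<le> r"
    using bounded_closure[OF bd] unfolding bounded_iff by blast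
  obtain a where a: "cball x0 (r + 1) \<subseteq> cbox (-a) a"
    using bounded_subset_cbox_symmetric bounded_cball by blast
  let ?C = "cbox (-a) a"
  have cg: "continuous_on UNIV (partial_deriv b g)" if "b \<in> Basis" for b
    using that by (intro smooth_on_continuous smooth_on_partial_deriv g)
  have in_C: "y \<in> ?C" if "x \<in> ball x0 1" "x - y \<in> closure {z. g z \<noteq> 0}" for x y
  proof -
    have "dist x0 y \<le> dist x0 x + norm (x - y)" by (metis dist_norm dist_triangle)
    then have "dist x0 y \<le> r + 1" using that r[OF that(2)] by (auto simp: mem_ball)
    then show ?thesis using a by auto
  qed
  define fx :: "'a \<Rightarrow> 'a \<Rightarrow> 'a \<Rightarrow>\<^sub>L real" where
    "fx x y = (\<Sum>b\<in>Basis. (f y * partial_deriv b g (x - y)) *\<^sub>R blinfun_inner_left b)" for x y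
  have fx_apply: "blinfun_apply (fx x y) h = (\<Sum>b\<in>Basis. (h \<bullet> b) * (f y * partial_deriv b g (x - y)))"
    for x y h
    by (simp add: fx_def blinfun.bilinear_simps blinfun.sum_left mult.commute)
  have cont: "continuous_on (ball x0 1 \<times> ?C) (\<lambda>(x, y). fx x y)"
    unfolding fx_def split_beta
    by (intro continuous_intros continuous_on_compose2[OF f] continuous_on_compose2[OF cg]) auto
  have "((\<lambda>x. integral ?C (\<lambda>y. f y * g (x - y))) has_derivative
      blinfun_apply (integral ?C (fx x0))) (at x0 within ball x0 1)"
  proof (rule leibniz_rule[OF _ _ cont])
    fix x y
    have "((\<lambda>x. f y * g (x - y)) has_derivative
        (\<lambda>h. f y * (\<Sum>b\<in>Basis. (h \<bullet> b) * partial_deriv b g (x - y)))) (at x within ball x0 1)"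
      by (rule has_derivative_mult_right, rule has_derivative_compose[OF _ smooth_on_has_derivative[OF g]])
         (auto intro!: derivative_eq_intros)
    moreover have "(\<lambda>h. f y * (\<Sum>b\<in>Basis. (h \<bullet> b) * partial_deriv b g (x - y))) = blinfun_apply (fx x y)"
      by (auto simp: fx_apply sum_distrib_left mult_ac)
    ultimately show "((\<lambda>x. f y * g (x - y)) has_derivative blinfun_apply (fx x y)) (at x within ball x0 1)"
      by simp
  next
    show "(\<lambda>y. f y * g (x - y)) integrable_on ?C" for x
      by (intro integrable_continuous continuous_on_conv_integrand f smooth_on_continuous g)
  qed auto
  then have D: "((\<lambda>x. integral ?C (\<lambda>y. f y * g (x - y))) has_derivative
      blinfun_apply (integral ?C (fx x0))) (at x0)"
    by (subst (asm) at_within_open) auto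
  have "blinfun_apply (integral ?C (fx x0)) h =
      (\<Sum>b\<in>Basis. (h \<bullet> b) * (\<integral>y. f y * partial_deriv b g (x0 - y) \<partial>lborel))" for h
  proof -
    have "continuous_on ?C (fx x0)"
      using continuous_on_compose2[OF cont, of ?C "\<lambda>y. (x0, y)"]
      by (simp add: continuous_on_Pair continuous_on_const continuous_on_id image_subset_iff)
    then have "fx x0 integrable_on ?C" by (rule integrable_continuous)
    from integral_linear[OF this blinfun.bounded_linear_left[of h]]
    have "blinfun_apply (integral ?C (fx x0)) h = integral ?C (\<lambda>y. blinfun_apply (fx x0 y) h)"
      by (simp add: o_def)
    also have "\<dots> = (\<Sum>b\<in>Basis. integral ?C (\<lambda>y. (h \<bullet> b) * (f y * partial_deriv b g (x0 - y))))"
      unfolding fx_apply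
      by (intro integral_sum integrable_continuous continuous_on_mult continuous_on_const
          continuous_on_conv_integrand f cg) auto
    also have "\<dots> = (\<Sum>b\<in>Basis. (h \<bullet> b) * (\<integral>y. f y * partial_deriv b g (x0 - y) \<partial>lborel))"
    proof (intro sum.cong refl)
      fix b :: 'a assume b: "b \<in> Basis"
      have "{y. f y * partial_deriv b g (x0 - y) \<noteq> 0} \<subseteq> ?C"
        using in_C[of x0, OF centre_in_ball[THEN iffD2, OF zero_less_one]]
          partial_deriv_support[of _ g b] by auto
      then have "(\<integral>y. f y * partial_deriv b g (x0 - y) \<partial>lborel) =
          integral ?C (\<lambda>y. f y * partial_deriv b g (x0 - y))"
        by (intro integral_continuous_cbox continuous_on_conv_integrand f cg b)
      then show "integral ?C (\<lambda>y. (h \<bullet> b) * (f y * partial_deriv b g (x0 - y))) =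
          (h \<bullet> b) * (\<integral>y. f y * partial_deriv b g (x0 - y) \<partial>lborel)"
        by simp
    qed
    finally show ?thesis .
  qed
  then have "blinfun_apply (integral ?C (fx x0)) =
      (\<lambda>h. \<Sum>b\<in>Basis. (h \<bullet> b) * (\<integral>y. f y * partial_deriv b g (x0 - y) \<partial>lborel))" by (rule ext)
  note D = D[unfolded this]
  show ?thesis
  proof (rule has_derivative_transform_within_open[OF D, of "ball x0 1"])
    fix x assume x: "x \<in> ball x0 1"
    have "{y. f y * g (x - y) \<noteq> 0} \<subseteq> ?C"
      using in_C[OF x] closure_subset[of "{z. g z \<noteq> 0}"] by auto
    then show "integral ?C (\<lambda>y. f y * g (x - y)) = (\<integral>y. f y * g (x - y) \<partial>lborel)"
      by (intro integral_continuous_cbox[symmetric] continuous_on_conv_integrand f smooth_on_continuous g)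
  qed auto
qed

lemma sum_Basis_inner_mult:
  "b \<in> Basis \<Longrightarrow> (\<Sum>i\<in>Basis. (b \<bullet> i) * (f i :: real)) = f b"
  by (subst sum.remove[of _ b]) (auto simp: inner_Basis intro!: sum.neutral split: if_splits)

lemma partial_deriv_conv:
  fixes f g :: "'a::euclidean_space \<Rightarrow> real"
  assumes "continuous_on UNIV f" "smooth_on UNIV g" "bounded {z. g z \<noteq> 0}" "b \<in> Basis"
  shows "partial_deriv b (\<lambda>x. \<integral>y. f y * g (x - y) \<partial>lborel) =
    (\<lambda>x. \<integral>y. f y * partial_deriv b g (x - y) \<partial>lborel)"
proof
  fix x
  have "(\<Sum>i\<in>Basis. (b \<bullet> i) * (\<integral>y. f y * partial_deriv i g (x - y) \<partial>lborel)) =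
      (\<integral>y. f y * partial_deriv b g (x - y) \<partial>lborel)"
    using assms(4) by (rule sum_Basis_inner_mult)
  then show "partial_deriv b (\<lambda>x. \<integral>y. f y * g (x - y) \<partial>lborel) x =
    (\<integral>y. f y * partial_deriv b g (x - y) \<partial>lborel)"
    unfolding partial_deriv_eq[OF conv_has_derivative[OF assms(1-3)]] .
qed

lemma smooth_on_conv:
  fixes f g :: "'a::euclidean_space \<Rightarrow> real"
  assumes "continuous_on UNIV f" "smooth_on UNIV g" "bounded {z. g z \<noteq> 0}"
  shows "smooth_on UNIV (\<lambda>x. \<integral>y. f y * g (x - y) \<partial>lborel)"
proof (rule smooth_on_coinduct[where F = "\<lambda>h. \<exists>g. smooth_on UNIV g \<and> bounded {z. g z \<noteq> 0} \<and>
      h = (\<lambda>x. \<integral>y. f y * g (x - y) \<partial>lborel)"])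
  fix h :: "'a \<Rightarrow> real" and x b :: 'a
  assume "\<exists>g. smooth_on UNIV g \<and> bounded {z. g z \<noteq> 0} \<and> h = (\<lambda>x. \<integral>y. f y * g (x - y) \<partial>lborel)"
  then obtain g where g: "smooth_on UNIV g" "bounded {z. g z \<noteq> 0}"
    and h: "h = (\<lambda>x. \<integral>y. f y * g (x - y) \<partial>lborel)" by blast
  show "h differentiable (at x)"
    unfolding h by (rule differentiableI[OF conv_has_derivative[OF assms(1) g]])
  assume "b \<in> Basis"
  then show "\<exists>g. smooth_on UNIV g \<and> bounded {z. g z \<noteq> 0} \<and>
      partial_deriv b h = (\<lambda>x. \<integral>y. f y * g (x - y) \<partial>lborel)"
    unfolding h partial_deriv_conv[OF assms(1) g \<open>b \<in> Basis\<close>]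
    using g smooth_on_partial_deriv bounded_support_partial_deriv by blast
qed (use assms in blast)

lemma integral_lborel_diff:
  fixes g :: "'a::euclidean_space \<Rightarrow> real"
  shows "(\<integral>y. g (x - y) \<partial>lborel) = (\<integral>y. g y \<partial>lborel)"
    and "integrable lborel (\<lambda>y. g (x - y)) \<longleftrightarrow> integrable lborel g"
proof -
  have d: "distr lborel borel (\<lambda>y. x - y) = (lborel :: 'a measure)"
    using lborel_affine[of "-1" x] by (simp add: density_1 one_ennreal_def[symmetric])
  have *: "(\<integral>y. g (x - y) \<partial>lborel) = (\<integral>y. g y \<partial>lborel)" if "g \<in> borel_measurable borel" for g :: "'a \<Rightarrow> real"
    using integral_distr[of "\<lambda>y. x - y" lborel borel g] that by (simp add: d)
  show **: "integrable lborel (\<lambda>y. g (x - y)) \<longleftrightarrow> integrable lborel g" for g :: "'a \<Rightarrow> real"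
  proof (cases "g \<in> borel_measurable borel")
    case True
    then show ?thesis using integrable_distr_eq[of "\<lambda>y. x - y" lborel borel g] by (simp add: d)
  next
    case False
    have "g \<in> borel_measurable borel" if "(\<lambda>y. g (x - y)) \<in> borel_measurable borel"
      using measurable_compose[OF _ that, of "\<lambda>y. x - y" borel] by simp
    then show ?thesis using False borel_measurable_integrable by force
  qed
  show "(\<integral>y. g (x - y) \<partial>lborel) = (\<integral>y. g y \<partial>lborel)"
  proof (cases "integrable lborel g")
    case True
    then show ?thesis using *[of g] by simp
  next
    case False
    then show ?thesis using **[of g] by (simp add: not_integrable_integral_eq)
  qed
qed

text \<open>Differentiate the convolution of \<open>g\<close> with the constant 1, which is constant.\<close>

lemma integral_partial_deriv:
  fixes g :: "'a::euclidean_space \<Rightarrow> real"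
  assumes "smooth_on UNIV g" "bounded {z. g z \<noteq> 0}" "b \<in> Basis"
  shows "(\<integral>x. partial_deriv b g x \<partial>lborel) = 0"
proof -
  have "partial_deriv b (\<lambda>x. \<integral>y. 1 * g (x - y) \<partial>lborel) 0 = (\<integral>y. 1 * partial_deriv b g (0 - y) \<partial>lborel)"
    by (subst partial_deriv_conv) (use assms in auto)
  then show ?thesis
    using integral_lborel_diff(1)[of g] integral_lborel_diff(1)[of "partial_deriv b g" 0]
    by (simp add: partial_deriv_const)
qed

section \<open>Mollification\<close>

definition mollify :: "('a::euclidean_space \<Rightarrow> real) \<Rightarrow> real \<Rightarrow> ('a \<Rightarrow> real) \<Rightarrow> 'a \<Rightarrow> real" where
  "mollify \<rho> \<kappa> f x = (\<integral>y. f (x - y) * mollify_scale \<rho> \<kappa> y \<partial>lborel)"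

lemma integral_lebesgue_continuous:
  fixes f :: "'a::euclidean_space \<Rightarrow> real"
  assumes "continuous_on UNIV f"
  shows "integral\<^sup>L lebesgue f = integral\<^sup>L lborel f"
    and "integrable lebesgue f \<longleftrightarrow> integrable lborel f"
  using borel_measurable_continuous_onI[OF assms]
  by (simp_all add: integral_completion integrable_completion)

lemma lipschitz_partial_deriv_bound:
  fixes F :: "'a::euclidean_space \<Rightarrow> real"
  assumes lip: "\<And>y z. \<bar>F y - F z\<bar> \<le> c * dist y z" and "F differentiable (at x)" and b: "b \<in> Basis"
  shows "\<bar>partial_deriv b F x\<bar> \<le> c"
proof -
  obtain D where D: "(F has_derivative D) (at x)" using assms(2) differentiable_def by blast
  have "((\<lambda>t. F (x + t *\<^sub>R b)) has_derivative (\<lambda>t. D (t *\<^sub>R b))) (at 0)"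
    by (rule has_derivative_compose[of "\<lambda>t. x + t *\<^sub>R b" "\<lambda>t. t *\<^sub>R b" _ _ F D])
       (use D in \<open>auto intro!: derivative_eq_intros\<close>)
  moreover have "D (t *\<^sub>R b) = D b * t" for t
    using linear_scale[OF has_derivative_linear[OF D], of t b] by simp
  ultimately have "((\<lambda>t. F (x + t *\<^sub>R b)) has_field_derivative D b) (at 0)"
    by (simp add: has_field_derivative_def)
  then have "((\<lambda>t. \<bar>(F (x + t *\<^sub>R b) - F x) / t\<bar>) \<longlongrightarrow> \<bar>D b\<bar>) (at 0)"
    by (intro tendsto_rabs) (simp add: DERIV_def)
  moreover have "\<forall>\<^sub>F t in at 0. \<bar>(F (x + t *\<^sub>R b) - F x) / t\<bar> \<le> c"
    unfolding eventually_at
  proof (intro exI[of _ 1] conjI ballI impI)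
    fix t :: real assume "t \<noteq> 0 \<and> dist t 0 < 1"
    then show "\<bar>(F (x + t *\<^sub>R b) - F x) / t\<bar> \<le> c"
      using lip[of "x + t *\<^sub>R b" x] b by (simp add: dist_norm field_simps)
  qed simp
  ultimately have "\<bar>D b\<bar> \<le> c" by (intro tendsto_upperbound[where F = "at (0::real)"]) auto
  then show ?thesis by (simp add: partial_deriv_eq[OF D])
qed

context
  fixes \<rho> :: "'a::euclidean_space \<Rightarrow> real"
  assumes \<rho>: "mollifier \<rho>"
begin

lemma smooth_on_mollify_scale: "smooth_on UNIV (mollify_scale \<rho> \<kappa>)"
  using smooth_on_scale[of \<rho> "inverse \<kappa>" "inverse (\<kappa> ^ DIM('a))"] \<rho>
  by (simp add: mollifier_def mollify_scale_def[abs_def] divide_inverse)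

lemma mollify_scale_nonneg: "0 < \<kappa> \<Longrightarrow> 0 \<le> mollify_scale \<rho> \<kappa> x"
  using \<rho> by (simp add: mollifier_def mollify_scale_def)

lemma mollify_scale_eq_0: "0 < \<kappa> \<Longrightarrow> \<kappa> \<le> norm x \<Longrightarrow> mollify_scale \<rho> \<kappa> x = 0"
  using \<rho> by (simp add: mollifier_def mollify_scale_def field_simps)

lemma bounded_support_mollify_scale: "0 < \<kappa> \<Longrightarrow> bounded {x. mollify_scale \<rho> \<kappa> x \<noteq> 0}"
  using mollify_scale_eq_0 by (intro bounded_subset[OF bounded_cball[of 0 \<kappa>]]) force

lemma mollify_scale_integrable: "0 < \<kappa> \<Longrightarrow> integrable lborel (mollify_scale \<rho> \<kappa>)"
  by (intro integrable_continuous_bounded_support smooth_on_continuous smooth_on_mollify_scale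
      bounded_support_mollify_scale)

lemma mollify_scale_integral:
  assumes "0 < \<kappa>"
  shows "(\<integral>x. mollify_scale \<rho> \<kappa> x \<partial>lborel) = 1"
proof -
  have cont: "continuous_on UNIV \<rho>" using \<rho> by (intro smooth_on_continuous) (simp add: mollifier_def)
  have 1: "(\<integral>x. \<rho> x \<partial>lborel) = 1"
    using \<rho> by (simp add: mollifier_def has_bochner_integral_iff integral_lebesgue_continuous[OF cont])
  have [measurable]: "mollify_scale \<rho> \<kappa> \<in> borel_measurable borel"
    by (intro borel_measurable_continuous_onI smooth_on_continuous smooth_on_mollify_scale)
  have "(\<integral>x. mollify_scale \<rho> \<kappa> x \<partial>lborel) =
      (\<integral>x. mollify_scale \<rho> \<kappa> x \<partial>density (distr lborel borel (\<lambda>x. 0 + \<kappa> *\<^sub>R x)) (\<lambda>_. \<bar>\<kappa>\<bar> ^ DIM('a)))"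
    using lborel_affine[of \<kappa> "0 :: 'a"] assms by simp
  also have "\<dots> = (\<integral>x. \<kappa> ^ DIM('a) * mollify_scale \<rho> \<kappa> (\<kappa> *\<^sub>R x) \<partial>lborel)"
    using assms by (subst integral_density) (auto simp: integral_distr)
  also have "(\<lambda>x. \<kappa> ^ DIM('a) * mollify_scale \<rho> \<kappa> (\<kappa> *\<^sub>R x)) = \<rho>"
    using assms by (auto simp: mollify_scale_def)
  finally show ?thesis using 1 by simp
qed

lemma mollify_cong:
  assumes "0 < \<kappa>" "\<And>y. dist x y < \<kappa> \<Longrightarrow> f y = g y"
  shows "mollify \<rho> \<kappa> f x = mollify \<rho> \<kappa> g x"
  unfolding mollify_def
proof (rule Bochner_Integration.integral_cong[OF refl])
  fix y
  show "f (x - y) * mollify_scale \<rho> \<kappa> y = g (x - y) * mollify_scale \<rho> \<kappa> y"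
    using assms(2)[of "x - y"] mollify_scale_eq_0[OF assms(1), of y]
    by (cases "norm y < \<kappa>") (auto simp: dist_norm)
qed

lemma mollify_const: "0 < \<kappa> \<Longrightarrow> mollify \<rho> \<kappa> (\<lambda>_. c) x = c"
  by (simp add: mollify_def mollify_scale_integral)

lemma mollify_integrable:
  assumes "0 < \<kappa>" "continuous_on UNIV f"
  shows "integrable lborel (\<lambda>y. f (x - y) * mollify_scale \<rho> \<kappa> y)"
proof (rule integrable_continuous_bounded_support)
  show "continuous_on UNIV (\<lambda>y. f (x - y) * mollify_scale \<rho> \<kappa> y)"
    by (intro continuous_intros continuous_on_compose2[OF assms(2)] smooth_on_continuous
        smooth_on_mollify_scale) auto
  show "bounded {y. f (x - y) * mollify_scale \<rho> \<kappa> y \<noteq> 0}"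
    by (rule bounded_subset[OF bounded_support_mollify_scale[OF assms(1)]]) auto
qed

lemma mollify_mono:
  assumes "0 < \<kappa>" "continuous_on UNIV f" "continuous_on UNIV g" "\<And>y. f y \<le> g y"
  shows "mollify \<rho> \<kappa> f x \<le> mollify \<rho> \<kappa> g x"
  unfolding mollify_def
  by (intro integral_mono mollify_integrable assms mult_right_mono mollify_scale_nonneg)

lemma smooth_on_mollify:
  assumes "0 < \<kappa>" "continuous_on UNIV f"
  shows "smooth_on UNIV (mollify \<rho> \<kappa> f)"
proof -
  have "mollify \<rho> \<kappa> f = (\<lambda>x. \<integral>y. f y * mollify_scale \<rho> \<kappa> (x - y) \<partial>lborel)"
  proof
    fix x
    show "mollify \<rho> \<kappa> f x = (\<integral>y. f y * mollify_scale \<rho> \<kappa> (x - y) \<partial>lborel)"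
      using integral_lborel_diff(1)[of "\<lambda>y. f y * mollify_scale \<rho> \<kappa> (x - y)" x]
      by (simp add: mollify_def)
  qed
  then show ?thesis
    using smooth_on_conv[OF assms(2) smooth_on_mollify_scale bounded_support_mollify_scale[OF assms(1)]]
    by metis
qed

lemma mollify_lipschitz:
  assumes \<kappa>: "0 < \<kappa>" and f: "continuous_on UNIV f" and lip: "\<And>y z. \<bar>f y - f z\<bar> \<le> c * dist y z"
  shows "\<bar>mollify \<rho> \<kappa> f x - mollify \<rho> \<kappa> f x'\<bar> \<le> c * dist x x'"
proof -
  let ?r = "mollify_scale \<rho> \<kappa>"
  have "mollify \<rho> \<kappa> f x - mollify \<rho> \<kappa> f x' = (\<integral>y. f (x - y) * ?r y - f (x' - y) * ?r y \<partial>lborel)"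
    unfolding mollify_def using mollify_integrable[OF \<kappa> f] by simp
  also have "\<bar>\<dots>\<bar> \<le> (\<integral>y. \<bar>f (x - y) * ?r y - f (x' - y) * ?r y\<bar> \<partial>lborel)"
    by (rule integral_abs_bound)
  also have "\<dots> \<le> (\<integral>y. (c * dist x x') * ?r y \<partial>lborel)"
  proof (rule integral_mono)
    fix y
    have "\<bar>f (x - y) * ?r y - f (x' - y) * ?r y\<bar> = \<bar>f (x - y) - f (x' - y)\<bar> * ?r y"
      using mollify_scale_nonneg[OF \<kappa>, of y] by (simp add: left_diff_distrib[symmetric] abs_mult)
    also have "\<dots> \<le> (c * dist x x') * ?r y"
      using lip[of "x - y" "x' - y"] mollify_scale_nonneg[OF \<kappa>, of y]
      by (intro mult_right_mono) (auto simp: dist_norm)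
    finally show "\<bar>f (x - y) * ?r y - f (x' - y) * ?r y\<bar> \<le> (c * dist x x') * ?r y" .
  qed (use mollify_integrable[OF \<kappa> f] mollify_scale_integrable[OF \<kappa>] in auto)
  also have "\<dots> = c * dist x x'" using mollify_scale_integral[OF \<kappa>] by simp
  finally show ?thesis .
qed

lemma mollify_partial_deriv_bound:
  assumes "0 < \<kappa>" "continuous_on UNIV f" "\<And>y z. \<bar>f y - f z\<bar> \<le> c * dist y z" "b \<in> Basis"
  shows "\<bar>partial_deriv b (mollify \<rho> \<kappa> f) x\<bar> \<le> c"
  using mollify_lipschitz[OF assms(1-3)] assms
  by (intro lipschitz_partial_deriv_bound smooth_on_differentiable smooth_on_mollify)

lemma integral_abs_partial_deriv_mollify_scale_ge:
  assumes \<delta>: "0 < \<delta>" and b: "b \<in> Basis"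
  shows "1 \<le> \<delta> * (\<integral>x. \<bar>partial_deriv b (mollify_scale \<rho> \<delta>) x\<bar> \<partial>lebesgue)"
proof -
  let ?r = "mollify_scale \<rho> \<delta>"
  have r: "smooth_on UNIV ?r" "bounded {x. ?r x \<noteq> 0}" "smooth_on UNIV (partial_deriv b ?r)"
    "bounded {x. partial_deriv b ?r x \<noteq> 0}"
    using \<delta> b smooth_on_mollify_scale bounded_support_mollify_scale smooth_on_partial_deriv
      bounded_support_partial_deriv by blast+
  have abs: "continuous_on UNIV (\<lambda>x. \<bar>partial_deriv b ?r x\<bar>)"
    by (intro continuous_intros smooth_on_continuous r)
  have int: "integrable lborel (\<lambda>x. (x \<bullet> b) * partial_deriv b ?r x)"
    by (intro integrable_continuous_bounded_support continuous_intros smooth_on_continuous r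
        bounded_subset[OF r(4)]) auto
  have "partial_deriv b (\<lambda>x. (x \<bullet> b) * ?r x) x = (x \<bullet> b) * partial_deriv b ?r x + ?r x" for x
  proof -
    have "((\<lambda>x. x \<bullet> b) has_derivative (\<lambda>h. h \<bullet> b)) (at x)"
      by (auto intro!: derivative_eq_intros)
    from partial_deriv_eq[OF this, of b] have "partial_deriv b (\<lambda>x. x \<bullet> b) x = 1" using b by simp
    then show ?thesis
      by (subst partial_deriv_mult) (auto intro: smooth_on_differentiable smooth_on_inner r)
  qed
  moreover have "(\<integral>x. partial_deriv b (\<lambda>x. (x \<bullet> b) * ?r x) x \<partial>lborel) = 0"
    by (intro integral_partial_deriv smooth_on_mult smooth_on_inner r b bounded_subset[OF r(2)]) auto
  ultimately have "0 = (\<integral>x. (x \<bullet> b) * partial_deriv b ?r x \<partial>lborel) + 1"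
    using int mollify_scale_integrable[OF \<delta>] mollify_scale_integral[OF \<delta>] by simp
  then have "1 = \<bar>\<integral>x. (x \<bullet> b) * partial_deriv b ?r x \<partial>lborel\<bar>" by simp
  also have "\<dots> \<le> (\<integral>x. \<bar>(x \<bullet> b) * partial_deriv b ?r x\<bar> \<partial>lborel)"
    by (rule integral_abs_bound)
  also have "\<dots> \<le> (\<integral>x. \<delta> * \<bar>partial_deriv b ?r x\<bar> \<partial>lborel)"
  proof (rule integral_mono)
    show "integrable lborel (\<lambda>x. \<delta> * \<bar>partial_deriv b ?r x\<bar>)"
      using integrable_continuous_bounded_support[OF abs] r(4) by simp
    fix x
    have "\<bar>x \<bullet> b\<bar> \<le> \<delta>" if "partial_deriv b ?r x \<noteq> 0"
    proof -
      have "closure {x. ?r x \<noteq> 0} \<subseteq> cball 0 \<delta>"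
        using mollify_scale_eq_0[OF \<delta>] by (intro closure_minimal) force+
      then have "x \<in> cball 0 \<delta>" using partial_deriv_support[of x ?r b] that by blast
      then have "norm x \<le> \<delta>" by simp
      then show ?thesis using Basis_le_norm[OF b, of x] by simp
    qed
    then show "\<bar>(x \<bullet> b) * partial_deriv b ?r x\<bar> \<le> \<delta> * \<bar>partial_deriv b ?r x\<bar>"
      by (cases "partial_deriv b ?r x = 0") (auto simp: abs_mult intro: mult_right_mono)
  qed (use int in simp)
  also have "\<dots> = \<delta> * (\<integral>x. \<bar>partial_deriv b ?r x\<bar> \<partial>lebesgue)"
    using integral_lebesgue_continuous(1)[OF abs] by simp
  finally show ?thesis .
qed

lemma cutoff_function:
  fixes K :: "'a set"
  assumes "K \<noteq> {}" "0 < w" "0 < \<kappa>"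
  obtains \<eta> where "smooth_on UNIV \<eta>" "\<And>x. 0 \<le> \<eta> x" "\<And>x. \<eta> x \<le> 1"
    "\<And>b x. b \<in> Basis \<Longrightarrow> \<bar>partial_deriv b \<eta> x\<bar> \<le> 1 / w"
    "\<And>x. ball x \<kappa> \<subseteq> K \<Longrightarrow> \<eta> x = 1"
    "\<And>x. \<eta> x \<noteq> 0 \<Longrightarrow> infdist x K < w + \<kappa>"
proof
  let ?f = "\<lambda>x. max 0 (1 - infdist x K / w)"
  let ?c = "mollify \<rho> \<kappa> ?f"
  have cont: "continuous_on UNIV ?f" using assms(2) by (intro continuous_intros) auto
  have lip: "\<bar>?f x - ?f y\<bar> \<le> 1 / w * dist x y" for x y
  proof -
    have "\<bar>?f x - ?f y\<bar> \<le> \<bar>infdist x K / w - infdist y K / w\<bar>" by (auto simp: max_def abs_if)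
    also have "\<dots> \<le> 1 / w * dist x y"
      using infdist_triangle_abs[of x K y] assms(2) by (simp add: diff_divide_distrib[symmetric] divide_right_mono)
    finally show ?thesis .
  qed
  show "smooth_on UNIV ?c" by (intro smooth_on_mollify cont assms)
  show "0 \<le> ?c x" for x
    using mollify_mono[OF assms(3) continuous_on_const[of _ 0] cont, of x]
    by (simp add: mollify_const[OF assms(3)])
  show "?c x \<le> 1" for x
    using mollify_mono[OF assms(3) cont continuous_on_const[of _ 1], of x] assms
    by (simp add: mollify_const[OF assms(3)] infdist_nonneg)
  show "\<bar>partial_deriv b ?c x\<bar> \<le> 1 / w" if "b \<in> Basis" for b x
    by (rule mollify_partial_deriv_bound[OF assms(3) cont lip that])
  show "?c x = 1" if "ball x \<kappa> \<subseteq> K" for x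
  proof -
    have "?c x = mollify \<rho> \<kappa> (\<lambda>_. 1) x"
      using that assms by (intro mollify_cong) (auto simp: subset_iff)
    then show ?thesis by (simp add: mollify_const[OF assms(3)])
  qed
  show "infdist x K < w + \<kappa>" if "?c x \<noteq> 0" for x
  proof (rule ccontr)
    assume far: "\<not> infdist x K < w + \<kappa>"
    have "?f y = 0" if "dist x y < \<kappa>" for y
      using far infdist_triangle[of x K y] that assms(2) by (simp add: field_simps)
    then have "?c x = mollify \<rho> \<kappa> (\<lambda>_. 0) x" by (intro mollify_cong assms)
    then show False using that by (simp add: mollify_const[OF assms(3)])
  qed
qed

end

section \<open>Weak derivatives\<close>

lemma integrable_lebesgue_on_iff:
  fixes f :: "'a::euclidean_space \<Rightarrow> real"
  shows "S \<in> sets lebesgue \<Longrightarrow>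
    integrable (lebesgue_on S) f \<longleftrightarrow> integrable lebesgue (\<lambda>x. indicator S x * f x)"
  by (simp add: integrable_restrict_space)

lemma integral_lebesgue_on_eq:
  fixes f :: "'a::euclidean_space \<Rightarrow> real"
  shows "S \<in> sets lebesgue \<Longrightarrow>
    integral\<^sup>L (lebesgue_on S) f = (\<integral>x. indicator S x * f x \<partial>lebesgue)"
  by (simp add: integral_restrict_space)

lemma lebesgue_on_transfer:
  fixes f h :: "'a::euclidean_space \<Rightarrow> real"
  assumes "V \<in> sets lebesgue" "W \<in> sets lebesgue"
    and "\<And>x. x \<in> V \<Longrightarrow> x \<notin> W \<Longrightarrow> f x = 0" "\<And>x. x \<in> W \<Longrightarrow> x \<notin> V \<Longrightarrow> h x = 0"
    and "\<And>x. x \<in> V \<Longrightarrow> x \<in> W \<Longrightarrow> f x = h x"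
  shows "integrable (lebesgue_on V) f \<longleftrightarrow> integrable (lebesgue_on W) h"
    and "integral\<^sup>L (lebesgue_on V) f = integral\<^sup>L (lebesgue_on W) h"
proof -
  have "(\<lambda>x. indicator V x * f x) = (\<lambda>x. indicator W x * h x)"
    using assms(3-) by (intro ext) (auto simp: indicator_def)
  then show "integrable (lebesgue_on V) f \<longleftrightarrow> integrable (lebesgue_on W) h"
    "integral\<^sup>L (lebesgue_on V) f = integral\<^sup>L (lebesgue_on W) h"
    using assms(1,2) by (simp_all add: integrable_lebesgue_on_iff integral_lebesgue_on_eq)
qed

lemma integrable_lebesgue_on_mult_continuous:
  fixes u h :: "'a::euclidean_space \<Rightarrow> real"
  assumes "compact K" "integrable (lebesgue_on K) u" "continuous_on UNIV h"
  shows "integrable (lebesgue_on K) (\<lambda>x. u x * h x)"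
proof -
  have K: "K \<in> sets lebesgue" using assms(1) by (simp add: compact_imp_closed)
  have "bounded (h ` K)"
    by (intro compact_imp_bounded compact_continuous_image continuous_on_subset[OF assms(3)] assms(1)) auto
  then obtain B where B: "\<And>x. x \<in> K \<Longrightarrow> \<bar>h x\<bar> \<le> B" unfolding bounded_iff by auto
  have "h \<in> borel_measurable lebesgue"
    using borel_measurable_continuous_onI[OF assms(3)] by (intro measurable_completion) simp
  then have [measurable]: "h \<in> borel_measurable (lebesgue_on K)" by (rule measurable_restrict_space1)
  show ?thesis
  proof (rule Bochner_Integration.integrable_bound)
    show "integrable (lebesgue_on K) (\<lambda>x. B * u x)" using assms(2) by simp
    show "(\<lambda>x. u x * h x) \<in> borel_measurable (lebesgue_on K)" using assms(2) by measurable
    show "AE x in lebesgue_on K. norm (u x * h x) \<le> norm (B * u x)"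
    proof (rule AE_I2)
      fix x assume "x \<in> space (lebesgue_on K)"
      then have "\<bar>h x\<bar> \<le> \<bar>B\<bar>" using B[of x] by (auto simp: space_restrict_space)
      then show "norm (u x * h x) \<le> norm (B * u x)"
        by (simp add: abs_mult mult.commute mult_right_mono)
    qed
  qed
qed

lemma test_function_mono: "test_function V \<eta> \<Longrightarrow> V \<subseteq> W \<Longrightarrow> test_function W \<eta>"
  by (auto simp: test_function_def)

lemma test_function_eq_0: "test_function V \<eta> \<Longrightarrow> x \<notin> V \<Longrightarrow> \<eta> x = 0"
  using closure_subset[of "{x. \<eta> x \<noteq> 0}"] by (auto simp: test_function_def)

lemma test_function_partial_deriv_eq_0: "test_function V \<eta> \<Longrightarrow> x \<notin> V \<Longrightarrow> partial_deriv b \<eta> x = 0"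
  by (rule partial_deriv_support) (auto simp: test_function_def)

lemma integrable_locally_integrable_mult:
  fixes u h :: "'a::euclidean_space \<Rightarrow> real"
  assumes V: "V \<in> sets lebesgue" and u: "locally_integrable V u" and K: "compact K" "K \<subseteq> V"
    and h: "continuous_on UNIV h" "\<And>x. h x \<noteq> 0 \<Longrightarrow> x \<in> K"
  shows "integrable (lebesgue_on V) (\<lambda>x. u x * h x)"
proof -
  have "integrable (lebesgue_on K) (\<lambda>x. u x * h x)"
    using u K by (intro integrable_lebesgue_on_mult_continuous h) (auto simp: locally_integrable_def)
  moreover have "K \<in> sets lebesgue" using K by (simp add: compact_imp_closed)
  ultimately show ?thesis
    using V K h(2) by (subst lebesgue_on_transfer(1)[of V K _ "\<lambda>x. u x * h x"]) auto
qed

lemma integrable_mult_test_function: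
  fixes u :: "'a::euclidean_space \<Rightarrow> real"
  assumes "V \<in> sets lebesgue" "locally_integrable V u" "test_function V \<eta>"
  shows "integrable (lebesgue_on V) (\<lambda>x. u x * \<eta> x)"
    and "b \<in> Basis \<Longrightarrow> integrable (lebesgue_on V) (\<lambda>x. u x * partial_deriv b \<eta> x)"
proof -
  have \<eta>: "smooth_on UNIV \<eta>" "compact (closure {x. \<eta> x \<noteq> 0})" "closure {x. \<eta> x \<noteq> 0} \<subseteq> V"
    using assms(3) by (auto simp: test_function_def)
  show "integrable (lebesgue_on V) (\<lambda>x. u x * \<eta> x)"
    using closure_subset[of "{x. \<eta> x \<noteq> 0}"]
    by (intro integrable_locally_integrable_mult[OF assms(1,2) \<eta>(2,3)] smooth_on_continuous \<eta>) auto
  show "integrable (lebesgue_on V) (\<lambda>x. u x * partial_deriv b \<eta> x)" if "b \<in> Basis"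
    using partial_deriv_support[of _ \<eta> b] that
    by (intro integrable_locally_integrable_mult[OF assms(1,2) \<eta>(2,3)] smooth_on_continuous
        smooth_on_partial_deriv \<eta>) auto
qed

lemma locally_integrable_subset: "locally_integrable V u \<Longrightarrow> W \<subseteq> V \<Longrightarrow> locally_integrable W u"
  by (auto simp: locally_integrable_def)

lemma locally_integrable_cong:
  "(\<And>x. x \<in> V \<Longrightarrow> u x = u' x) \<Longrightarrow> locally_integrable V u \<longleftrightarrow> locally_integrable V u'"
  unfolding locally_integrable_def
  by (intro all_cong1 imp_cong refl Bochner_Integration.integrable_cong)
     (auto simp: space_restrict_space)

lemma locally_integrable_add:
  "locally_integrable V u \<Longrightarrow> locally_integrable V g \<Longrightarrow> locally_integrable V (\<lambda>x. u x + g x)"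
  by (auto simp: locally_integrable_def)

lemma locally_integrable_mult_transfer:
  fixes u h :: "'a::euclidean_space \<Rightarrow> real"
  assumes u: "locally_integrable V u" and h: "continuous_on UNIV h"
    and C: "closed C" "\<And>x. h x \<noteq> 0 \<Longrightarrow> x \<in> C" "C \<inter> W \<subseteq> V"
  shows "locally_integrable W (\<lambda>x. h x * u x)"
  unfolding locally_integrable_def
proof (intro allI impI)
  fix K assume K: "compact K \<and> K \<subseteq> W"
  then have KC: "compact (K \<inter> C)" "K \<inter> C \<subseteq> V" using C by (auto intro: compact_Int_closed)
  then have "integrable (lebesgue_on (K \<inter> C)) (\<lambda>x. u x * h x)"
    using u by (intro integrable_lebesgue_on_mult_continuous h) (auto simp: locally_integrable_def)
  then show "integrable (lebesgue_on K) (\<lambda>x. h x * u x)"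
    using K KC C by (subst lebesgue_on_transfer(1)[of K "K \<inter> C" _ "\<lambda>x. u x * h x"])
      (auto simp: compact_imp_closed)
qed

lemma has_weak_deriv_locally_integrable:
  "has_weak_deriv V b u g \<Longrightarrow> locally_integrable V u"
  "has_weak_deriv V b u g \<Longrightarrow> locally_integrable V g"
  by (auto simp: has_weak_deriv_def)

lemma has_weak_deriv_cong:
  assumes "\<And>x. x \<in> V \<Longrightarrow> u x = u' x" "\<And>x. x \<in> V \<Longrightarrow> g x = g' x"
  shows "has_weak_deriv V b u g \<longleftrightarrow> has_weak_deriv V b u' g'"
proof -
  have "(\<integral>x. u x * partial_deriv b \<eta> x \<partial>lebesgue_on V) = (\<integral>x. u' x * partial_deriv b \<eta> x \<partial>lebesgue_on V)"
    "(\<integral>x. g x * \<eta> x \<partial>lebesgue_on V) = (\<integral>x. g' x * \<eta> x \<partial>lebesgue_on V)" for \<eta>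
    using assms by (auto intro!: Bochner_Integration.integral_cong simp: space_restrict_space)
  then show ?thesis
    using locally_integrable_cong[of V u u'] locally_integrable_cong[of V g g'] assms
    by (simp add: has_weak_deriv_def)
qed

lemma has_weak_deriv_subset:
  assumes wd: "has_weak_deriv V b u g" and "W \<subseteq> V" and VW: "V \<in> sets lebesgue" "W \<in> sets lebesgue"
  shows "has_weak_deriv W b u g"
  unfolding has_weak_deriv_def
proof (intro conjI allI impI)
  show "locally_integrable W u" "locally_integrable W g"
    using has_weak_deriv_locally_integrable[OF wd] locally_integrable_subset \<open>W \<subseteq> V\<close> by blast+
  fix \<eta> assume \<eta>: "test_function W \<eta>"
  have "(\<integral>x. u x * partial_deriv b \<eta> x \<partial>lebesgue_on W) = (\<integral>x. u x * partial_deriv b \<eta> x \<partial>lebesgue_on V)"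
    "(\<integral>x. g x * \<eta> x \<partial>lebesgue_on W) = (\<integral>x. g x * \<eta> x \<partial>lebesgue_on V)"
    using \<open>W \<subseteq> V\<close> test_function_eq_0[OF \<eta>] test_function_partial_deriv_eq_0[OF \<eta>]
    by (auto intro!: lebesgue_on_transfer(2) VW)
  then show "(\<integral>x. u x * partial_deriv b \<eta> x \<partial>lebesgue_on W) = - (\<integral>x. g x * \<eta> x \<partial>lebesgue_on W)"
    using wd test_function_mono[OF \<eta> \<open>W \<subseteq> V\<close>] by (simp add: has_weak_deriv_def)
qed

lemma has_weak_deriv_add:
  assumes "has_weak_deriv V b u g" "has_weak_deriv V b u' g'" "V \<in> sets lebesgue" "b \<in> Basis"
  shows "has_weak_deriv V b (\<lambda>x. u x + u' x) (\<lambda>x. g x + g' x)"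
  unfolding has_weak_deriv_def
proof (intro conjI allI impI)
  fix \<eta> assume \<eta>: "test_function V \<eta>"
  note int = integrable_mult_test_function[OF assms(3) has_weak_deriv_locally_integrable(1) \<eta>]
    integrable_mult_test_function[OF assms(3) has_weak_deriv_locally_integrable(2) \<eta>]
  show "(\<integral>x. (u x + u' x) * partial_deriv b \<eta> x \<partial>lebesgue_on V) = - (\<integral>x. (g x + g' x) * \<eta> x \<partial>lebesgue_on V)"
    using assms(1,2) \<eta>
    by (simp add: distrib_right int[OF assms(1)] int[OF assms(2)] assms(4) has_weak_deriv_def)
qed (use assms in \<open>auto intro: locally_integrable_add dest: has_weak_deriv_locally_integrable\<close>)

lemma has_weak_deriv_zero: "has_weak_deriv V b (\<lambda>_. 0) (\<lambda>_. 0)"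
  by (simp add: has_weak_deriv_def locally_integrable_def)

lemma has_weak_deriv_sum:
  assumes "\<And>i. i \<in> I \<Longrightarrow> has_weak_deriv V b (u i) (g i)" "V \<in> sets lebesgue" "b \<in> Basis"
  shows "has_weak_deriv V b (\<lambda>x. \<Sum>i\<in>I. u i x) (\<lambda>x. \<Sum>i\<in>I. g i x)"
  using assms(1)
  by (induction I rule: infinite_finite_induct)
     (auto intro: has_weak_deriv_zero has_weak_deriv_add assms(2,3))

text \<open>\<open>\<theta> u\<close> is extended by zero from \<open>V\<close> to \<open>W\<close>.\<close>

lemma has_weak_deriv_mult_smooth:
  fixes u g \<theta> :: "'a::euclidean_space \<Rightarrow> real"
  assumes wd: "has_weak_deriv V b u g" and \<theta>: "smooth_on UNIV \<theta>"
    and supp: "closure {x. \<theta> x \<noteq> 0} \<inter> W \<subseteq> V"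
    and VW: "V \<in> sets lebesgue" "W \<in> sets lebesgue" and b: "b \<in> Basis"
  shows "has_weak_deriv W b (\<lambda>x. \<theta> x * u x) (\<lambda>x. \<theta> x * g x + partial_deriv b \<theta> x * u x)"
  unfolding has_weak_deriv_def
proof (intro conjI allI impI)
  let ?C = "closure {x. \<theta> x \<noteq> 0}"
  note loc = has_weak_deriv_locally_integrable[OF wd]
  have \<theta>C: "x \<in> ?C" if "\<theta> x \<noteq> 0" for x using closure_subset that by fastforce
  have d\<theta>C: "x \<in> ?C" if "partial_deriv b \<theta> x \<noteq> 0" for x using partial_deriv_support that by blast
  note \<theta>' = smooth_on_partial_deriv[OF \<theta> b]
  show "locally_integrable W (\<lambda>x. \<theta> x * u x)"
    by (rule locally_integrable_mult_transfer[OF loc(1) smooth_on_continuous[OF \<theta>] closed_closure \<theta>C supp])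
  show "locally_integrable W (\<lambda>x. \<theta> x * g x + partial_deriv b \<theta> x * u x)"
    by (intro locally_integrable_add
        locally_integrable_mult_transfer[OF loc(1) smooth_on_continuous[OF \<theta>'] closed_closure d\<theta>C supp]
        locally_integrable_mult_transfer[OF loc(2) smooth_on_continuous[OF \<theta>] closed_closure \<theta>C supp])
  fix \<eta> assume \<eta>: "test_function W \<eta>"
  let ?E = "closure {x. \<eta> x \<noteq> 0}"
  have \<eta>': "smooth_on UNIV \<eta>" "compact ?E" "?E \<subseteq> W" using \<eta> by (auto simp: test_function_def)
  have \<eta>E: "x \<in> ?E" if "\<eta> x \<noteq> 0" for x using closure_subset that by fastforce
  have d\<eta>E: "x \<in> ?E" if "partial_deriv b \<eta> x \<noteq> 0" for x using partial_deriv_support that by blast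
  have K: "compact (?C \<inter> ?E)" "?C \<inter> ?E \<subseteq> V"
    using \<eta>' supp by (auto intro: closed_Int_compact)
  have sub: "closure {x. \<theta> x * \<eta> x \<noteq> 0} \<subseteq> ?C \<inter> ?E"
    using \<theta>C \<eta>E by (intro closure_minimal) auto
  have "bounded {x. \<theta> x * \<eta> x \<noteq> 0}"
    by (rule bounded_subset[OF compact_imp_bounded[OF K(1)] order_trans[OF closure_subset sub]])
  then have test: "test_function V (\<lambda>x. \<theta> x * \<eta> x)"
    using order_trans[OF sub K(2)] smooth_on_mult[OF \<theta> \<eta>'(1)]
    by (simp add: test_function_def compact_closure)
  have dm: "partial_deriv b (\<lambda>x. \<theta> x * \<eta> x) x = \<theta> x * partial_deriv b \<eta> x + partial_deriv b \<theta> x * \<eta> x" for x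
    by (rule partial_deriv_mult) (intro smooth_on_differentiable \<theta> \<eta>')+
  have cont: "continuous_on UNIV (\<lambda>x. \<theta> x * \<eta> x)" "continuous_on UNIV (\<lambda>x. \<theta> x * partial_deriv b \<eta> x)"
    "continuous_on UNIV (\<lambda>x. partial_deriv b \<theta> x * \<eta> x)"
    by (intro continuous_on_mult smooth_on_continuous \<theta> \<theta>' \<eta>' smooth_on_partial_deriv b)+
  have int: "integrable (lebesgue_on V) (\<lambda>x. u x * (\<theta> x * partial_deriv b \<eta> x))"
    "integrable (lebesgue_on V) (\<lambda>x. u x * (partial_deriv b \<theta> x * \<eta> x))"
    "integrable (lebesgue_on V) (\<lambda>x. g x * (\<theta> x * \<eta> x))"
    using \<theta>C d\<theta>C \<eta>E d\<eta>E
    by (auto intro!: integrable_locally_integrable_mult[OF VW(1) loc(1) K]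
          integrable_locally_integrable_mult[OF VW(1) loc(2) K] cont)
  have "(\<integral>x. \<theta> x * u x * partial_deriv b \<eta> x \<partial>lebesgue_on W) =
      (\<integral>x. u x * (\<theta> x * partial_deriv b \<eta> x) \<partial>lebesgue_on V)"
    using supp \<theta>C d\<eta>E \<eta>'(3) by (intro lebesgue_on_transfer(2) VW) (auto simp: subset_iff)
  also have "\<dots> = (\<integral>x. u x * partial_deriv b (\<lambda>x. \<theta> x * \<eta> x) x \<partial>lebesgue_on V) -
      (\<integral>x. u x * (partial_deriv b \<theta> x * \<eta> x) \<partial>lebesgue_on V)"
    using int by (simp add: dm distrib_left)
  also have "\<dots> = - (\<integral>x. g x * (\<theta> x * \<eta> x) + u x * (partial_deriv b \<theta> x * \<eta> x) \<partial>lebesgue_on V)"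
    using wd test int by (simp add: has_weak_deriv_def)
  also have "\<dots> = - (\<integral>x. (\<theta> x * g x + partial_deriv b \<theta> x * u x) * \<eta> x \<partial>lebesgue_on W)"
  proof (intro arg_cong[where f = uminus] lebesgue_on_transfer(2) VW)
    fix x assume "x \<in> V" "x \<notin> W"
    then have "\<eta> x = 0" using \<eta>E \<eta>'(3) by blast
    then show "g x * (\<theta> x * \<eta> x) + u x * (partial_deriv b \<theta> x * \<eta> x) = 0" by simp
  next
    fix x assume "x \<in> W" "x \<notin> V"
    then have "\<theta> x = 0" "partial_deriv b \<theta> x = 0" using supp \<theta>C d\<theta>C by blast+
    then show "(\<theta> x * g x + partial_deriv b \<theta> x * u x) * \<eta> x = 0" by simp
  qed (simp add: algebra_simps)
  finally show "(\<integral>x. \<theta> x * u x * partial_deriv b \<eta> x \<partial>lebesgue_on W) =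
      - (\<integral>x. (\<theta> x * g x + partial_deriv b \<theta> x * u x) * \<eta> x \<partial>lebesgue_on W)" .
qed

lemma has_weak_deriv_locally_finite_sum:
  fixes u g :: "'i \<Rightarrow> 'a::euclidean_space \<Rightarrow> real" and I :: "'a \<Rightarrow> 'i set"
  assumes wd: "\<And>i. has_weak_deriv V b (u i) (g i)" and V: "V \<in> sets lebesgue" and b: "b \<in> Basis"
    and I: "\<And>x. finite (I x)" and \<kappa>: "0 < \<kappa>"
    and zero: "\<And>i x y. dist x y < \<kappa> \<Longrightarrow> i \<notin> I x \<Longrightarrow> u i y = 0 \<and> g i y = 0"
  shows "has_weak_deriv V b (\<lambda>x. \<Sum>i\<in>I x. u i x) (\<lambda>x. \<Sum>i\<in>I x. g i x)"
proof -
  have fin: "\<exists>J. finite J \<and> (\<forall>x\<in>K. (\<Sum>i\<in>I x. u i x) = (\<Sum>i\<in>J. u i x) \<and>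
      (\<Sum>i\<in>I x. g i x) = (\<Sum>i\<in>J. g i x))" if K: "compact K" for K
  proof -
    have "K \<subseteq> (\<Union>x\<in>K. ball x \<kappa>)" using \<kappa> by auto
    then obtain X where X: "finite X" "K \<subseteq> (\<Union>x\<in>X. ball x \<kappa>)"
      by (rule compactE_image[OF K, of K "\<lambda>x. ball x \<kappa>", rotated]) auto
    let ?J = "\<Union>x\<in>X. I x"
    have J: "finite ?J" using X I by auto
    have "(\<Sum>i\<in>I x. f i x) = (\<Sum>i\<in>?J. f i x)"
      if x: "x \<in> K" and "\<And>i z. dist z x < \<kappa> \<Longrightarrow> i \<notin> I z \<Longrightarrow> f i x = 0" for x and f :: "'i \<Rightarrow> 'a \<Rightarrow> real"
    proof -
      obtain z where z: "z \<in> X" "dist z x < \<kappa>" using X(2) x by auto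
      have 1: "(\<Sum>i\<in>I x. f i x) = (\<Sum>i\<in>I x \<union> ?J. f i x)"
        using that(2)[of x] \<kappa> J I by (intro sum.mono_neutral_left) auto
      have 2: "(\<Sum>i\<in>?J. f i x) = (\<Sum>i\<in>I x \<union> ?J. f i x)"
        using that(2)[OF z(2)] z(1) J I by (intro sum.mono_neutral_left) auto
      show ?thesis using 1 2 by simp
    qed
    from this[of _ u] this[of _ g] show ?thesis using J zero by (intro exI[of _ ?J]) simp
  qed
  show ?thesis
    unfolding has_weak_deriv_def
  proof (intro conjI allI impI)
    have "integrable (lebesgue_on K) (\<lambda>x. \<Sum>i\<in>I x. u i x) \<and> integrable (lebesgue_on K) (\<lambda>x. \<Sum>i\<in>I x. g i x)"
      if K: "compact K" "K \<subseteq> V" for K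
    proof -
      obtain J where J: "finite J" "\<And>x. x \<in> K \<Longrightarrow> (\<Sum>i\<in>I x. u i x) = (\<Sum>i\<in>J. u i x)"
        "\<And>x. x \<in> K \<Longrightarrow> (\<Sum>i\<in>I x. g i x) = (\<Sum>i\<in>J. g i x)" using fin[OF K(1)] by blast
      have "integrable (lebesgue_on K) (\<lambda>x. \<Sum>i\<in>J. u i x)" "integrable (lebesgue_on K) (\<lambda>x. \<Sum>i\<in>J. g i x)"
        using wd K by (auto simp: has_weak_deriv_def locally_integrable_def)
      moreover have "integrable (lebesgue_on K) (\<lambda>x. \<Sum>i\<in>I x. u i x) \<longleftrightarrow> integrable (lebesgue_on K) (\<lambda>x. \<Sum>i\<in>J. u i x)"
        "integrable (lebesgue_on K) (\<lambda>x. \<Sum>i\<in>I x. g i x) \<longleftrightarrow> integrable (lebesgue_on K) (\<lambda>x. \<Sum>i\<in>J. g i x)"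
        by (auto intro!: Bochner_Integration.integrable_cong simp: space_restrict_space J)
      ultimately show ?thesis by simp
    qed
    then show "locally_integrable V (\<lambda>x. \<Sum>i\<in>I x. u i x)" "locally_integrable V (\<lambda>x. \<Sum>i\<in>I x. g i x)"
      by (auto simp: locally_integrable_def)
    fix \<eta> assume \<eta>: "test_function V \<eta>"
    let ?K = "closure {x. \<eta> x \<noteq> 0}"
    have "compact ?K" using \<eta> by (simp add: test_function_def)
    obtain J where J: "finite J" "\<And>x. x \<in> ?K \<Longrightarrow> (\<Sum>i\<in>I x. u i x) = (\<Sum>i\<in>J. u i x)"
      "\<And>x. x \<in> ?K \<Longrightarrow> (\<Sum>i\<in>I x. g i x) = (\<Sum>i\<in>J. g i x)" using fin[OF \<open>compact ?K\<close>] by blast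
    have 1: "(\<Sum>i\<in>I x. u i x) * partial_deriv b \<eta> x = (\<Sum>i\<in>J. u i x) * partial_deriv b \<eta> x" for x
      using J(2) partial_deriv_support[of x \<eta> b] by (cases "x \<in> ?K") auto
    have 2: "(\<Sum>i\<in>I x. g i x) * \<eta> x = (\<Sum>i\<in>J. g i x) * \<eta> x" for x
      using J(3) closure_subset[of "{x. \<eta> x \<noteq> 0}"] by (cases "x \<in> ?K") auto
    show "(\<integral>x. (\<Sum>i\<in>I x. u i x) * partial_deriv b \<eta> x \<partial>lebesgue_on V) =
        - (\<integral>x. (\<Sum>i\<in>I x. g i x) * \<eta> x \<partial>lebesgue_on V)"
      unfolding 1 2 using has_weak_deriv_sum[of J V b u g, OF wd V b] \<eta> by (simp add: has_weak_deriv_def)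
  qed
qed

lemma locally_integrable_continuous:
  fixes f :: "'a::euclidean_space \<Rightarrow> real"
  assumes "continuous_on UNIV f"
  shows "locally_integrable V f"
  unfolding locally_integrable_def
proof (intro allI impI)
  fix K assume K: "compact K \<and> K \<subseteq> V"
  then have "integrable lborel (\<lambda>x. indicator K x *\<^sub>R f x)"
    using continuous_on_subset[OF assms] by (intro borel_integrable_compact) auto
  then have "integrable lebesgue (\<lambda>x. indicator K x *\<^sub>R f x)"
    by (subst integrable_completion) auto
  then show "integrable (lebesgue_on K) f"
    using K by (simp add: integrable_lebesgue_on_iff compact_imp_closed)
qed

lemma has_weak_deriv_smooth:
  fixes f :: "'a::euclidean_space \<Rightarrow> real"
  assumes f: "smooth_on UNIV f" and b: "b \<in> Basis"
  shows "has_weak_deriv UNIV b f (partial_deriv b f)"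
  unfolding has_weak_deriv_def
proof (intro conjI allI impI locally_integrable_continuous smooth_on_continuous
    smooth_on_partial_deriv f b)
  fix \<eta> assume \<eta>: "test_function (UNIV :: 'a set) \<eta>"
  then have \<eta>': "smooth_on UNIV \<eta>" "bounded {x. \<eta> x \<noteq> 0}"
    by (auto simp: test_function_def intro: bounded_subset[OF compact_imp_bounded closure_subset])
  have cont: "continuous_on UNIV (\<lambda>x. f x * partial_deriv b \<eta> x)"
    "continuous_on UNIV (\<lambda>x. partial_deriv b f x * \<eta> x)"
    by (intro continuous_on_mult smooth_on_continuous smooth_on_partial_deriv f b \<eta>'(1))+
  have int: "integrable lborel (\<lambda>x. f x * partial_deriv b \<eta> x)" "integrable lborel (\<lambda>x. partial_deriv b f x * \<eta> x)"
    by (intro integrable_continuous_bounded_support cont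
        bounded_subset[OF bounded_support_partial_deriv[OF \<eta>'(2), of b]], auto)
       (intro integrable_continuous_bounded_support cont bounded_subset[OF \<eta>'(2)], auto)
  have "(\<integral>x. partial_deriv b (\<lambda>x. f x * \<eta> x) x \<partial>lborel) = 0"
    by (intro integral_partial_deriv smooth_on_mult f \<eta>' b bounded_subset[OF \<eta>'(2)]) auto
  moreover have "partial_deriv b (\<lambda>x. f x * \<eta> x) x = f x * partial_deriv b \<eta> x + partial_deriv b f x * \<eta> x" for x
    by (rule partial_deriv_mult) (intro smooth_on_differentiable f \<eta>')+
  ultimately have "(\<integral>x. f x * partial_deriv b \<eta> x \<partial>lborel) = - (\<integral>x. partial_deriv b f x * \<eta> x \<partial>lborel)"
    using int by simp
  moreover have "(\<integral>x. f x * partial_deriv b \<eta> x \<partial>lebesgue) = (\<integral>x. f x * partial_deriv b \<eta> x \<partial>lborel)"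
    "(\<integral>x. partial_deriv b f x * \<eta> x \<partial>lebesgue) = (\<integral>x. partial_deriv b f x * \<eta> x \<partial>lborel)"
    by (intro integral_lebesgue_continuous cont)+
  ultimately show "(\<integral>x. f x * partial_deriv b \<eta> x \<partial>lebesgue_on UNIV) =
      - (\<integral>x. partial_deriv b f x * \<eta> x \<partial>lebesgue_on UNIV)"
    by (simp add: lebesgue_on_UNIV_eq)
qed

section \<open>Uniqueness of weak derivatives\<close>

lemma infdist_less_iff: "A \<noteq> {} \<Longrightarrow> infdist x A < r \<longleftrightarrow> (\<exists>a\<in>A. dist x a < r)"
  by (auto simp: infdist_def cINF_less_iff bounded_imp_bdd_below)

lemma locally_integrable_measurable:
  fixes g :: "'a::euclidean_space \<Rightarrow> real"
  assumes V: "open V" and g: "locally_integrable V g"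
  shows "g \<in> borel_measurable (lebesgue_on V)"
proof -
  obtain D where D: "countable D" "D \<subseteq> Pow V" "\<And>X. X \<in> D \<Longrightarrow> \<exists>a b. X = cbox a b" "\<Union>D = V"
    using open_countable_Union_open_cbox[OF V] by blast
  show ?thesis
  proof (rule measurable_piecewise_restrict[OF D(1)])
    show "space (lebesgue_on V) \<subseteq> \<Union>D" using D(4) by (simp add: space_restrict_space)
    fix X assume X: "X \<in> D"
    then have XV: "X \<subseteq> V" using D by auto
    obtain a b where ab: "X = cbox a b" using D(3)[OF X] by blast
    have Vs: "V \<in> sets lebesgue" using V by simp
    have Xs: "X \<in> sets lebesgue" by (simp add: ab)
    show "X \<inter> space (lebesgue_on V) \<in> sets (lebesgue_on V)"
      using Vs Xs by (auto simp: sets_restrict_space space_restrict_space)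
    have "integrable (lebesgue_on X) g" using g XV by (simp add: locally_integrable_def ab)
    moreover have "restrict_space (lebesgue_on V) X = lebesgue_on X"
      using XV Vs Xs by (simp add: restrict_restrict_space Int_absorb1)
    ultimately show "g \<in> borel_measurable (restrict_space (lebesgue_on V) X)" by simp
  qed
qed

context
  fixes \<rho> :: "'a::euclidean_space \<Rightarrow> real"
  assumes \<rho>: "mollifier \<rho>"
begin

lemma compact_cutoff_function:
  fixes C V :: "'a set"
  assumes "compact C" "C \<noteq> {}" "0 < e"
  obtains \<eta> where "smooth_on UNIV \<eta>" "\<And>x. 0 \<le> \<eta> x" "\<And>x. \<eta> x \<le> 1" "\<And>x. x \<in> C \<Longrightarrow> \<eta> x = 1"
    "\<And>x. \<eta> x \<noteq> 0 \<Longrightarrow> infdist x C < e"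
proof -
  let ?K = "{x. infdist x C \<le> e / 4}"
  have CK: "C \<subseteq> ?K" using assms by auto
  then have "?K \<noteq> {}" using assms by blast
  obtain \<eta> where \<eta>: "smooth_on UNIV \<eta>" "\<And>x. 0 \<le> \<eta> x" "\<And>x. \<eta> x \<le> 1"
    "\<And>x. ball x (e/4) \<subseteq> ?K \<Longrightarrow> \<eta> x = 1" "\<And>x. \<eta> x \<noteq> 0 \<Longrightarrow> infdist x ?K < e/4 + e/4"
    using cutoff_function[OF \<rho> \<open>?K \<noteq> {}\<close>, of "e/4" "e/4"] assms by (metis zero_less_divide_iff zero_less_numeral)
  show thesis
  proof
    show "\<eta> x = 1" if "x \<in> C" for x
    proof (rule \<eta>(4), rule subsetI)
      fix y assume "y \<in> ball x (e/4)"
      then show "y \<in> ?K" using infdist_le[OF that, of y] by (simp add: dist_commute)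
    qed
    show "infdist x C < e" if x: "\<eta> x \<noteq> 0" for x
    proof -
      obtain y where "y \<in> ?K" "dist x y < e/4 + e/4"
        using \<eta>(5)[OF x] unfolding infdist_less_iff[OF \<open>?K \<noteq> {}\<close>] by blast
      then show ?thesis using infdist_triangle[of x C y] assms(3) by simp
    qed
  qed (use \<eta> in auto)
qed

text \<open>Cutoff functions converge boundedly to the indicator of a compact set.\<close>

lemma integral_compact_eq_0:
  fixes g :: "'a \<Rightarrow> real"
  assumes V: "open V" and g: "locally_integrable V g"
    and orth: "\<And>\<eta>. test_function V \<eta> \<Longrightarrow> (\<integral>x. g x * \<eta> x \<partial>lebesgue_on V) = 0"
    and C: "compact C" "C \<subseteq> V"
  shows "integral\<^sup>L (lebesgue_on C) g = 0"
proof (cases "C = {}")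
  case True
  then show ?thesis by (simp add: integral_lebesgue_on_eq)
next
  case False
  obtain e where e: "0 < e" "(\<Union>x\<in>C. ball x e) \<subseteq> V"
    using compact_subset_open_imp_ball_epsilon_subset[OF C(1) V C(2)] .
  let ?K = "{x. infdist x C \<le> e / 2}"
  have K: "compact ?K" using compact_infdist_le[OF False C(1), of "e/2"] e(1) by simp
  have "?K \<subseteq> V"
  proof
    fix x assume "x \<in> ?K"
    then have "infdist x C < e" using e by simp
    then obtain y where "y \<in> C" "dist x y < e" using False by (auto simp: infdist_less_iff)
    then have "x \<in> (\<Union>x\<in>C. ball x e)" by (auto simp: dist_commute)
    then show "x \<in> V" using e(2) by blast
  qed
  have "\<exists>\<eta>. smooth_on UNIV \<eta> \<and> (\<forall>x. 0 \<le> \<eta> x \<and> \<eta> x \<le> 1) \<and> (\<forall>x\<in>C. \<eta> x = 1) \<and>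
      (\<forall>x. \<eta> x \<noteq> 0 \<longrightarrow> infdist x C < e / 2 / real (Suc k))" for k
    using compact_cutoff_function[OF C(1) False, of "e / 2 / real (Suc k)"] e(1)
    by (metis of_nat_0_less_iff zero_less_Suc zero_less_divide_iff zero_less_numeral)
  then obtain \<eta> where \<eta>: "\<And>k. smooth_on UNIV (\<eta> k)" "\<And>k x. 0 \<le> \<eta> k x" "\<And>k x. \<eta> k x \<le> 1"
    "\<And>k x. x \<in> C \<Longrightarrow> \<eta> k x = 1" "\<And>k x. \<eta> k x \<noteq> 0 \<Longrightarrow> infdist x C < e / 2 / real (Suc k)"
    by metis
  have supp: "x \<in> ?K" if "\<eta> k x \<noteq> 0" for k x
  proof -
    have "e / 2 / real (Suc k) \<le> e / 2 / 1" using e(1) by (intro divide_left_mono) auto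
    then have "infdist x C \<le> e / 2" using \<eta>(5)[OF that] by linarith
    then show ?thesis by simp
  qed
  have sub: "closure {x. \<eta> k x \<noteq> 0} \<subseteq> ?K" for k
    using supp K by (intro closure_minimal) (auto intro: compact_imp_closed)
  have test: "test_function V (\<eta> k)" for k
    using \<eta>(1) sub[of k] \<open>?K \<subseteq> V\<close> bounded_subset[OF compact_imp_bounded[OF K] order_trans[OF closure_subset sub]]
    by (auto simp: test_function_def compact_closure)
  have Vs: "V \<in> sets lebesgue" "C \<in> sets lebesgue" "?K \<in> sets lebesgue"
    using V C K by (simp_all add: compact_imp_closed)
  have gK: "integrable (lebesgue_on ?K) g" using g K \<open>?K \<subseteq> V\<close> by (auto simp: locally_integrable_def)
  have "C \<subseteq> ?K" using e by auto
  have lim: "(\<lambda>k. \<integral>x. g x * \<eta> k x \<partial>lebesgue_on ?K) \<longlonglongrightarrow> (\<integral>x. g x * indicator C x \<partial>lebesgue_on ?K)"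
  proof (rule integral_dominated_convergence[where w = "\<lambda>x. \<bar>g x\<bar>"])
    have [measurable]: "\<eta> k \<in> borel_measurable (lebesgue_on ?K)" for k
      using borel_measurable_continuous_onI[OF smooth_on_continuous[OF \<eta>(1)]]
      by (intro measurable_restrict_space1 measurable_completion) simp
    have [measurable]: "indicator C \<in> borel_measurable (lebesgue_on ?K)"
      using Vs(2) by (intro measurable_restrict_space1 borel_measurable_indicator)
    show "(\<lambda>x. g x * indicator C x) \<in> borel_measurable (lebesgue_on ?K)"
      "\<And>k. (\<lambda>x. g x * \<eta> k x) \<in> borel_measurable (lebesgue_on ?K)"
      using gK by measurable
    show "AE x in lebesgue_on ?K. norm (g x * \<eta> k x) \<le> \<bar>g x\<bar>" for k
      using \<eta>(2,3) by (intro AE_I2) (auto simp: abs_mult intro: mult_left_le)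
    show "AE x in lebesgue_on ?K. (\<lambda>k. g x * \<eta> k x) \<longlonglongrightarrow> g x * indicator C x"
    proof (rule AE_I2)
      fix x
      have "(\<lambda>k. \<eta> k x) \<longlonglongrightarrow> indicator C x"
      proof (cases "x \<in> C")
        case False
        then have "0 < infdist x C"
          using C \<open>C \<noteq> {}\<close> by (simp add: compact_imp_closed infdist_pos_not_in_closed)
        moreover have "(\<lambda>k. e / 2 / real (Suc k)) \<longlonglongrightarrow> 0"
          by (rule LIMSEQ_Suc[OF lim_const_over_n])
        ultimately have "\<forall>\<^sub>F k in sequentially. e / 2 / real (Suc k) < infdist x C"
          by (rule order_tendstoD(2)[rotated])
        then have "\<forall>\<^sub>F k in sequentially. \<eta> k x = 0"
          by eventually_elim (use \<eta>(5) in \<open>fastforce dest: less_trans\<close>)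
        then show ?thesis using False by (auto intro: tendsto_eventually)
      qed (simp add: \<eta>(4))
      then show "(\<lambda>k. g x * \<eta> k x) \<longlonglongrightarrow> g x * indicator C x" by (intro tendsto_intros)
    qed
  qed (use gK in simp)
  have "(\<integral>x. g x * \<eta> k x \<partial>lebesgue_on ?K) = 0" for k
  proof -
    have "(\<integral>x. g x * \<eta> k x \<partial>lebesgue_on ?K) = (\<integral>x. g x * \<eta> k x \<partial>lebesgue_on V)"
      using supp[of k] \<open>?K \<subseteq> V\<close> by (intro lebesgue_on_transfer(2) Vs) auto
    then show ?thesis using orth[OF test] by simp
  qed
  then have "(\<integral>x. g x * indicator C x \<partial>lebesgue_on ?K) = 0"
    using LIMSEQ_unique[OF lim, of 0] by simp
  also have "(\<integral>x. g x * indicator C x \<partial>lebesgue_on ?K) = integral\<^sup>L (lebesgue_on C) g"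
    using \<open>C \<subseteq> ?K\<close> by (intro lebesgue_on_transfer(2) Vs) (auto simp: indicator_def)
  finally show ?thesis .
qed

lemma fundamental_lemma_nonpos:
  fixes g :: "'a \<Rightarrow> real"
  assumes V: "open V" and g: "locally_integrable V g"
    and orth: "\<And>\<eta>. test_function V \<eta> \<Longrightarrow> (\<integral>x. g x * \<eta> x \<partial>lebesgue_on V) = 0"
  shows "AE x in lebesgue. x \<in> V \<longrightarrow> g x \<le> 0"
proof -
  let ?P = "{x \<in> V. 0 < g x}"
  have "g \<in> borel_measurable (lebesgue_on V)" by (rule locally_integrable_measurable[OF V g])
  then have "{x \<in> space (lebesgue_on V). 0 < g x} \<in> sets (lebesgue_on V)" by measurable
  then have "?P \<in> sets lebesgue"
    using V by (auto simp: space_restrict_space sets_restrict_space_iff)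
  then obtain C N where CN: "fsigma C" "N \<in> null_sets lebesgue" "C \<union> N = ?P"
    using lebesgue_set_almost_fsigma by metis
  obtain F :: "nat \<Rightarrow> 'a set" where F: "range F \<subseteq> Collect compact" "C = \<Union>(F ` UNIV)"
    using CN(1) fsigma_Union_compact by blast
  have "F n \<in> null_sets lebesgue" for n
  proof -
    have Fn: "compact (F n)" "F n \<subseteq> ?P" using F CN(3) by auto
    then have "F n \<subseteq> V" by auto
    have s: "F n \<in> sets lebesgue" using Fn by (simp add: compact_imp_closed)
    have int: "integrable (lebesgue_on (F n)) g" using g Fn \<open>F n \<subseteq> V\<close> by (simp add: locally_integrable_def)
    have "AE x in lebesgue_on (F n). 0 \<le> g x"
      using Fn by (intro AE_I2) (auto simp: space_restrict_space)
    then have "AE x in lebesgue_on (F n). g x = 0"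
      using integral_nonneg_eq_0_iff_AE[OF int] integral_compact_eq_0[OF V g orth Fn(1) \<open>F n \<subseteq> V\<close>] by simp
    then have "AE x in lebesgue. x \<in> F n \<longrightarrow> g x = 0"
      using s by (simp add: AE_restrict_space_iff)
    then have "AE x in lebesgue. x \<notin> F n"
      by eventually_elim (use Fn in auto)
    then show ?thesis using s by (simp add: AE_iff_null_sets)
  qed
  then have "C \<in> null_sets lebesgue" unfolding F(2) by (intro null_sets_UN')  auto
  then have "?P \<in> null_sets lebesgue" using CN by (metis null_sets.Un)
  then have "AE x in lebesgue. x \<notin> ?P" by (rule AE_not_in)
  then show ?thesis by eventually_elim auto
qed

lemma fundamental_lemma_calculus_of_variations:
  fixes g :: "'a \<Rightarrow> real"
  assumes V: "open V" and g: "locally_integrable V g"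
    and orth: "\<And>\<eta>. test_function V \<eta> \<Longrightarrow> (\<integral>x. g x * \<eta> x \<partial>lebesgue_on V) = 0"
  shows "AE x in lebesgue. x \<in> V \<longrightarrow> g x = 0"
proof -
  have "locally_integrable V (\<lambda>x. - g x)" using g by (simp add: locally_integrable_def)
  moreover have "(\<integral>x. - g x * \<eta> x \<partial>lebesgue_on V) = 0" if "test_function V \<eta>" for \<eta>
    using orth[OF that] by simp
  ultimately have "AE x in lebesgue. x \<in> V \<longrightarrow> - g x \<le> 0" by (intro fundamental_lemma_nonpos[OF V])
  moreover have "AE x in lebesgue. x \<in> V \<longrightarrow> g x \<le> 0" by (rule fundamental_lemma_nonpos[OF assms])
  ultimately show ?thesis by eventually_elim auto
qed

lemma has_weak_deriv_unique:
  fixes u :: "'a \<Rightarrow> real"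
  assumes V: "open V" and g: "has_weak_deriv V b u g" "has_weak_deriv V b u g'"
  shows "AE x in lebesgue. x \<in> V \<longrightarrow> g x = g' x"
proof -
  have Vs: "V \<in> sets lebesgue" using V by simp
  note loc = has_weak_deriv_locally_integrable(2)[OF g(1)] has_weak_deriv_locally_integrable(2)[OF g(2)]
  have "locally_integrable V (\<lambda>x. g x - g' x)" using loc by (simp add: locally_integrable_def)
  moreover have "(\<integral>x. (g x - g' x) * \<eta> x \<partial>lebesgue_on V) = 0" if \<eta>: "test_function V \<eta>" for \<eta>
  proof -
    have "(\<integral>x. g x * \<eta> x \<partial>lebesgue_on V) = (\<integral>x. g' x * \<eta> x \<partial>lebesgue_on V)"
      using g \<eta> by (simp add: has_weak_deriv_def)
    then show ?thesis
      using integrable_mult_test_function(1)[OF Vs loc(1) \<eta>] integrable_mult_test_function(1)[OF Vs loc(2) \<eta>]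
      by (simp add: left_diff_distrib)
  qed
  ultimately have "AE x in lebesgue. x \<in> V \<longrightarrow> g x - g' x = 0"
    by (rule fundamental_lemma_calculus_of_variations[OF V])
  then show ?thesis by eventually_elim auto
qed

end

section \<open>Lebesgue and Sobolev norms\<close>

lemma convex_on_powr:
  assumes q: "1 \<le> q"
  shows "convex_on {0..} (\<lambda>x::real. x powr q)"
proof (rule convex_on_linorderI)
  fix t x y :: real assume t: "0 < t" "t < 1" and "x \<in> {0..}" "y \<in> {0..}" "x < y"
  then have xy: "0 \<le> x" "0 < y" by auto
  show "((1 - t) *\<^sub>R x + t *\<^sub>R y) powr q \<le> (1 - t) * x powr q + t * y powr q"
  proof (cases "x = 0")
    case True
    have "t powr q \<le> t powr 1" using t q by (intro powr_mono') auto
    then show ?thesis using True t xy by (simp add: powr_mult mult_right_mono)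
  next
    case False
    then show ?thesis using convex_onD[OF powr_convex[OF q], of t x y] t xy by simp
  qed
qed simp

lemma powr_add_le_convex:
  fixes s t z q :: real
  assumes "1 \<le> q" "0 \<le> s" "0 \<le> t" "0 < z" "z < 1"
  shows "(s + t) powr q \<le> z powr (1 - q) * s powr q + (1 - z) powr (1 - q) * t powr q"
proof -
  have *: "a * (r / a) powr q = a powr (1 - q) * r powr q" if "0 < a" "0 \<le> r" for a r :: real
    using that by (simp add: powr_divide powr_diff)
  have "(s + t) powr q = ((1 - z) *\<^sub>R (t / (1 - z)) + z *\<^sub>R (s / z)) powr q"
    using assms by (simp add: add.commute)
  also have "\<dots> \<le> (1 - z) * (t / (1 - z)) powr q + z * (s / z) powr q"
    using assms by (intro convex_onD[OF convex_on_powr]) auto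
  finally show ?thesis using *[of z s] *[of "1 - z" t] assms by simp
qed

lemma sum_powr_le_card:
  fixes a :: "'i \<Rightarrow> real"
  assumes q: "1 \<le> q" and J: "finite J" "card J \<le> N" and a: "\<And>i. i \<in> J \<Longrightarrow> 0 \<le> a i"
  shows "(\<Sum>i\<in>J. a i) powr q \<le> real N powr (q - 1) * (\<Sum>i\<in>J. a i powr q)"
proof (cases "J = {}")
  case False
  let ?k = "real (card J)"
  have k: "0 < ?k" using J False by (simp add: card_gt_0_iff)
  have "(\<Sum>i\<in>J. (1 / ?k) *\<^sub>R a i) powr q \<le> (\<Sum>i\<in>J. 1 / ?k * a i powr q)"
    using k a by (intro convex_on_sum[OF J(1) False convex_on_powr[OF q]]) auto
  then have "(\<Sum>i\<in>J. a i) powr q / ?k powr q \<le> (\<Sum>i\<in>J. a i powr q) / ?k"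
    using a by (simp add: sum_divide_distrib[symmetric] powr_divide sum_nonneg)
  then have "(\<Sum>i\<in>J. a i) powr q \<le> ?k powr (q - 1) * (\<Sum>i\<in>J. a i powr q)"
    using k by (simp add: powr_diff field_simps)
  also have "\<dots> \<le> real N powr (q - 1) * (\<Sum>i\<in>J. a i powr q)"
    using J q k by (intro mult_right_mono powr_mono2 sum_nonneg) auto
  finally show ?thesis .
qed simp

definition pow_int :: "'a::euclidean_space set \<Rightarrow> real \<Rightarrow> ('a \<Rightarrow> real) \<Rightarrow> ennreal" where
  "pow_int S q f = (\<integral>\<^sup>+x. ennreal (\<bar>f x\<bar> powr q) \<partial>lebesgue_on S)"

lemma pow_int_eq:
  "S \<in> sets lebesgue \<Longrightarrow> pow_int S q f = (\<integral>\<^sup>+x. ennreal (\<bar>f x\<bar> powr q) * indicator S x \<partial>lebesgue)"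
  by (simp add: pow_int_def nn_integral_restrict_space)

lemma pow_int_mono_AE:
  assumes "S \<in> sets lebesgue" "S' \<in> sets lebesgue"
    and "AE x in lebesgue. x \<in> S \<longrightarrow> f x \<noteq> 0 \<longrightarrow> x \<in> S' \<and> \<bar>f x\<bar> \<le> \<bar>g x\<bar>" "0 \<le> q"
  shows "pow_int S q f \<le> pow_int S' q g"
  unfolding pow_int_eq[OF assms(1)] pow_int_eq[OF assms(2)]
  using assms(3) by (intro nn_integral_mono_AE, eventually_elim)
    (use assms(4) in \<open>auto simp: indicator_def intro!: powr_mono2\<close>)

lemma pow_int_cong_AE:
  assumes "S \<in> sets lebesgue" "AE x in lebesgue. x \<in> S \<longrightarrow> f x = g x"
  shows "pow_int S q f = pow_int S q g"
  unfolding pow_int_eq[OF assms(1)]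
  using assms(2) by (intro nn_integral_cong_AE, eventually_elim) (auto simp: indicator_def)

lemma Lp_space_iff:
  "f \<in> Lp_space S q \<longleftrightarrow> f \<in> borel_measurable (lebesgue_on S) \<and> pow_int S q f < \<infinity>"
proof -
  have [measurable]: "(\<lambda>x. \<bar>f x\<bar> powr q) \<in> borel_measurable (lebesgue_on S)"
    if [measurable]: "f \<in> borel_measurable (lebesgue_on S)"
    by measurable
  show ?thesis
    by (auto simp: Lp_space_def pow_int_def integrable_iff_bounded)
qed

lemma pow_int_eq_integral:
  assumes "f \<in> Lp_space S q"
  shows "pow_int S q f = ennreal (\<integral>x. \<bar>f x\<bar> powr q \<partial>lebesgue_on S)"
  using assms unfolding pow_int_def Lp_space_def by (intro nn_integral_eq_integral) auto

lemma pow_int_eq_Lp_norm: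
  assumes "f \<in> Lp_space S q" "0 < q"
  shows "pow_int S q f = ennreal (Lp_norm S q f powr q)"
  using assms(2) by (simp add: pow_int_eq_integral[OF assms(1)] Lp_norm_def powr_powr)

lemma Lp_norm_nonneg: "0 \<le> Lp_norm S q f"
  by (simp add: Lp_norm_def)

lemma grad_norm_nonneg: "0 \<le> grad_norm S q f"
  by (simp add: grad_norm_def)

lemma Lp_space_mono_bound:
  assumes S: "S \<in> sets lebesgue" "S' \<in> sets lebesgue" and g: "g \<in> Lp_space S' q" "0 \<le> q"
    and f: "f \<in> borel_measurable (lebesgue_on S)"
    and le: "AE x in lebesgue. x \<in> S \<longrightarrow> f x \<noteq> 0 \<longrightarrow> x \<in> S' \<and> \<bar>f x\<bar> \<le> \<bar>g x\<bar>"
  shows "f \<in> Lp_space S q"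
  using pow_int_mono_AE[OF S le g(2)] f g(1) by (auto simp: Lp_space_iff)

lemma Lp_space_restrict:
  assumes "f \<in> Lp_space S' q" "S \<subseteq> S'" "S \<in> sets lebesgue" "S' \<in> sets lebesgue" "0 \<le> q"
  shows "f \<in> Lp_space S q"
proof (rule Lp_space_mono_bound[OF assms(3,4,1,5)])
  have "f \<in> borel_measurable (lebesgue_on S')" using assms(1) by (simp add: Lp_space_iff)
  then have "f \<in> borel_measurable (restrict_space (lebesgue_on S') S)" by (rule measurable_restrict_space1)
  then show "f \<in> borel_measurable (lebesgue_on S)"
    using assms by (simp add: restrict_restrict_space Int_absorb1)
qed (use assms(2) in auto)

lemma Lp_space_cong:
  "(\<And>x. x \<in> S \<Longrightarrow> f x = g x) \<Longrightarrow> f \<in> Lp_space S q \<longleftrightarrow> g \<in> Lp_space S q"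
proof -
  assume eq: "\<And>x. x \<in> S \<Longrightarrow> f x = g x"
  then have "f \<in> borel_measurable (lebesgue_on S) \<longleftrightarrow> g \<in> borel_measurable (lebesgue_on S)"
    by (intro measurable_cong) (simp add: space_restrict_space)
  moreover have "pow_int S q f = pow_int S q g"
    unfolding pow_int_def using eq by (intro nn_integral_cong) (simp add: space_restrict_space)
  ultimately show ?thesis by (simp add: Lp_space_iff)
qed

lemma Lp_norm_cong: "(\<And>x. x \<in> S \<Longrightarrow> f x = g x) \<Longrightarrow> Lp_norm S q f = Lp_norm S q g"
  unfolding Lp_norm_def
  by (intro arg_cong[where f = "\<lambda>x. x powr _"] Bochner_Integration.integral_cong)
     (auto simp: space_restrict_space)

lemma Lp_norm_mono:
  assumes "f \<in> Lp_space S' q" "S \<subseteq> S'" "S \<in> sets lebesgue" "S' \<in> sets lebesgue" "0 < q"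
  shows "Lp_norm S q f \<le> Lp_norm S' q f"
proof -
  have "pow_int S q f \<le> pow_int S' q f"
    using assms by (intro pow_int_mono_AE) auto
  then have "(\<integral>x. \<bar>f x\<bar> powr q \<partial>lebesgue_on S) \<le> (\<integral>x. \<bar>f x\<bar> powr q \<partial>lebesgue_on S')"
    using assms by (simp add: pow_int_eq_integral Lp_space_restrict[OF assms(1-4)])
  then show ?thesis unfolding Lp_norm_def using assms(5) by (intro powr_mono2) auto
qed

lemma Lp_norm_eq_0_AE:
  assumes "f \<in> Lp_space S q" "Lp_norm S q f = 0" "S \<in> sets lebesgue" "0 < q"
  shows "AE x in lebesgue. x \<in> S \<longrightarrow> f x = 0"
proof -
  have [measurable]: "f \<in> borel_measurable (lebesgue_on S)" using assms(1) by (simp add: Lp_space_iff)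
  have "pow_int S q f = 0" using assms by (simp add: pow_int_eq_Lp_norm)
  then have "AE x in lebesgue_on S. ennreal (\<bar>f x\<bar> powr q) = 0"
    unfolding pow_int_def by (subst (asm) nn_integral_0_iff_AE) measurable
  then have "AE x in lebesgue. x \<in> S \<longrightarrow> ennreal (\<bar>f x\<bar> powr q) = 0"
    using assms(3) by (simp add: AE_restrict_space_iff)
  then show ?thesis by eventually_elim (auto simp: ennreal_eq_0_iff)
qed

context
  fixes \<rho> :: "'a::euclidean_space \<Rightarrow> real" and q :: real
  assumes \<rho>: "mollifier \<rho>" and q: "0 < q"
begin

lemma sobolev_weak_deriv:
  assumes V: "open V" and u: "u \<in> sobolev V q" and b: "(b::'a) \<in> Basis"
  shows "has_weak_deriv V b u (weak_deriv V b u)" "weak_deriv V b u \<in> Lp_space V q"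
proof -
  obtain g where g: "g \<in> Lp_space V q" "has_weak_deriv V b u g"
    using u b by (auto simp: sobolev_def)
  show wd: "has_weak_deriv V b u (weak_deriv V b u)"
    unfolding weak_deriv_def by (rule someI[of "has_weak_deriv V b u", OF g(2)])
  have meas: "weak_deriv V b u \<in> borel_measurable (lebesgue_on V)"
    by (rule locally_integrable_measurable[OF V has_weak_deriv_locally_integrable(2)[OF wd]])
  have "pow_int V q (weak_deriv V b u) = pow_int V q g"
    using V by (intro pow_int_cong_AE has_weak_deriv_unique[OF \<rho> V wd g(2)]) simp
  then show "weak_deriv V b u \<in> Lp_space V q" using meas g(1) by (simp add: Lp_space_iff)
qed

lemma pow_int_weak_deriv:
  assumes V: "open V" and g: "has_weak_deriv V (b::'a) u g"
  shows "pow_int V q (weak_deriv V b u) = pow_int V q g"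
proof -
  have "has_weak_deriv V b u (weak_deriv V b u)"
    unfolding weak_deriv_def by (rule someI[of "has_weak_deriv V b u", OF g])
  then show ?thesis
    using V by (intro pow_int_cong_AE has_weak_deriv_unique[OF \<rho> V _ g]) auto
qed

lemma sobolevI:
  assumes V: "open V" and u: "u \<in> Lp_space V q"
    and g: "\<And>b. b \<in> Basis \<Longrightarrow> has_weak_deriv V (b::'a) u (g b)" "\<And>b. b \<in> Basis \<Longrightarrow> pow_int V q (g b) < \<infinity>"
  shows "u \<in> sobolev V q"
  unfolding sobolev_def
proof (intro CollectI conjI ballI u)
  fix b :: 'a assume b: "b \<in> Basis"
  have "g b \<in> Lp_space V q"
    using g[OF b] locally_integrable_measurable[OF V has_weak_deriv_locally_integrable(2)]
    by (auto simp: Lp_space_iff)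
  then show "\<exists>g\<in>Lp_space V q. has_weak_deriv V b u g" using g(1)[OF b] by blast
qed

lemma grad_norm_eq:
  assumes V: "open V" and u: "u \<in> sobolev V q"
    and g: "\<And>b. b \<in> Basis \<Longrightarrow> has_weak_deriv V (b::'a) u (g b)"
  shows "(\<Sum>b\<in>Basis. pow_int V q (g b)) = ennreal (grad_norm V q u powr q)"
proof -
  have "(\<Sum>b\<in>Basis. pow_int V q (g b)) = (\<Sum>b\<in>Basis. pow_int V q (weak_deriv V b u))"
    using pow_int_weak_deriv[OF V g] by simp
  also have "\<dots> = (\<Sum>b\<in>Basis. ennreal (\<integral>x. \<bar>weak_deriv V b u x\<bar> powr q \<partial>lebesgue_on V))"
    using sobolev_weak_deriv(2)[OF V u] by (intro sum.cong pow_int_eq_integral) auto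
  also have "\<dots> = ennreal (\<Sum>b\<in>Basis. \<integral>x. \<bar>weak_deriv V b u x\<bar> powr q \<partial>lebesgue_on V)"
    by (rule sum_ennreal) simp
  also have "\<dots> = ennreal (grad_norm V q u powr q)"
    using q by (simp add: grad_norm_def powr_powr sum_nonneg)
  finally show ?thesis .
qed

end

lemma sobolev_restrict:
  assumes q: "0 < q" and "open V" "open W" "W \<subseteq> V" "u \<in> sobolev V q"
  shows "u \<in> sobolev W q"
proof -
  have s: "V \<in> sets lebesgue" "W \<in> sets lebesgue" using assms by auto
  have "\<exists>g\<in>Lp_space W q. has_weak_deriv W b u g" if "b \<in> Basis" for b
  proof -
    obtain g where "g \<in> Lp_space V q" "has_weak_deriv V b u g"
      using assms(5) \<open>b \<in> Basis\<close> by (auto simp: sobolev_def)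
    then show ?thesis
      using Lp_space_restrict[OF _ assms(4) s(2,1)] has_weak_deriv_subset[OF _ assms(4) s] q by (meson less_imp_le)
  qed
  then show ?thesis
    using assms(5) q Lp_space_restrict[OF _ assms(4) s(2,1)] by (auto simp: sobolev_def)
qed

lemma continuous_Lp_space:
  fixes f :: "'a::euclidean_space \<Rightarrow> real"
  assumes q: "0 < q" and f: "continuous_on UNIV f" "bounded {x. f x \<noteq> 0}"
  shows "f \<in> Lp_space UNIV q"
proof -
  have "integrable lborel (\<lambda>x. \<bar>f x\<bar> powr q)"
    using f q by (intro integrable_continuous_bounded_support continuous_on_powr' continuous_intros) auto
  then have "integrable lebesgue (\<lambda>x. \<bar>f x\<bar> powr q)"
    by (subst integrable_completion) auto
  moreover have "f \<in> borel_measurable lebesgue"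
    using borel_measurable_continuous_onI[OF f(1)] by (intro measurable_completion) simp
  ultimately show ?thesis by (simp add: Lp_space_def lebesgue_on_UNIV_eq)
qed

lemma smooth_bounded_support_sobolev:
  fixes f :: "'a::euclidean_space \<Rightarrow> real"
  assumes q: "0 < q" and f: "smooth_on UNIV f" "bounded {x. f x \<noteq> 0}"
  shows "f \<in> sobolev UNIV q"
  unfolding sobolev_def
  using f has_weak_deriv_smooth[OF f(1)]
  by (auto intro!: continuous_Lp_space[OF q] smooth_on_continuous bexI[of _ "partial_deriv _ f"]
      smooth_on_partial_deriv bounded_support_partial_deriv)

section \<open>Extension across the boundary\<close>

lemma pow_int_add_convex:
  assumes f: "f \<in> borel_measurable (lebesgue_on S)" and g: "g \<in> borel_measurable (lebesgue_on S)"
    and q: "1 \<le> q" and z: "0 < z" "z < 1"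
  shows "pow_int S q (\<lambda>x. \<bar>f x\<bar> + \<bar>g x\<bar>) \<le>
    ennreal (z powr (1 - q)) * pow_int S q f + ennreal ((1 - z) powr (1 - q)) * pow_int S q g"
proof -
  note [measurable] = f g
  have "pow_int S q (\<lambda>x. \<bar>f x\<bar> + \<bar>g x\<bar>) \<le>
      (\<integral>\<^sup>+x. ennreal (z powr (1 - q)) * ennreal (\<bar>f x\<bar> powr q) +
        ennreal ((1 - z) powr (1 - q)) * ennreal (\<bar>g x\<bar> powr q) \<partial>lebesgue_on S)"
    unfolding pow_int_def
  proof (rule nn_integral_mono)
    fix x
    have "(\<bar>f x\<bar> + \<bar>g x\<bar>) powr q \<le>
        z powr (1 - q) * \<bar>f x\<bar> powr q + (1 - z) powr (1 - q) * \<bar>g x\<bar> powr q"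
      using q z by (intro powr_add_le_convex) auto
    then show "ennreal (\<bar>\<bar>f x\<bar> + \<bar>g x\<bar>\<bar> powr q) \<le> ennreal (z powr (1 - q)) * ennreal (\<bar>f x\<bar> powr q) +
        ennreal ((1 - z) powr (1 - q)) * ennreal (\<bar>g x\<bar> powr q)"
      by (simp add: ennreal_mult[symmetric] ennreal_plus[symmetric] ennreal_leI del: ennreal_plus)
  qed
  also have "\<dots> = ennreal (z powr (1 - q)) * pow_int S q f + ennreal ((1 - z) powr (1 - q)) * pow_int S q g"
    unfolding pow_int_def by (simp add: nn_integral_add nn_integral_cmult)
  finally show ?thesis .
qed

lemma pow_int_cmult:
  assumes [measurable]: "f \<in> borel_measurable (lebesgue_on S)"
  shows "pow_int S q (\<lambda>x. c * f x) = ennreal (\<bar>c\<bar> powr q) * pow_int S q f"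
  unfolding pow_int_def by (simp add: abs_mult powr_mult ennreal_mult nn_integral_cmult)

locale smooth_patches =
  fixes \<Omega> :: "'a::euclidean_space set" and U D :: "nat \<Rightarrow> 'a set" and \<phi> lam :: "nat \<Rightarrow> 'a \<Rightarrow> real"
    and \<kappa> c :: real and N :: nat
  assumes open_dom: "open \<Omega>" "\<And>i. open (U i)" "\<And>i. open (D i)"
    and agree: "\<And>i. U i \<inter> \<Omega> = U i \<inter> D i"
    and overlap: "\<And>x. finite {i. x \<in> U i}" "\<And>x. card {i. x \<in> U i} \<le> N" "1 \<le> N"
    and pos: "0 < \<kappa>" "0 \<le> c"
    and phi: "\<And>i. smooth_on UNIV (\<phi> i)" "\<And>i x. 0 \<le> \<phi> i x" "\<And>i x. \<phi> i x \<le> 1"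
      "\<And>i b x. b \<in> Basis \<Longrightarrow> \<bar>partial_deriv b (\<phi> i) x\<bar> \<le> 2 * c"
      "\<And>i x y. \<phi> i y \<noteq> 0 \<Longrightarrow> dist x y < \<kappa> \<Longrightarrow> x \<in> U i"
    and lam: "\<And>i. smooth_on UNIV (lam i)" "\<And>i x. 0 \<le> lam i x" "\<And>i x. lam i x \<le> 1"
      "\<And>i b x. b \<in> Basis \<Longrightarrow> \<bar>partial_deriv b (lam i) x\<bar> \<le> c"
      "\<And>i. closure {x. lam i x \<noteq> 0} \<subseteq> U i"
    and lam_phi: "\<And>i x. \<phi> i x \<noteq> 0 \<Longrightarrow> lam i x = 1"
    and partition: "\<And>x. x \<in> frontier \<Omega> \<Longrightarrow>
      \<exists>V. open V \<and> x \<in> V \<and> (\<forall>y\<in>V. (\<Sum>i | y \<in> U i. \<phi> i y) = 1)"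
begin

lemma sets_dom [simp]: "\<Omega> \<in> sets lebesgue" "U i \<in> sets lebesgue" "D i \<in> sets lebesgue"
  using open_dom by auto

lemma partial_deriv_phi_support:
  assumes "partial_deriv b (\<phi> i) y \<noteq> 0" "dist x y < \<kappa>"
  shows "x \<in> U i"
proof -
  have "y \<in> closure {z. \<phi> i z \<noteq> 0}" using partial_deriv_support assms(1) by blast
  then have "ball x \<kappa> \<inter> {z. \<phi> i z \<noteq> 0} \<noteq> {}"
    using open_Int_closure_eq_empty[of "ball x \<kappa>" "{z. \<phi> i z \<noteq> 0}"] assms(2) by auto
  then show ?thesis using phi(5) by auto
qed

definition \<theta> :: "'a \<Rightarrow> real" where
  "\<theta> x = (if x \<in> \<Omega> then 1 - (\<Sum>i | x \<in> U i. \<phi> i x) else 0)"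

lemma sum_phi_local:
  assumes "dist x y < \<kappa>"
  shows "(\<Sum>i | y \<in> U i. \<phi> i y) = (\<Sum>i | x \<in> U i. \<phi> i y)"
proof (rule sum.mono_neutral_cong)
  show "\<And>i. i \<in> {i. x \<in> U i} - {i. y \<in> U i} \<Longrightarrow> \<phi> i y = 0"
    using phi(5)[of _ y y] pos by auto
  show "\<And>i. i \<in> {i. y \<in> U i} - {i. x \<in> U i} \<Longrightarrow> \<phi> i y = 0"
    using phi(5)[OF _ assms] by auto
qed (auto simp: overlap)

lemma theta_zero_nhd:
  assumes "x \<notin> \<Omega>"
  obtains V where "open V" "x \<in> V" "\<And>y. y \<in> V \<Longrightarrow> \<theta> y = 0"
proof (cases "x \<in> closure \<Omega>")
  case True
  then have "x \<in> frontier \<Omega>" using assms open_dom(1) by (simp add: frontier_def interior_open)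
  then show ?thesis using partition[of x] that unfolding \<theta>_def by (metis diff_self)
next
  case False
  have "\<theta> y = 0" if "y \<in> - closure \<Omega>" for y
    using that closure_subset[of \<Omega>] by (auto simp: \<theta>_def)
  then show ?thesis using that[of "- closure \<Omega>"] False by auto
qed

lemma smooth_theta: "smooth_on UNIV \<theta>"
proof (rule smooth_on_localI)
  fix x
  show "\<exists>V g. open V \<and> x \<in> V \<and> smooth_on UNIV g \<and> (\<forall>y\<in>V. \<theta> y = g y)"
  proof (cases "x \<in> \<Omega>")
    case True
    have "smooth_on UNIV (\<lambda>y. 1 - (\<Sum>i | x \<in> U i. \<phi> i y))"
      by (intro smooth_on_diff smooth_on_const smooth_on_sum phi)
    moreover have "\<forall>y\<in>ball x \<kappa> \<inter> \<Omega>. \<theta> y = 1 - (\<Sum>i | x \<in> U i. \<phi> i y)"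
      using sum_phi_local by (auto simp: \<theta>_def)
    ultimately show ?thesis
      using True pos(1) open_dom(1) by (intro exI[of _ "ball x \<kappa> \<inter> \<Omega>"]) auto
  next
    case False
    then show ?thesis using theta_zero_nhd[OF False] smooth_on_const[of 0] by metis
  qed
qed

lemma closure_theta: "closure {x. \<theta> x \<noteq> 0} \<subseteq> \<Omega>"
proof
  fix x assume x: "x \<in> closure {x. \<theta> x \<noteq> 0}"
  show "x \<in> \<Omega>"
  proof (rule ccontr)
    assume "x \<notin> \<Omega>"
    from theta_zero_nhd[OF this] obtain V where "open V" "x \<in> V" "\<And>y. y \<in> V \<Longrightarrow> \<theta> y = 0" by blast
    then have "V \<inter> closure {x. \<theta> x \<noteq> 0} = {}"
      using open_Int_closure_eq_empty[of V] by blast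
    then show False using x \<open>x \<in> V\<close> by blast
  qed
qed

lemma partial_deriv_theta: "x \<notin> \<Omega> \<Longrightarrow> partial_deriv b \<theta> x = 0"
  using partial_deriv_support closure_theta by blast

lemma lam_support: "lam i x \<noteq> 0 \<Longrightarrow> x \<in> U i" "partial_deriv b (lam i) x \<noteq> 0 \<Longrightarrow> x \<in> U i"
  using lam(5)[of i] closure_subset[of "{x. lam i x \<noteq> 0}"] partial_deriv_support[of x "lam i" b] by blast+

lemma lam_mem: "x \<in> D i \<Longrightarrow> x \<in> U i \<Longrightarrow> x \<in> \<Omega> \<inter> U i"
  using agree[of i] by blast

lemma pow_int_overlap:
  assumes f: "f \<in> borel_measurable (lebesgue_on \<Omega>)"
  shows "(\<Sum>i. pow_int (\<Omega> \<inter> U i) q f) \<le> of_nat N * pow_int \<Omega> q f"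
proof -
  note [measurable] = f
  have [measurable]: "indicator (U i) \<in> borel_measurable (lebesgue_on \<Omega>)" for i
    by (intro measurable_restrict_space1 borel_measurable_indicator) simp
  have "pow_int (\<Omega> \<inter> U i) q f = (\<integral>\<^sup>+x. ennreal (\<bar>f x\<bar> powr q) * indicator (U i) x \<partial>lebesgue_on \<Omega>)" for i
  proof -
    have "pow_int (\<Omega> \<inter> U i) q f = (\<integral>\<^sup>+x. ennreal (\<bar>f x\<bar> powr q) * indicator (U i) x * indicator \<Omega> x \<partial>lebesgue)"
      by (subst pow_int_eq) (auto simp: indicator_def intro!: nn_integral_cong)
    then show ?thesis by (simp add: nn_integral_restrict_space)
  qed
  then have "(\<Sum>i. pow_int (\<Omega> \<inter> U i) q f) =
      (\<integral>\<^sup>+x. (\<Sum>i. ennreal (\<bar>f x\<bar> powr q) * indicator (U i) x) \<partial>lebesgue_on \<Omega>)"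
    by (subst nn_integral_suminf) auto
  also have "\<dots> \<le> (\<integral>\<^sup>+x. of_nat N * ennreal (\<bar>f x\<bar> powr q) \<partial>lebesgue_on \<Omega>)"
  proof (rule nn_integral_mono)
    fix x
    have "(\<Sum>i. indicator (U i) x :: ennreal) = (\<Sum>i | x \<in> U i. indicator (U i) x)"
      by (rule suminf_finite) (auto simp: overlap)
    also have "\<dots> = of_nat (card {i. x \<in> U i})" by simp
    also have "\<dots> \<le> of_nat N" using overlap(2) by (simp only: of_nat_le_iff)
    finally have le: "(\<Sum>i. indicator (U i) x :: ennreal) \<le> of_nat N" .
    show "(\<Sum>i. ennreal (\<bar>f x\<bar> powr q) * indicator (U i) x) \<le> of_nat N * ennreal (\<bar>f x\<bar> powr q)"
      unfolding ennreal_suminf_cmult mult.commute[of "of_nat N"] by (rule mult_left_mono[OF le]) simp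
  qed
  also have "\<dots> = of_nat N * pow_int \<Omega> q f" unfolding pow_int_def by (simp add: nn_integral_cmult)
  finally show ?thesis .
qed

lemma pow_int_glue:
  assumes q: "1 \<le> q"
    and g: "g \<in> borel_measurable (lebesgue_on \<Omega>)" and F: "\<And>i. F i \<in> borel_measurable lebesgue"
    and on: "AE x in lebesgue. x \<in> \<Omega> \<longrightarrow> f x = g x"
    and off: "\<And>x. x \<notin> \<Omega> \<Longrightarrow> \<bar>f x\<bar> \<le> (\<Sum>i | x \<in> U i. \<bar>F i x\<bar>)"
  shows "pow_int UNIV q f \<le> pow_int \<Omega> q g + ennreal (real N powr (q - 1)) * (\<Sum>i. pow_int UNIV q (F i))"
proof -
  note [measurable] = g F
  have [measurable]: "(\<lambda>x. ennreal (\<bar>g x\<bar> powr q) * indicator \<Omega> x) \<in> borel_measurable lebesgue"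
    using borel_measurable_restrict_space_iff_ennreal[of \<Omega> lebesgue "\<lambda>x. ennreal (\<bar>g x\<bar> powr q)"] by simp
  have "pow_int UNIV q f \<le> (\<integral>\<^sup>+x. ennreal (\<bar>g x\<bar> powr q) * indicator \<Omega> x +
      ennreal (real N powr (q - 1)) * (\<Sum>i. ennreal (\<bar>F i x\<bar> powr q)) \<partial>lebesgue)"
    unfolding pow_int_def lebesgue_on_UNIV_eq
  proof (rule nn_integral_mono_AE, use on in eventually_elim)
    fix x assume on: "x \<in> \<Omega> \<longrightarrow> f x = g x"
    show "ennreal (\<bar>f x\<bar> powr q) \<le> ennreal (\<bar>g x\<bar> powr q) * indicator \<Omega> x +
      ennreal (real N powr (q - 1)) * (\<Sum>i. ennreal (\<bar>F i x\<bar> powr q))"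
    proof (cases "x \<in> \<Omega>")
      case False
      have "\<bar>f x\<bar> powr q \<le> (\<Sum>i | x \<in> U i. \<bar>F i x\<bar>) powr q"
        using off[OF False] q by (intro powr_mono2) auto
      also have "\<dots> \<le> real N powr (q - 1) * (\<Sum>i | x \<in> U i. \<bar>F i x\<bar> powr q)"
        using q overlap by (intro sum_powr_le_card) auto
      finally have "ennreal (\<bar>f x\<bar> powr q) \<le>
          ennreal (real N powr (q - 1)) * (\<Sum>i | x \<in> U i. ennreal (\<bar>F i x\<bar> powr q))"
        by (simp add: ennreal_mult[symmetric] sum_nonneg ennreal_leI)
      also have "\<dots> \<le> ennreal (real N powr (q - 1)) * (\<Sum>i. ennreal (\<bar>F i x\<bar> powr q))"
        by (intro mult_left_mono sum_le_suminf) (auto simp: overlap)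
      finally show ?thesis using False by simp
    qed (use on in simp)
  qed
  also have "\<dots> = pow_int \<Omega> q g + ennreal (real N powr (q - 1)) * (\<Sum>i. pow_int UNIV q (F i))"
    by (subst nn_integral_add) (auto simp: nn_integral_cmult nn_integral_suminf pow_int_eq lebesgue_on_UNIV_eq pow_int_def nn_integral_restrict_space)
  finally show ?thesis .
qed

context
  fixes \<rho> u :: "'a \<Rightarrow> real" and q :: real
  assumes \<rho>: "mollifier \<rho>" and q: "1 \<le> q" and u: "u \<in> sobolev \<Omega> q"
begin

lemma q_pos: "0 < q" using q by simp

lemma u_Lp: "u \<in> Lp_space \<Omega> q" "u \<in> borel_measurable (lebesgue_on \<Omega>)"
  using u by (auto simp: sobolev_def Lp_space_iff)

lemma has_weak_deriv_u: "b \<in> Basis \<Longrightarrow> has_weak_deriv \<Omega> b u (weak_deriv \<Omega> b u)"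
  and weak_deriv_u_Lp: "b \<in> Basis \<Longrightarrow> weak_deriv \<Omega> b u \<in> Lp_space \<Omega> q"
  by (auto intro: sobolev_weak_deriv[OF \<rho> q_pos open_dom(1) u])

lemma weak_deriv_u_measurable: "b \<in> Basis \<Longrightarrow> weak_deriv \<Omega> b u \<in> borel_measurable (lebesgue_on \<Omega>)"
  using weak_deriv_u_Lp by (auto simp: Lp_space_iff)

lemma has_weak_deriv_lam_u:
  assumes "b \<in> Basis"
  shows "has_weak_deriv (D i) b (\<lambda>x. lam i x * u x)
      (\<lambda>x. lam i x * weak_deriv \<Omega> b u x + partial_deriv b (lam i) x * u x)"
  using lam(5)[of i] agree[of i] assms
  by (intro has_weak_deriv_mult_smooth[OF has_weak_deriv_u] lam) auto

lemma pow_int_lam_u: "pow_int (D i) q (\<lambda>x. lam i x * u x) \<le> pow_int (\<Omega> \<inter> U i) q u"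
proof (intro pow_int_mono_AE AE_I2 impI conjI)
  fix x assume "x \<in> D i" "lam i x * u x \<noteq> 0"
  then show "x \<in> \<Omega> \<inter> U i" using lam_support(1) lam_mem by auto
  show "\<bar>lam i x * u x\<bar> \<le> \<bar>u x\<bar>" using lam(2,3)[of i x] by (simp add: abs_mult mult_left_le_one_le)
qed (use q in auto)

lemma pow_int_weak_deriv_lam_u:
  assumes b: "b \<in> Basis" and z: "0 < z" "z < 1"
  shows "pow_int (D i) q (\<lambda>x. lam i x * weak_deriv \<Omega> b u x + partial_deriv b (lam i) x * u x) \<le>
    ennreal (z powr (1 - q)) * pow_int (\<Omega> \<inter> U i) q (weak_deriv \<Omega> b u) +
    ennreal ((1 - z) powr (1 - q) * c powr q) * pow_int (\<Omega> \<inter> U i) q u"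
proof -
  have m: "f \<in> borel_measurable (lebesgue_on (\<Omega> \<inter> U i))" if "f \<in> borel_measurable (lebesgue_on \<Omega>)"
    for f :: "'a \<Rightarrow> real"
    using measurable_restrict_space1[OF that, of "U i"] by (simp add: restrict_restrict_space)
  note m = m[OF u_Lp(2)] m[OF weak_deriv_u_measurable[OF b]]
  have "pow_int (D i) q (\<lambda>x. lam i x * weak_deriv \<Omega> b u x + partial_deriv b (lam i) x * u x) \<le>
      pow_int (\<Omega> \<inter> U i) q (\<lambda>x. \<bar>weak_deriv \<Omega> b u x\<bar> + \<bar>c * u x\<bar>)"
  proof (intro pow_int_mono_AE AE_I2 impI conjI)
    fix x assume "x \<in> D i" "lam i x * weak_deriv \<Omega> b u x + partial_deriv b (lam i) x * u x \<noteq> 0"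
    then show "x \<in> \<Omega> \<inter> U i" using lam_support[where i = i and x = x] lam_mem[where i = i and x = x] by fastforce
    have "\<bar>lam i x * weak_deriv \<Omega> b u x\<bar> \<le> \<bar>weak_deriv \<Omega> b u x\<bar>"
      using lam(2,3)[of i x] by (simp add: abs_mult mult_left_le_one_le)
    moreover have "\<bar>partial_deriv b (lam i) x * u x\<bar> \<le> \<bar>c * u x\<bar>"
      using lam(4)[OF b, of i x] pos by (simp add: abs_mult mult_right_mono)
    ultimately show "\<bar>lam i x * weak_deriv \<Omega> b u x + partial_deriv b (lam i) x * u x\<bar> \<le>
        \<bar>\<bar>weak_deriv \<Omega> b u x\<bar> + \<bar>c * u x\<bar>\<bar>" by linarith
  qed (use q in auto)
  also have "\<dots> \<le> ennreal (z powr (1 - q)) * pow_int (\<Omega> \<inter> U i) q (weak_deriv \<Omega> b u) +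
      ennreal ((1 - z) powr (1 - q)) * pow_int (\<Omega> \<inter> U i) q (\<lambda>x. c * u x)"
    using m by (intro pow_int_add_convex q z) auto
  also have "\<dots> = ennreal (z powr (1 - q)) * pow_int (\<Omega> \<inter> U i) q (weak_deriv \<Omega> b u) +
      ennreal ((1 - z) powr (1 - q) * c powr q) * pow_int (\<Omega> \<inter> U i) q u"
    using pos(2) by (simp add: pow_int_cmult[OF m(1)] ennreal_mult mult.assoc)
  finally show ?thesis .
qed

lemma lam_u_sobolev: "(\<lambda>x. lam i x * u x) \<in> sobolev (D i) q"
proof (rule sobolevI[OF \<rho> q_pos open_dom(3) _ has_weak_deriv_lam_u])
  have fin: "pow_int (\<Omega> \<inter> U i) q f < \<infinity>" if "f \<in> Lp_space \<Omega> q" for f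
    using pow_int_mono_AE[of "\<Omega> \<inter> U i" \<Omega> f f q] that q sets.Int[OF sets_dom(1,2)]
    by (auto simp: Lp_space_iff intro: order_le_less_trans)
  have "(\<lambda>x. lam i x * u x) \<in> borel_measurable (lebesgue_on (D i))"
    using has_weak_deriv_lam_u[OF SOME_Basis] has_weak_deriv_locally_integrable(1)
      locally_integrable_measurable[OF open_dom(3)] by blast
  then show "(\<lambda>x. lam i x * u x) \<in> Lp_space (D i) q"
    using pow_int_lam_u[of i] fin[OF u_Lp(1)] by (auto simp: Lp_space_iff order_le_less_trans)
  fix b :: 'a assume b: "b \<in> Basis"
  show "pow_int (D i) q (\<lambda>x. lam i x * weak_deriv \<Omega> b u x + partial_deriv b (lam i) x * u x) < \<infinity>"
    using pow_int_weak_deriv_lam_u[OF b, of "1/2" i] fin[OF u_Lp(1)] fin[OF weak_deriv_u_Lp[OF b]]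
    by (auto simp: ennreal_mult_less_top order_le_less_trans)
qed

lemma extension_bound:
  fixes v :: "nat \<Rightarrow> 'a \<Rightarrow> real" and A A' z t :: real
  assumes v: "\<And>i. v i \<in> sobolev UNIV q" "\<And>i x. x \<in> D i \<Longrightarrow> v i x = lam i x * u x"
    and A: "0 \<le> A" "\<And>i. Lp_norm UNIV q (v i) \<le> A * Lp_norm (D i) q (\<lambda>x. lam i x * u x)"
    and A': "0 \<le> A'" "\<And>i. grad_norm UNIV q (v i) \<le> A' * grad_norm (D i) q (\<lambda>x. lam i x * u x)"
    and z: "0 < z" "z < 1" and t: "0 < t" "t < 1"
  obtains w where "w \<in> sobolev UNIV q" "\<And>x. x \<in> \<Omega> \<Longrightarrow> w x = u x"
    "grad_norm UNIV q w powr q \<le> grad_norm \<Omega> q u powr q + real N powr q *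
      (t powr (1 - q) * (2 * c * A) powr q * DIM('a) * Lp_norm \<Omega> q u powr q +
       (1 - t) powr (1 - q) * A' powr q * (z powr (1 - q) * grad_norm \<Omega> q u powr q +
         (1 - z) powr (1 - q) * c powr q * DIM('a) * Lp_norm \<Omega> q u powr q))"
proof -
  define g where "g b = weak_deriv \<Omega> b u" for b
  define h where "h b i = weak_deriv UNIV b (v i)" for b i
  define w where "w x = (\<Sum>i | x \<in> U i. \<phi> i x * v i x) + \<theta> x * u x" for x
  define G where "G b x = (\<Sum>i | x \<in> U i. \<phi> i x * h b i x + partial_deriv b (\<phi> i) x * v i x) +
      (\<theta> x * g b x + partial_deriv b \<theta> x * u x)" for b x
  let ?X = "ennreal (grad_norm \<Omega> q u powr q)" and ?Y = "ennreal (Lp_norm \<Omega> q u powr q)"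
  have X: "(\<Sum>b\<in>Basis. pow_int \<Omega> q (g b)) = ?X"
    unfolding g_def by (rule grad_norm_eq[OF \<rho> q_pos open_dom(1) u has_weak_deriv_u])
  have Y: "pow_int \<Omega> q u = ?Y" by (rule pow_int_eq_Lp_norm[OF u_Lp(1) q_pos])
  have h: "has_weak_deriv UNIV b (v i) (h b i)" if "b \<in> Basis" for b i
    unfolding h_def using sobolev_weak_deriv(1)[OF \<rho> q_pos open_UNIV v(1) that] .
  have hm: "h b i \<in> borel_measurable lebesgue" if "b \<in> Basis" for b i
    using locally_integrable_measurable[OF open_UNIV has_weak_deriv_locally_integrable(2)[OF h[OF that]]]
    by (simp add: lebesgue_on_UNIV_eq)
  have vm: "v i \<in> borel_measurable lebesgue" for i
    using v(1)[of i] by (auto simp: sobolev_def Lp_space_iff lebesgue_on_UNIV_eq)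
  have wu: "w x = u x" if x: "x \<in> \<Omega>" for x
  proof -
    have "\<phi> i x * v i x = \<phi> i x * u x" if "x \<in> U i" for i
      using v(2)[where i = i and x = x] lam_phi[of i x] agree[of i] x that by (cases "\<phi> i x = 0") auto
    then have "(\<Sum>i | x \<in> U i. \<phi> i x * v i x) = (\<Sum>i | x \<in> U i. \<phi> i x * u x)"
      by (intro sum.cong) auto
    then have "(\<Sum>i | x \<in> U i. \<phi> i x * v i x) = (\<Sum>i | x \<in> U i. \<phi> i x) * u x"
      by (simp only: sum_distrib_right)
    then show ?thesis using x by (simp add: w_def \<theta>_def algebra_simps)
  qed
  have wG: "has_weak_deriv UNIV b w (G b)" if b: "b \<in> Basis" for b
    unfolding w_def[abs_def] G_def[abs_def]
  proof (intro has_weak_deriv_add has_weak_deriv_locally_finite_sum[OF _ _ b _ pos(1)] b)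
    show "has_weak_deriv UNIV b (\<lambda>x. \<phi> i x * v i x) (\<lambda>x. \<phi> i x * h b i x + partial_deriv b (\<phi> i) x * v i x)" for i
      by (intro has_weak_deriv_mult_smooth[OF h[OF b]] phi b) auto
    show "has_weak_deriv UNIV b (\<lambda>x. \<theta> x * u x) (\<lambda>x. \<theta> x * g b x + partial_deriv b \<theta> x * u x)"
      unfolding g_def using closure_theta
      by (intro has_weak_deriv_mult_smooth[OF has_weak_deriv_u[OF b]] smooth_theta b) auto
    show "\<phi> i y * v i y = 0 \<and> \<phi> i y * h b i y + partial_deriv b (\<phi> i) y * v i y = 0"
      if "dist x y < \<kappa>" "i \<notin> {i. x \<in> U i}" for i x y
    proof -
      have "\<phi> i y = 0" "partial_deriv b (\<phi> i) y = 0"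
        using phi(5)[of i y x] partial_deriv_phi_support[of b i y x] that by blast+
      then show ?thesis by simp
    qed
  qed (auto simp: overlap)
  have Gg: "AE x in lebesgue. x \<in> \<Omega> \<longrightarrow> G b x = g b x" if b: "b \<in> Basis" for b
  proof (rule has_weak_deriv_unique[OF \<rho> open_dom(1)])
    show "has_weak_deriv \<Omega> b u (g b)" unfolding g_def by (rule has_weak_deriv_u[OF b])
    have "has_weak_deriv \<Omega> b w (G b)" by (rule has_weak_deriv_subset[OF wG[OF b]]) auto
    then show "has_weak_deriv \<Omega> b u (G b)" using has_weak_deriv_cong[of \<Omega> w u "G b" "G b" b] wu by simp
  qed
  have V: "(\<Sum>i. pow_int UNIV q (v i)) \<le> ennreal (A powr q) * (of_nat N * ?Y)"
  proof -
    have "pow_int UNIV q (v i) \<le> ennreal (A powr q) * pow_int (\<Omega> \<inter> U i) q u" for i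
    proof -
      have "v i \<in> Lp_space UNIV q" using v(1)[of i] by (simp add: sobolev_def)
      then have "pow_int UNIV q (v i) = ennreal (Lp_norm UNIV q (v i) powr q)"
        by (rule pow_int_eq_Lp_norm[OF _ q_pos])
      also have "\<dots> \<le> ennreal ((A * Lp_norm (D i) q (\<lambda>x. lam i x * u x)) powr q)"
        using A(2)[of i] q by (intro ennreal_leI powr_mono2 Lp_norm_nonneg) auto
      also have "\<dots> = ennreal (A powr q) * pow_int (D i) q (\<lambda>x. lam i x * u x)"
        using lam_u_sobolev[of i] A(1)
        by (subst pow_int_eq_Lp_norm) (auto simp: q_pos sobolev_def powr_mult Lp_norm_nonneg ennreal_mult)
      also have "\<dots> \<le> ennreal (A powr q) * pow_int (\<Omega> \<inter> U i) q u"
        by (intro mult_left_mono pow_int_lam_u) simp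
      finally show ?thesis .
    qed
    then have "(\<Sum>i. pow_int UNIV q (v i)) \<le> (\<Sum>i. ennreal (A powr q) * pow_int (\<Omega> \<inter> U i) q u)"
      by (intro suminf_le) auto
    also have "\<dots> \<le> ennreal (A powr q) * (of_nat N * ?Y)"
      unfolding Y[symmetric] ennreal_suminf_cmult by (intro mult_left_mono pow_int_overlap u_Lp) simp
    finally show ?thesis .
  qed
  define K where "K = ennreal ((1 - z) powr (1 - q) * c powr q)"
  define Z where "Z = ennreal (z powr (1 - q))"
  have H: "(\<Sum>i. \<Sum>b\<in>Basis. pow_int UNIV q (h b i)) \<le>
      ennreal (A' powr q) * (Z * (of_nat N * ?X) + of_nat DIM('a) * (K * (of_nat N * ?Y)))"
  proof -
    have "(\<Sum>b\<in>Basis. pow_int UNIV q (h b i)) \<le> ennreal (A' powr q) *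
        (Z * (\<Sum>b\<in>Basis. pow_int (\<Omega> \<inter> U i) q (g b)) + of_nat DIM('a) * (K * pow_int (\<Omega> \<inter> U i) q u))" for i
    proof -
      have "(\<Sum>b\<in>Basis. pow_int UNIV q (h b i)) = ennreal (grad_norm UNIV q (v i) powr q)"
        by (rule grad_norm_eq[OF \<rho> q_pos open_UNIV v(1) h])
      also have "\<dots> \<le> ennreal ((A' * grad_norm (D i) q (\<lambda>x. lam i x * u x)) powr q)"
        using A'(2)[of i] q by (intro ennreal_leI powr_mono2 grad_norm_nonneg) auto
      also have "\<dots> = ennreal (A' powr q) * (\<Sum>b\<in>Basis. pow_int (D i) q
          (\<lambda>x. lam i x * weak_deriv \<Omega> b u x + partial_deriv b (lam i) x * u x))"
        using A'(1) by (subst grad_norm_eq[OF \<rho> q_pos open_dom(3) lam_u_sobolev has_weak_deriv_lam_u])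
          (auto simp: powr_mult grad_norm_nonneg ennreal_mult)
      also have "\<dots> \<le> ennreal (A' powr q) * (\<Sum>b\<in>Basis. Z * pow_int (\<Omega> \<inter> U i) q (g b) + K * pow_int (\<Omega> \<inter> U i) q u)"
        unfolding Z_def K_def g_def by (intro mult_left_mono sum_mono pow_int_weak_deriv_lam_u z) auto
      finally show ?thesis by (simp add: sum.distrib sum_distrib_left)
    qed
    then have "(\<Sum>i. \<Sum>b\<in>Basis. pow_int UNIV q (h b i)) \<le> (\<Sum>i. ennreal (A' powr q) *
        (Z * (\<Sum>b\<in>Basis. pow_int (\<Omega> \<inter> U i) q (g b)) + of_nat DIM('a) * (K * pow_int (\<Omega> \<inter> U i) q u)))"
      by (intro suminf_le) auto
    also have "\<dots> = ennreal (A' powr q) * (Z * (\<Sum>b\<in>Basis. \<Sum>i. pow_int (\<Omega> \<inter> U i) q (g b)) +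
        of_nat DIM('a) * (K * (\<Sum>i. pow_int (\<Omega> \<inter> U i) q u)))"
      by (simp add: suminf_add[symmetric] suminf_sum)
    also have "\<dots> \<le> ennreal (A' powr q) * (Z * (\<Sum>b\<in>Basis. of_nat N * pow_int \<Omega> q (g b)) +
        of_nat DIM('a) * (K * (of_nat N * pow_int \<Omega> q u)))"
      unfolding g_def
      by (intro mult_left_mono add_mono sum_mono pow_int_overlap u_Lp weak_deriv_u_measurable) auto
    finally show ?thesis unfolding sum_distrib_left[symmetric] X Y .
  qed
  define P where "P = ennreal (real N powr (q - 1))"
  define Th where "Th = ennreal (t powr (1 - q) * (2 * c) powr q)"
  define Th' where "Th' = ennreal ((1 - t) powr (1 - q))"
  have Gb: "pow_int UNIV q (G b) \<le> pow_int \<Omega> q (g b) + P * (\<Sum>i. Th * pow_int UNIV q (v i) + Th' * pow_int UNIV q (h b i))"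
    if b: "b \<in> Basis" for b
  proof -
    have gm: "g b \<in> borel_measurable (lebesgue_on \<Omega>)" unfolding g_def by (rule weak_deriv_u_measurable[OF b])
    have "pow_int UNIV q (G b) \<le> pow_int \<Omega> q (g b) + P * (\<Sum>i. pow_int UNIV q (\<lambda>x. \<bar>2 * c * v i x\<bar> + \<bar>h b i x\<bar>))"
      unfolding P_def
    proof (rule pow_int_glue[OF q gm _ Gg[OF b]])
      show "(\<lambda>x. \<bar>2 * c * v i x\<bar> + \<bar>h b i x\<bar>) \<in> borel_measurable lebesgue" for i
        using vm[of i] hm[OF b, of i] by measurable
      fix x assume x: "x \<notin> \<Omega>"
      then have "G b x = (\<Sum>i | x \<in> U i. \<phi> i x * h b i x + partial_deriv b (\<phi> i) x * v i x)"
        by (simp add: G_def \<theta>_def partial_deriv_theta)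
      also have "\<bar>\<dots>\<bar> \<le> (\<Sum>i | x \<in> U i. \<bar>\<phi> i x * h b i x + partial_deriv b (\<phi> i) x * v i x\<bar>)" by (rule sum_abs)
      also have "\<dots> \<le> (\<Sum>i | x \<in> U i. \<bar>\<bar>2 * c * v i x\<bar> + \<bar>h b i x\<bar>\<bar>)"
      proof (rule sum_mono)
        fix i
        have "\<bar>\<phi> i x * h b i x\<bar> \<le> \<bar>h b i x\<bar>"
          using phi(2,3)[of i x] by (simp add: abs_mult mult_left_le_one_le)
        moreover have "\<bar>partial_deriv b (\<phi> i) x * v i x\<bar> \<le> \<bar>2 * c * v i x\<bar>"
          using phi(4)[OF b, of i x] pos by (simp add: abs_mult mult_right_mono)
        ultimately show "\<bar>\<phi> i x * h b i x + partial_deriv b (\<phi> i) x * v i x\<bar> \<le> \<bar>\<bar>2 * c * v i x\<bar> + \<bar>h b i x\<bar>\<bar>"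
          by linarith
      qed
      finally show "\<bar>G b x\<bar> \<le> (\<Sum>i | x \<in> U i. \<bar>\<bar>2 * c * v i x\<bar> + \<bar>h b i x\<bar>\<bar>)" .
    qed
    also have "\<dots> \<le> pow_int \<Omega> q (g b) + P * (\<Sum>i. Th * pow_int UNIV q (v i) + Th' * pow_int UNIV q (h b i))"
    proof (intro add_left_mono mult_left_mono suminf_le)
      fix i
      have m: "v i \<in> borel_measurable (lebesgue_on UNIV)" "h b i \<in> borel_measurable (lebesgue_on UNIV)"
        using vm hm[OF b] by (auto simp: lebesgue_on_UNIV_eq)
      have m2: "(\<lambda>x. 2 * c * v i x) \<in> borel_measurable (lebesgue_on UNIV)" using m(1) by measurable
      show "pow_int UNIV q (\<lambda>x. \<bar>2 * c * v i x\<bar> + \<bar>h b i x\<bar>) \<le> Th * pow_int UNIV q (v i) + Th' * pow_int UNIV q (h b i)"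
        using pow_int_add_convex[OF m2 m(2) q t] pow_int_cmult[OF m(1), of q "2 * c"] pos(2)
        by (simp add: Th_def Th'_def ennreal_mult mult.assoc)
    qed auto
    finally show ?thesis .
  qed
  have sumG: "(\<Sum>b\<in>Basis. pow_int UNIV q (G b)) \<le> ?X + P * (of_nat DIM('a) * (Th * (ennreal (A powr q) * (of_nat N * ?Y))) +
      Th' * (ennreal (A' powr q) * (Z * (of_nat N * ?X) + of_nat DIM('a) * (K * (of_nat N * ?Y)))))"
  proof -
    have "(\<Sum>b\<in>Basis. pow_int UNIV q (G b)) \<le>
      (\<Sum>b\<in>Basis. pow_int \<Omega> q (g b) + P * (\<Sum>i. Th * pow_int UNIV q (v i) + Th' * pow_int UNIV q (h b i)))"
      by (intro sum_mono Gb)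
    also have "\<dots> = ?X + P * (of_nat DIM('a) * (Th * (\<Sum>i. pow_int UNIV q (v i))) +
        Th' * (\<Sum>i. \<Sum>b\<in>Basis. pow_int UNIV q (h b i)))"
      by (simp add: sum.distrib X suminf_add[symmetric] suminf_sum sum_distrib_left[symmetric])
    also have "\<dots> \<le> ?X + P * (of_nat DIM('a) * (Th * (ennreal (A powr q) * (of_nat N * ?Y))) +
      Th' * (ennreal (A' powr q) * (Z * (of_nat N * ?X) + of_nat DIM('a) * (K * (of_nat N * ?Y)))))"
      by (intro add_left_mono mult_left_mono add_mono V H) auto
    finally show ?thesis .
  qed
  define B where "B = grad_norm \<Omega> q u powr q + real N powr (q - 1) *
      (DIM('a) * ((t powr (1 - q) * (2 * c) powr q) * (A powr q * (real N * Lp_norm \<Omega> q u powr q))) +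
       (1 - t) powr (1 - q) * (A' powr q * (z powr (1 - q) * (real N * grad_norm \<Omega> q u powr q) +
         DIM('a) * (((1 - z) powr (1 - q) * c powr q) * (real N * Lp_norm \<Omega> q u powr q)))))"
  have B: "(\<Sum>b\<in>Basis. pow_int UNIV q (G b)) \<le> ennreal B"
    using sumG unfolding P_def Th_def Th'_def Z_def K_def B_def
    by (simp add: ennreal_mult[symmetric] ennreal_plus[symmetric] ennreal_of_nat_eq_real_of_nat del: ennreal_plus)
  have fin: "pow_int UNIV q (G b) < \<infinity>" if "b \<in> Basis" for b
  proof -
    have "pow_int UNIV q (G b) \<le> (\<Sum>b\<in>Basis. pow_int UNIV q (G b))"
      using that by (intro member_le_sum) auto
    then show ?thesis using B by (simp add: order_le_less_trans)
  qed
  have "w \<in> borel_measurable (lebesgue_on UNIV)"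
    using locally_integrable_measurable[OF open_UNIV has_weak_deriv_locally_integrable(1)[OF wG[OF SOME_Basis]]] .
  moreover have "pow_int UNIV q w < \<infinity>"
  proof -
    have "pow_int UNIV q w \<le> pow_int \<Omega> q u + ennreal (real N powr (q - 1)) * (\<Sum>i. pow_int UNIV q (v i))"
    proof (rule pow_int_glue[OF q u_Lp(2) vm])
      show "AE x in lebesgue. x \<in> \<Omega> \<longrightarrow> w x = u x" using wu by auto
      fix x assume "x \<notin> \<Omega>"
      then have "\<bar>w x\<bar> \<le> (\<Sum>i | x \<in> U i. \<bar>\<phi> i x * v i x\<bar>)" by (simp add: w_def \<theta>_def sum_abs)
      also have "\<dots> \<le> (\<Sum>i | x \<in> U i. \<bar>v i x\<bar>)"
        using phi(2,3) by (intro sum_mono) (simp add: abs_mult mult_left_le_one_le)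
      finally show "\<bar>w x\<bar> \<le> (\<Sum>i | x \<in> U i. \<bar>v i x\<bar>)" .
    qed
    moreover have "(\<Sum>i. pow_int UNIV q (v i)) < \<infinity>"
      using V by (rule order_le_less_trans) (simp add: ennreal_mult_less_top of_nat_less_top)
    ultimately show ?thesis
      using Y by (auto simp: ennreal_mult_less_top intro: order_le_less_trans)
  qed
  ultimately have w: "w \<in> sobolev UNIV q"
    by (intro sobolevI[OF \<rho> q_pos open_UNIV _ wG fin]) (auto simp: Lp_space_iff)
  have "ennreal (grad_norm UNIV q w powr q) \<le> ennreal B"
    using B grad_norm_eq[OF \<rho> q_pos open_UNIV w wG] by simp
  then have "grad_norm UNIV q w powr q \<le> B"
    by (subst (asm) ennreal_le_iff) (auto simp: B_def)
  also have "B = grad_norm \<Omega> q u powr q + real N powr q *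
      (t powr (1 - q) * (2 * c * A) powr q * DIM('a) * Lp_norm \<Omega> q u powr q +
       (1 - t) powr (1 - q) * A' powr q * (z powr (1 - q) * grad_norm \<Omega> q u powr q +
         (1 - z) powr (1 - q) * c powr q * DIM('a) * Lp_norm \<Omega> q u powr q))"
  proof -
    have N: "real N powr q = real N powr (q - 1) * real N"
      using overlap(3) by (simp add: powr_diff)
    have "(2 * c * A) powr q = (2 * c) powr q * A powr q" using A(1) pos(2) by (simp add: powr_mult)
    then show ?thesis unfolding B_def N by (simp add: algebra_simps)
  qed
  finally show thesis using that[OF w wu] by blast
qed

end

end

lemma one_plus_powr_le:
  fixes x q :: real
  assumes "0 \<le> x" "1 \<le> q"
  shows "1 + x powr q \<le> (1 + x) powr q"
proof (cases "x = 0")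
  case False
  then have x: "0 < x" using assms by simp
  have "x powr q = x * x powr (q - 1)" using x by (simp add: powr_diff)
  also have "\<dots> \<le> x * (1 + x) powr (q - 1)" using x assms by (intro mult_left_mono powr_mono2) auto
  finally have "1 + x powr q \<le> (1 + x) powr (q - 1) + x * (1 + x) powr (q - 1)"
    using ge_one_powr_ge_zero[of "1 + x" "q - 1"] x assms by simp
  also have "\<dots> = (1 + x) * (1 + x) powr (q - 1)" by (simp add: algebra_simps)
  also have "\<dots> = (1 + x) powr q" using x by (simp add: powr_diff)
  finally show ?thesis .
qed (use assms in simp)

text \<open>The weights \<open>t\<close> and \<open>z\<close> make the three coefficients \<open>t\<close>, \<open>(1 - t) * z\<close> and
  \<open>(1 - t) * (1 - z)\<close> proportional to \<open>2 * A\<close>, \<open>2 * A + A'\<close> and \<open>A'\<close>.\<close>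

lemma convexity_weights:
  fixes A A' N c d s X Y Aq q :: real
  assumes q: "1 \<le> q" and pos: "0 < A" "0 < A'" "1 \<le> N" "0 \<le> c" "0 < d" "0 \<le> X" "0 \<le> Y" "0 < s"
    and Aq: "N * A' + 1 \<le> Aq" "c * (2 * N * A + N * A') * d powr (1 / q) \<le> s * Aq"
  obtains t z where "0 < t" "t < 1" "0 < z" "z < 1"
    "X + N powr q * (t powr (1 - q) * (2 * c * A) powr q * d * Y +
       (1 - t) powr (1 - q) * A' powr q * (z powr (1 - q) * X + (1 - z) powr (1 - q) * c powr q * d * Y))
     \<le> 2 powr (q - 1) * Aq powr q * (X + s powr q * Y)"
proof
  define S where "S = 2 * A + A'"
  let ?t = "A / S" and ?z = "S / (2 * (A + A'))"
  have AA: "A + A' \<noteq> 0" using pos by simp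
  have S: "0 < S" using pos by (simp add: S_def)
  show t: "0 < ?t" "?t < 1" and z: "0 < ?z" "?z < 1" using pos S by (auto simp: S_def field_simps)
  have inv: "x powr (1 - q) = (1 / x) powr (q - 1)" if "0 < x" for x :: real
    using powr_minus[of x "q - 1"] that by (simp add: powr_divide inverse_eq_divide)
  have pw: "x powr q = x * x powr (q - 1)" if "0 < x" for x :: real
    using that by (simp add: powr_diff)
  have t1: "1 - ?t = (A + A') / S" using S by (simp add: S_def field_simps)
  have z1: "1 - ?z = A' / (2 * (A + A'))" using pos by (simp add: S_def field_simps)
  have 1: "?t powr (1 - q) * (2 * A) powr q = 2 powr (q - 1) * S powr (q - 1) * (2 * A)"
    using pos S by (simp add: inv t pw powr_mult powr_divide)
  have 2: "(1 - ?t) powr (1 - q) * ?z powr (1 - q) = 2 powr (q - 1)"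
  proof -
    have "(1 - ?t) powr (1 - q) * ?z powr (1 - q) = ((1 - ?t) * ?z) powr (1 - q)"
      using t z by (subst powr_mult) auto
    also have "(1 - ?t) * ?z = 1 / 2" unfolding t1 using AA S by simp
    finally show ?thesis by (simp add: inv)
  qed
  have 3: "(1 - ?t) powr (1 - q) * A' powr q * (1 - ?z) powr (1 - q) = 2 powr (q - 1) * S powr (q - 1) * A'"
  proof -
    have "(1 - ?t) powr (1 - q) * (1 - ?z) powr (1 - q) = ((1 - ?t) * (1 - ?z)) powr (1 - q)"
      using t z by (subst powr_mult) auto
    also have "(1 - ?t) * (1 - ?z) = A' / (2 * S)"
    proof -
      have "x / S * (A' / (2 * x)) = A' / (2 * S)" if "x \<noteq> 0" for x using that by simp
      then show ?thesis unfolding t1 z1 using AA by blast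
    qed
    finally have "(1 - ?t) powr (1 - q) * (1 - ?z) powr (1 - q) = 2 powr (q - 1) * S powr (q - 1) / A' powr (q - 1)"
      using pos S by (simp add: inv powr_mult powr_divide)
    then show ?thesis using pos pw[of A'] by (simp add: field_simps)
  qed
  have "X + N powr q * (?t powr (1 - q) * (2 * c * A) powr q * d * Y +
       (1 - ?t) powr (1 - q) * A' powr q * (?z powr (1 - q) * X + (1 - ?z) powr (1 - q) * c powr q * d * Y))
     = X + N powr q * ((?t powr (1 - q) * (2 * A) powr q) * c powr q * d * Y +
       ((1 - ?t) powr (1 - q) * ?z powr (1 - q)) * A' powr q * X +
       ((1 - ?t) powr (1 - q) * A' powr q * (1 - ?z) powr (1 - q)) * c powr q * d * Y)"
    using pos powr_mult[of "2 * A" c q] by (simp add: algebra_simps)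
  also have "\<dots> = X * (1 + 2 powr (q - 1) * (N * A') powr q) + 2 powr (q - 1) * (N powr q * (S * S powr (q - 1)) * c powr q * d) * Y"
    unfolding 1 2 3 using pos by (simp add: S_def powr_mult algebra_simps)
  also have "N powr q * (S * S powr (q - 1)) * c powr q * d = (c * (2 * N * A + N * A') * d powr (1 / q)) powr q"
  proof -
    have "c * (2 * N * A + N * A') * d powr (1 / q) = N * S * c * d powr (1 / q)"
      by (simp add: S_def algebra_simps)
    also have "\<dots> powr q = N powr q * S powr q * c powr q * d"
      using pos S q by (simp add: powr_mult powr_powr)
    finally show ?thesis using pw[OF S] by simp
  qed
  also have "X * (1 + 2 powr (q - 1) * (N * A') powr q) +
      2 powr (q - 1) * (c * (2 * N * A + N * A') * d powr (1 / q)) powr q * Y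
    \<le> X * (2 powr (q - 1) * Aq powr q) + 2 powr (q - 1) * (s * Aq) powr q * Y"
  proof (intro add_mono mult_left_mono mult_right_mono powr_mono2 Aq pos)
    have "1 + 2 powr (q - 1) * (N * A') powr q \<le> 2 powr (q - 1) * (1 + (N * A') powr q)"
      using ge_one_powr_ge_zero[of 2 "q - 1"] q by (simp add: algebra_simps)
    also have "\<dots> \<le> 2 powr (q - 1) * (1 + N * A') powr q"
      using pos q by (intro mult_left_mono one_plus_powr_le) auto
    also have "\<dots> \<le> 2 powr (q - 1) * Aq powr q"
      using pos q Aq(1) by (intro mult_left_mono powr_mono2) auto
    finally show "1 + 2 powr (q - 1) * (N * A') powr q \<le> 2 powr (q - 1) * Aq powr q" .
  qed (use pos q in auto)
  also have "\<dots> = 2 powr (q - 1) * Aq powr q * (X + s powr q * Y)"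
  proof -
    have "0 \<le> N * A'" using pos by simp
    then have "0 \<le> Aq" using Aq(1) by linarith
    then show ?thesis using pos by (simp add: powr_mult algebra_simps)
  qed
  finally show "X + N powr q * (?t powr (1 - q) * (2 * c * A) powr q * d * Y +
       (1 - ?t) powr (1 - q) * A' powr q * (?z powr (1 - q) * X + (1 - ?z) powr (1 - q) * c powr q * d * Y))
     \<le> 2 powr (q - 1) * Aq powr q * (X + s powr q * Y)" .
qed

section \<open>Partitions subordinate to the patches\<close>

primrec running_max :: "(nat \<Rightarrow> 'a \<Rightarrow> real) \<Rightarrow> nat \<Rightarrow> 'a \<Rightarrow> real" where
  "running_max f 0 x = 0"
| "running_max f (Suc n) x = max (running_max f n x) (f n x)"

lemma running_max_nonneg: "0 \<le> running_max f n x"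
  by (induction n) auto

lemma running_max_le: "(\<And>i. f i x \<le> 1) \<Longrightarrow> running_max f n x \<le> 1"
  by (induction n) auto

lemma running_max_ge: "i < n \<Longrightarrow> f i x \<le> running_max f n x"
  by (induction n) (auto simp: less_Suc_eq)

lemma running_max_continuous:
  "(\<And>i. continuous_on S (f i)) \<Longrightarrow> continuous_on S (running_max f n)"
proof (induction n)
  case (Suc n)
  have "running_max f (Suc n) = (\<lambda>x. max (running_max f n x) (f n x))" by auto
  then show ?case using Suc by (simp add: continuous_on_max)
qed (simp add: running_max.simps(1)[abs_def])

lemma running_max_lipschitz:
  fixes f :: "nat \<Rightarrow> 'a::metric_space \<Rightarrow> real"
  assumes "\<And>i x y. \<bar>f i x - f i y\<bar> \<le> c * dist x y" "0 \<le> c"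
  shows "\<bar>running_max f n x - running_max f n y\<bar> \<le> c * dist x y"
proof (induction n)
  case (Suc n)
  have "\<bar>max a b - max a' b'\<bar> \<le> max \<bar>a - a'\<bar> \<bar>b - b'\<bar>" for a b a' b' :: real by linarith
  from this[of "running_max f n x" "f n x" "running_max f n y" "f n y"]
  show ?case using Suc assms(1)[of n x y] unfolding running_max.simps by linarith
qed (use assms(2) in simp)

lemma shrink_ball:
  assumes "y \<in> shrink S r" "dist x y \<le> d"
  shows "x \<in> shrink S (r - d)"
proof -
  have "ball x (r - d) \<subseteq> ball y r"
  proof
    fix z assume "z \<in> ball x (r - d)"
    then show "z \<in> ball y r" using assms(2) dist_triangle[of y z x] by (simp add: dist_commute)
  qed
  then show ?thesis using assms(1) by (auto simp: shrink_def)
qed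

lemma shrink_mem: "x \<in> shrink S r \<Longrightarrow> dist x y < r \<Longrightarrow> y \<in> S"
  by (auto simp: shrink_def)

text \<open>With \<open>\<mu> i\<close> a Lipschitz bump that is 1 on \<open>shrink (U i) (\<epsilon> / 2)\<close>, the functions \<open>\<phi> i\<close> are
  the mollified increments of the running maximum of the \<open>\<mu> i\<close>: their sum is 1 wherever some
  \<open>\<mu> i\<close> is, and their Lipschitz constants do not depend on the overlap number.\<close>

lemma exists_smooth_patches:
  fixes \<Omega> :: "'a::euclidean_space set" and \<rho> :: "'a \<Rightarrow> real"
  assumes \<rho>: "mollifier \<rho>"
    and dom: "open \<Omega>" "\<And>i. open (U i)" "\<And>i. open (D i)" "\<And>i. U i \<inter> \<Omega> = U i \<inter> D i"
    and overlap: "\<And>x. finite {i. x \<in> U i}" "\<And>x. card {i. x \<in> U i} \<le> N" "1 \<le> N"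
    and w: "0 < w" "w < \<epsilon> / 4"
    and ne: "\<And>i. shrink (U i) (\<epsilon> / 2) \<noteq> {}"
    and cover: "\<And>x. frontier \<Omega> \<noteq> {} \<Longrightarrow> infdist x (frontier \<Omega>) \<le> \<epsilon> / 2 \<Longrightarrow> \<exists>i. x \<in> shrink (U i) (\<epsilon> / 2)"
  obtains \<phi> lam \<kappa> where "smooth_patches \<Omega> U D \<phi> lam \<kappa> (1 / w) N"
proof -
  define \<kappa> where "\<kappa> = (\<epsilon> / 2 - 2 * w) / 4"
  have \<kappa>: "0 < \<kappa>" "\<epsilon> / 2 = 2 * w + 4 * \<kappa>" using w by (auto simp: \<kappa>_def field_simps)
  define K where "K i = shrink (U i) (\<epsilon> / 2)" for i
  define K' where "K' i = shrink (U i) (w + 2 * \<kappa>)" for i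
  define \<mu> where "\<mu> i x = max 0 (1 - infdist x (K i) / w)" for i x
  define m where "m = running_max \<mu>"
  define \<phi> where "\<phi> i x = mollify \<rho> \<kappa> (m (Suc i)) x - mollify \<rho> \<kappa> (m i) x" for i x
  have K_ne: "K i \<noteq> {}" "K i \<subseteq> K' i" for i
  proof -
    show "K i \<noteq> {}" using ne[of i] by (simp add: K_def)
    have "x \<in> shrink (U i) (\<epsilon> / 2 - (w + 2 * \<kappa>))" if "x \<in> K i" for x
      using that \<kappa>(1) w(1) by (intro shrink_ball[of x]) (simp_all add: K_def)
    then show "K i \<subseteq> K' i" using \<kappa>(2) by (auto simp: K'_def)
  qed
  have \<mu>_cont: "continuous_on UNIV (\<mu> i)" for i
    unfolding \<mu>_def using w(1) by (intro continuous_intros) auto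
  have \<mu>_le: "\<mu> i x \<le> 1" for i x using w(1) by (simp add: \<mu>_def infdist_nonneg)
  have \<mu>_lip: "\<bar>\<mu> i x - \<mu> i y\<bar> \<le> 1 / w * dist x y" for i x y
  proof -
    have "\<bar>\<mu> i x - \<mu> i y\<bar> \<le> \<bar>infdist x (K i) / w - infdist y (K i) / w\<bar>"
      by (auto simp: \<mu>_def max_def abs_if)
    also have "\<dots> \<le> 1 / w * dist x y"
      using infdist_triangle_abs[of x "K i" y] w(1)
      by (simp add: diff_divide_distrib[symmetric] divide_right_mono)
    finally show ?thesis .
  qed
  have \<mu>_supp: "x \<in> shrink (U i) (w + 4 * \<kappa>)" if "\<mu> i x \<noteq> 0" for i x
  proof -
    have "infdist x (K i) < w" using that w(1) by (auto simp: \<mu>_def max_def divide_simps split: if_splits)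
    then obtain y where "y \<in> K i" "dist x y < w" using infdist_less_iff[OF K_ne(1)] by blast
    then have "x \<in> shrink (U i) (\<epsilon> / 2 - w)" unfolding K_def by (intro shrink_ball) auto
    then show ?thesis using \<kappa>(2) by (simp add: algebra_simps)
  qed
  have m_cont: "continuous_on UNIV (m n)" for n
    unfolding m_def by (intro running_max_continuous \<mu>_cont)
  have m_lip: "\<bar>m n x - m n y\<bar> \<le> 1 / w * dist x y" for n x y
    unfolding m_def using w(1) by (intro running_max_lipschitz \<mu>_lip) auto
  note smooth = smooth_on_mollify[OF \<rho> \<kappa>(1) m_cont]
  have bounds: "0 \<le> mollify \<rho> \<kappa> (m n) x" "mollify \<rho> \<kappa> (m n) x \<le> 1" for n x
    using mollify_mono[OF \<rho> \<kappa>(1) continuous_on_const[of _ 0] m_cont, of n x]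
      mollify_mono[OF \<rho> \<kappa>(1) m_cont continuous_on_const[of _ 1], of n x]
    by (auto simp: mollify_const[OF \<rho> \<kappa>(1)] m_def running_max_nonneg intro!: running_max_le \<mu>_le)
  have \<phi>_supp: "y \<in> shrink (U i) (w + 3 * \<kappa>)" if "\<phi> i y \<noteq> 0" for i y
  proof -
    have "\<exists>z. dist y z < \<kappa> \<and> m (Suc i) z \<noteq> m i z"
      using mollify_cong[OF \<rho> \<kappa>(1), of y "m (Suc i)" "m i"] that by (auto simp: \<phi>_def)
    then obtain z where z: "dist y z < \<kappa>" "m (Suc i) z \<noteq> m i z" by blast
    have "\<mu> i z \<noteq> 0" using z(2) running_max_nonneg[of \<mu> i z] by (auto simp: m_def max_def split: if_splits)
    then have "y \<in> shrink (U i) (w + 4 * \<kappa> - \<kappa>)" using \<mu>_supp z(1) by (intro shrink_ball[of z]) auto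
    then show ?thesis by (simp add: algebra_simps)
  qed
  define cutoff where "cutoff i \<eta> \<longleftrightarrow> smooth_on UNIV \<eta> \<and> (\<forall>x. 0 \<le> \<eta> x \<and> \<eta> x \<le> 1) \<and>
      (\<forall>b\<in>Basis. \<forall>x. \<bar>partial_deriv b \<eta> x\<bar> \<le> 1 / w) \<and>
      (\<forall>x. ball x \<kappa> \<subseteq> K' i \<longrightarrow> \<eta> x = 1) \<and> (\<forall>x. \<eta> x \<noteq> 0 \<longrightarrow> infdist x (K' i) < w + \<kappa>)" for i \<eta>
  have "\<exists>\<eta>. cutoff i \<eta>" for i
  proof -
    have "K' i \<noteq> {}" using K_ne[of i] by blast
    show ?thesis
      by (rule cutoff_function[OF \<rho> \<open>K' i \<noteq> {}\<close> w(1) \<kappa>(1)]) (auto simp: cutoff_def)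
  qed
  then have "\<exists>lam. \<forall>i. cutoff i (lam i)" by (intro choice allI)
  then obtain lam where "\<And>i. cutoff i (lam i)" by blast
  then have lam: "\<And>i. smooth_on UNIV (lam i)" "\<And>i x. 0 \<le> lam i x" "\<And>i x. lam i x \<le> 1"
    "\<And>i b x. b \<in> Basis \<Longrightarrow> \<bar>partial_deriv b (lam i) x\<bar> \<le> 1 / w"
    "\<And>i x. ball x \<kappa> \<subseteq> K' i \<Longrightarrow> lam i x = 1" "\<And>i x. lam i x \<noteq> 0 \<Longrightarrow> infdist x (K' i) < w + \<kappa>"
    unfolding cutoff_def by blast+
  have lam_supp: "x \<in> shrink (U i) \<kappa>" if lam_nz: "lam i x \<noteq> 0" for i x
  proof -
    obtain y where "y \<in> K' i" "dist x y < w + \<kappa>"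
      using lam(6)[OF lam_nz] infdist_less_iff[of "K' i" x "w + \<kappa>"] K_ne[of i] by blast
    then have "x \<in> shrink (U i) (w + 2 * \<kappa> - (w + \<kappa>))" unfolding K'_def by (intro shrink_ball) auto
    then show ?thesis by simp
  qed
  have sum_\<phi>: "(\<Sum>i<n. \<phi> i x) = mollify \<rho> \<kappa> (m n) x" for n x
  proof (induction n)
    case 0
    have "m 0 = (\<lambda>_. 0)" by (auto simp: m_def)
    then show ?case by (simp add: mollify_const[OF \<rho> \<kappa>(1)])
  qed (simp add: \<phi>_def)
  show thesis
  proof (rule that, unfold_locales)
    show "0 < \<kappa>" "0 \<le> 1 / w" using \<kappa> w by auto
    show "smooth_on UNIV (\<phi> i)" for i
      unfolding \<phi>_def[abs_def] by (intro smooth_on_diff smooth)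
    show "0 \<le> \<phi> i x" for i x
      using mollify_mono[OF \<rho> \<kappa>(1) m_cont m_cont, of i "Suc i" x] by (simp add: \<phi>_def m_def)
    show "\<phi> i x \<le> 1" for i x using bounds(1)[of i x] bounds(2)[of "Suc i" x] by (simp add: \<phi>_def)
    show "\<bar>partial_deriv b (\<phi> i) x\<bar> \<le> 2 * (1 / w)" if b: "b \<in> Basis" for i b x
    proof -
      have "partial_deriv b (\<lambda>x. mollify \<rho> \<kappa> (m i) x + \<phi> i x) x =
          partial_deriv b (mollify \<rho> \<kappa> (m i)) x + partial_deriv b (\<phi> i) x"
        unfolding \<phi>_def[abs_def] by (intro partial_deriv_add smooth_on_differentiable smooth_on_diff smooth)
      then have "partial_deriv b (\<phi> i) x =
          partial_deriv b (mollify \<rho> \<kappa> (m (Suc i))) x - partial_deriv b (mollify \<rho> \<kappa> (m i)) x"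
        by (simp add: \<phi>_def)
      then show ?thesis
        using mollify_partial_deriv_bound[OF \<rho> \<kappa>(1) m_cont m_lip b, of i x]
          mollify_partial_deriv_bound[OF \<rho> \<kappa>(1) m_cont m_lip b, of "Suc i" x] by linarith
    qed
    show "x \<in> U i" if "\<phi> i y \<noteq> 0" "dist x y < \<kappa>" for i x y
      using shrink_mem[OF \<phi>_supp[OF that(1)], of x] that(2) \<kappa>(1) w(1) by (simp add: dist_commute)
    show "closure {x. lam i x \<noteq> 0} \<subseteq> U i" for i
    proof
      fix x assume "x \<in> closure {x. lam i x \<noteq> 0}"
      then obtain z where "lam i z \<noteq> 0" "dist z x < \<kappa>" using \<kappa>(1) by (auto simp: closure_approachable)
      then show "x \<in> U i" using shrink_mem lam_supp by blast
    qed
    show "lam i x = 1" if "\<phi> i x \<noteq> 0" for i x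
    proof (rule lam(5), rule subsetI)
      fix y assume "y \<in> ball x \<kappa>"
      then have "y \<in> shrink (U i) (w + 3 * \<kappa> - \<kappa>)"
        using \<phi>_supp[OF that] by (intro shrink_ball[of x]) (auto simp: dist_commute)
      then show "y \<in> K' i" by (simp add: K'_def algebra_simps)
    qed
    show "\<exists>V. open V \<and> x \<in> V \<and> (\<forall>y\<in>V. (\<Sum>i | y \<in> U i. \<phi> i y) = 1)" if x: "x \<in> frontier \<Omega>" for x
    proof (intro exI[of _ "ball x (\<epsilon> / 2 - \<kappa>)"] conjI ballI)
      show "x \<in> ball x (\<epsilon> / 2 - \<kappa>)" using \<kappa> w by simp
      fix y assume y: "y \<in> ball x (\<epsilon> / 2 - \<kappa>)"
      obtain n where n: "{i. y \<in> U i} \<subseteq> {..<n}"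
        using overlap(1)[of y] finite_nat_iff_bounded by blast
      have "(\<Sum>i | y \<in> U i. \<phi> i y) = (\<Sum>i<n. \<phi> i y)"
      proof (rule sum.mono_neutral_left[OF _ n])
        show "\<forall>i\<in>{..<n} - {i. y \<in> U i}. \<phi> i y = 0"
          using shrink_mem[OF \<phi>_supp, of _ y y] \<kappa>(1) w(1) by fastforce
      qed simp
      also have "\<dots> = mollify \<rho> \<kappa> (m n) y" by (rule sum_\<phi>)
      also have "\<dots> = mollify \<rho> \<kappa> (\<lambda>_. 1) y"
      proof (rule mollify_cong[OF \<rho> \<kappa>(1)])
        fix z assume z: "dist y z < \<kappa>"
        have "dist z x \<le> \<epsilon> / 2" using y z dist_triangle[of z x y] by (simp add: dist_commute)
        then have "infdist z (frontier \<Omega>) \<le> \<epsilon> / 2" using infdist_le2[OF x] by blast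
        then obtain i where i: "z \<in> K i" using cover x unfolding K_def by blast
        then have "\<mu> i z = 1" by (simp add: \<mu>_def)
        have "y \<in> U i" using shrink_mem[of z "U i" "\<epsilon> / 2" y] i z \<kappa> w by (simp add: K_def dist_commute)
        then have "i < n" using n by auto
        then show "m n z = 1"
          using running_max_ge[of i n \<mu> z] running_max_le[of \<mu> z n] \<mu>_le \<open>\<mu> i z = 1\<close>
          by (simp add: m_def order_antisym)
      qed
      also have "\<dots> = 1" by (rule mollify_const[OF \<rho> \<kappa>(1)])
      finally show "(\<Sum>i | y \<in> U i. \<phi> i y) = 1" .
    qed simp
  qed (use dom overlap lam in auto)
qed

section \<open>The embedding constant\<close>

lemma exists_bump_function:
  fixes V :: "'a::euclidean_space set" and \<rho> :: "'a \<Rightarrow> real"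
  assumes \<rho>: "mollifier \<rho>" and V: "open V" "V \<noteq> {}"
  obtains \<eta> where "smooth_on UNIV \<eta>" "bounded {x. \<eta> x \<noteq> 0}" "\<not> (AE x in lebesgue. x \<in> V \<longrightarrow> \<eta> x = 0)"
proof -
  obtain z where z: "z \<in> V" using V by blast
  obtain \<eta> where \<eta>: "smooth_on UNIV \<eta>" "\<And>x. x \<in> {z} \<Longrightarrow> \<eta> x = 1"
    "\<And>x. \<eta> x \<noteq> 0 \<Longrightarrow> infdist x {z} < 1"
    by (rule compact_cutoff_function[OF \<rho>, of "{z}" 1]) simp_all
  have "bounded {x. \<eta> x \<noteq> 0}"
    using \<eta>(3) by (intro bounded_subset[OF bounded_ball[of z 1]]) (auto simp: dist_commute)
  moreover have "\<not> (AE x in lebesgue. x \<in> V \<longrightarrow> \<eta> x = 0)"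
  proof
    let ?S = "{x. 1/2 < \<eta> x} \<inter> V"
    have S: "open ?S"
      using smooth_on_continuous[OF \<eta>(1)] V(1) by (intro open_Int open_Collect_less continuous_on_const) auto
    assume "AE x in lebesgue. x \<in> V \<longrightarrow> \<eta> x = 0"
    then have "AE x in lebesgue. x \<notin> ?S" by eventually_elim auto
    then have "?S \<in> null_sets lebesgue" using S by (simp add: AE_iff_null_sets)
    then have "negligible ?S" by (simp add: negligible_iff_null_sets)
    then have "?S = {}" using open_not_negligible[OF S] by blast
    moreover have "z \<in> ?S" using z \<eta>(2)[of z] by simp
    ultimately show False by blast
  qed
  ultimately show thesis using that \<eta>(1) by blast
qed

lemma special_lipschitz_domain_open_nonempty:
  fixes D :: "((real ^ 'm) \<times> real) set"
  assumes "special_lipschitz_domain D M"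
  shows "open D" "D \<noteq> {}"
proof -
  obtain \<phi> where D: "D = {(x', xn). \<phi> x' < xn}" and \<phi>: "\<And>x y. \<bar>\<phi> x - \<phi> y\<bar> \<le> M * norm (x - y)"
    using assms by (auto simp: special_lipschitz_domain_def)
  have "(0, \<phi> 0 + 1) \<in> D" by (simp add: D)
  then show "D \<noteq> {}" by blast
  have "M-lipschitz_on UNIV \<phi>"
    using \<phi> assms by (intro lipschitz_onI) (simp_all add: dist_norm special_lipschitz_domain_def)
  then have "continuous_on UNIV \<phi>" by (rule lipschitz_on_continuous_on)
  then have "continuous_on UNIV (\<lambda>x :: (real ^ 'm) \<times> real. \<phi> (fst x))"
    by (rule continuous_on_compose2) (simp_all add: continuous_on_fst continuous_on_id)
  then have "open {x. \<phi> (fst x) < snd x}"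
    by (intro open_Collect_less continuous_on_snd continuous_on_id)
  moreover have "D = {x. \<phi> (fst x) < snd x}" by (simp add: D case_prod_unfold)
  ultimately show "open D" by simp
qed

theorem corollary4p1:
  fixes \<Omega> :: "((real ^ 'm) \<times> real) set"
    and U D :: "nat \<Rightarrow> ((real ^ 'm) \<times> real) set"
    and M a a' :: "nat \<Rightarrow> real"
    and N n :: nat
    and \<rho> :: "(real ^ 'm) \<times> real \<Rightarrow> real"
    and RD :: "((real ^ 'm) \<times> real) set \<Rightarrow> real \<Rightarrow> (real ^ 'm) \<times> real \<Rightarrow> real"
    and P :: "((real ^ 'm) \<times> real) multiset \<Rightarrow> real"
    and \<psi> :: "real \<Rightarrow> real"
    and p q T \<sigma> \<tau> \<xi> \<epsilon> A0 A1 A A' b R Aq :: real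
  assumes n: "n = DIM((real ^ 'm) \<times> real)"
    and p: "real n / (real n - 1) < p"
    and q: "q = real n * p / (real n + p)"
    and T: "\<And>u. u \<in> sobolev (UNIV :: ((real ^ 'm) \<times> real) set) q \<Longrightarrow>
              u \<in> Lp_space UNIV p \<and> Lp_norm UNIV p u \<le> T * grad_norm UNIV q u"
    and \<Omega>: "minimally_smooth \<Omega> N U D M"
    and \<sigma>: "0 < \<sigma>"
    and \<tau>: "0 < \<tau>"
    and \<xi>: "0 < \<xi>" "\<xi> < 1"
    and \<epsilon>: "admissible \<Omega> U \<epsilon>"
    and \<rho>: "mollifier \<rho>"
    and RD: "regularized_distance P RD"
    and \<psi>: "extension_kernel \<psi> A0 A1"
    and ext: "\<And>i v. v \<in> sobolev (D i) q \<Longrightarrow>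
              lip_ext RD \<psi> (D i) (M i) \<tau> \<xi> v \<in> sobolev UNIV q \<and>
              Lp_norm UNIV q (lip_ext RD \<psi> (D i) (M i) \<tau> \<xi> v) \<le> a i * Lp_norm (D i) q v \<and>
              grad_norm UNIV q (lip_ext RD \<psi> (D i) (M i) \<tau> \<xi> v) \<le> a' i * grad_norm (D i) q v"
    and A: "bdd_above (range a)" "A = (SUP i. a i)"
    and A': "bdd_above (range a')" "A' = (SUP i. a' i)"
    and b: "0 < b"
           "\<And>j. j \<in> Basis \<Longrightarrow>
              (\<integral>x. \<bar>partial_deriv j (mollify_scale \<rho> (1/4 * \<epsilon>)) x\<bar> \<partial>lebesgue) \<le> b"
    and R: "R = b * (6 * real N * A + real N * A' + 3) * real n powr (1 / q) / (real N * A' + 1)"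
    and Aq: "Aq = (if R \<le> \<sigma> powr (1 / q) then real N * A' + 1
                   else b * (6 * real N * A + real N * A' + 3) * real n powr (1 / q) / \<sigma> powr (1 / q))"
  shows "\<forall>u \<in> sobolev \<Omega> q.
           u \<in> Lp_space \<Omega> p \<and>
           Lp_norm \<Omega> p u \<le> (2 powr ((q - 1) / q) * T * Aq) * sobolev_norm \<Omega> q \<sigma> u"
proof
  fix u assume u: "u \<in> sobolev \<Omega> q"
  define E where "E i = lip_ext RD \<psi> (D i) (M i) \<tau> \<xi>" for i
  have E: "E i v x = v x" if "x \<in> D i" for i v x
  proof -
    have "x \<in> closure (D i)" using that closure_subset by blast
    then show ?thesis by (cases x) (simp add: E_def lip_ext_def Let_def)
  qed
  have n2: "2 \<le> n" unfolding n by (simp add: Suc_le_eq)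
  then have n1: "1 < real n" "0 < real n" by auto
  have p1: "1 < p"
  proof -
    have "1 < real n / (real n - 1)" using n1 by (simp add: field_simps)
    then show ?thesis using p by linarith
  qed
  have q1: "1 < q"
  proof -
    have "real n < p * (real n - 1)" using p n1 by (simp add: field_simps)
    then have "real n + p < real n * p" by (simp add: algebra_simps)
    then show ?thesis using p1 n1 unfolding q by simp
  qed
  then have q0: "0 < q" "1 \<le> q" by auto

  have dom: "open \<Omega>" "\<And>i. open (U i)" "1 \<le> N" "\<And>x. finite {i. x \<in> U i}" "\<And>x. card {i. x \<in> U i} \<le> N"
    "\<And>i. special_lipschitz_domain (D i) (M i)" "\<And>i. U i \<inter> \<Omega> = U i \<inter> D i"
    using \<Omega> unfolding minimally_smooth_def by blast+
  note D = special_lipschitz_domain_open_nonempty[OF dom(6)]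
  have \<epsilon>0: "0 < \<epsilon>" using \<epsilon> by (simp add: admissible_def)

  have aA: "a i \<le> A" "a' i \<le> A'" for i
    unfolding A(2) A'(2) by (intro cSUP_upper A(1) A'(1) UNIV_I)+
  obtain \<eta> where \<eta>: "smooth_on UNIV \<eta>" "bounded {x. \<eta> x \<noteq> 0}" "\<not> (AE x in lebesgue. x \<in> D 0 \<longrightarrow> \<eta> x = 0)"
    using exists_bump_function[OF \<rho> D] by blast
  have \<eta>_sob: "\<eta> \<in> sobolev UNIV q" by (rule smooth_bounded_support_sobolev[OF q0(1) \<eta>(1,2)])
  have norm_pos: "0 < Lp_norm UNIV r v"
    if "v \<in> Lp_space UNIV r" "0 < r" "\<And>x. x \<in> D 0 \<Longrightarrow> v x = \<eta> x" for v r
  proof (rule ccontr)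
    assume "\<not> 0 < Lp_norm UNIV r v"
    then have "Lp_norm UNIV r v = 0" using Lp_norm_nonneg[of UNIV r v] by linarith
    then have "AE x in lebesgue. x \<in> UNIV \<longrightarrow> v x = 0" using that by (intro Lp_norm_eq_0_AE) auto
    then have "AE x in lebesgue. x \<in> D 0 \<longrightarrow> \<eta> x = 0"
      by eventually_elim (use that(3) in auto)
    then show False using \<eta>(3) by blast
  qed
  have \<eta>D: "\<eta> \<in> sobolev (D 0) q" by (rule sobolev_restrict[OF q0(1) open_UNIV D(1) _ \<eta>_sob]) simp
  define v where "v = E 0 \<eta>"
  have v: "v \<in> sobolev UNIV q" "Lp_norm UNIV q v \<le> a 0 * Lp_norm (D 0) q \<eta>"
    "grad_norm UNIV q v \<le> a' 0 * grad_norm (D 0) q \<eta>"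
    using ext[OF \<eta>D] by (auto simp: v_def E_def)
  have factor_pos: "0 < x" if "0 < r" "r \<le> x * y" "0 \<le> y" for r x y :: real
  proof -
    have "0 < x * y" using that by linarith
    then show ?thesis using that(3) by (auto simp: zero_less_mult_iff)
  qed
  have "0 < Lp_norm UNIV p \<eta>" using T[OF \<eta>_sob] p1 by (intro norm_pos) auto
  then have T0: "0 < T"
    using factor_pos T[OF \<eta>_sob] grad_norm_nonneg by blast
  have "0 < Lp_norm UNIV q v" using v(1) q0 E by (intro norm_pos) (auto simp: sobolev_def v_def)
  then have "0 < a 0" using factor_pos v(2) Lp_norm_nonneg by blast
  then have A0: "0 < A" using aA(1)[of 0] by linarith
  have "0 < Lp_norm UNIV p v" using T[OF v(1)] p1 E by (intro norm_pos) (auto simp: v_def)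
  then have "0 < T * grad_norm UNIV q v" using T[OF v(1)] by linarith
  then have "0 < grad_norm UNIV q v" using T0 by (simp add: zero_less_mult_iff)
  then have "0 < a' 0" using factor_pos v(3) grad_norm_nonneg by blast
  then have A'0: "0 < A'" using aA(2)[of 0] by linarith

  define k where "k = 1 / (1 + real N * A')"
  define w where "w = \<epsilon> / (4 * (1 + k))"
  have NA': "0 < real N * A'" "0 < real N * A" using dom(3) A0 A'0 by auto
  then have k: "0 < k" "k \<le> 1" "k * (real N * A') \<le> 1" by (auto simp: k_def field_simps)
  have w: "0 < w" "w < \<epsilon> / 4" using k \<epsilon>0 by (auto simp: w_def field_simps)
  have cb: "1 / w \<le> (1 + k) * b"
  proof -
    obtain j :: "(real ^ 'm) \<times> real" where j: "j \<in> Basis" using nonempty_Basis by blast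
    have "1 \<le> 1/4 * \<epsilon> * (\<integral>x. \<bar>partial_deriv j (mollify_scale \<rho> (1/4 * \<epsilon>)) x\<bar> \<partial>lebesgue)"
      using \<epsilon>0 by (intro integral_abs_partial_deriv_mollify_scale_ge[OF \<rho> _ j]) simp
    also have "\<dots> \<le> 1/4 * \<epsilon> * b" using b(2)[OF j] \<epsilon>0 by (intro mult_left_mono) auto
    finally have "4 \<le> \<epsilon> * b" by simp
    then have "4 * (1 + k) \<le> \<epsilon> * b * (1 + k)" using k by (intro mult_right_mono) auto
    then show ?thesis using \<epsilon>0 k by (simp add: w_def field_simps)
  qed
  define \<beta> where "\<beta> = b * (6 * real N * A + real N * A' + 3) * real n powr (1 / q)"
  define s where "s = \<sigma> powr (1 / q)"
  have s: "0 < s" "s powr q = \<sigma>" using \<sigma> q0 by (auto simp: s_def powr_powr)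
  have Aq1: "real N * A' + 1 \<le> Aq" and Aq2: "\<beta> \<le> s * Aq"
  proof -
    have R': "R = \<beta> / (real N * A' + 1)" by (simp add: R \<beta>_def)
    have Aq': "Aq = (if R \<le> s then real N * A' + 1 else \<beta> / s)" by (simp add: Aq \<beta>_def s_def)
    show "real N * A' + 1 \<le> Aq" "\<beta> \<le> s * Aq"
      using NA' s(1) unfolding Aq' R' by (auto simp: field_simps)
  qed
  have c_le: "1 / w * (2 * real N * A + real N * A') * real n powr (1 / q) \<le> s * Aq"
  proof -
    have "1 / w * (2 * real N * A + real N * A') \<le> (1 + k) * b * (2 * real N * A + real N * A')"
      using NA' by (intro mult_right_mono cb) auto
    also have "\<dots> = b * ((1 + k) * (2 * real N * A) + real N * A' + k * (real N * A'))"
      by (simp add: algebra_simps)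
    also have "\<dots> \<le> b * (2 * (2 * real N * A) + real N * A' + 1)"
      using k NA' b(1) A0 A'0 by (intro mult_left_mono add_mono mult_right_mono) auto
    also have "\<dots> \<le> b * (6 * real N * A + real N * A' + 3)"
      using b(1) A0 by (intro mult_left_mono) auto
    finally have "1 / w * (2 * real N * A + real N * A') * real n powr (1 / q) \<le> \<beta>"
      unfolding \<beta>_def by (intro mult_right_mono) auto
    then show ?thesis using Aq2 by linarith
  qed

  obtain \<phi> lam \<kappa> where patches: "smooth_patches \<Omega> U D \<phi> lam \<kappa> (1 / w) N"
  proof (rule exists_smooth_patches[OF \<rho> dom(1,2) D(1) dom(7,4,5,3) w])
    show "shrink (U i) (\<epsilon> / 2) \<noteq> {}" for i
    proof -
      obtain x where "x \<in> shrink (U i) (3/4 * \<epsilon>)" using \<epsilon> unfolding admissible_def by blast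
      then have "x \<in> shrink (U i) (3/4 * \<epsilon> - \<epsilon> / 4)" using \<epsilon>0 by (intro shrink_ball) auto
      then show ?thesis by auto
    qed
    show "\<exists>i. x \<in> shrink (U i) (\<epsilon> / 2)"
      if "frontier \<Omega> \<noteq> {}" "infdist x (frontier \<Omega>) \<le> \<epsilon> / 2" for x
    proof -
      have "\<exists>i. x \<in> shrink (U i) (1/2 * \<epsilon>)" using \<epsilon> that unfolding admissible_def by blast
      then show ?thesis by simp
    qed
  qed
  interpret smooth_patches \<Omega> U D \<phi> lam \<kappa> "1 / w" N by (rule patches)
  let ?X = "grad_norm \<Omega> q u powr q" and ?Y = "Lp_norm \<Omega> q u powr q"
  obtain t z where tz: "0 < t" "t < 1" "0 < z" "z < 1"
    and le: "?X + real N powr q * (t powr (1 - q) * (2 * (1 / w) * A) powr q * real n * ?Y +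
       (1 - t) powr (1 - q) * A' powr q * (z powr (1 - q) * ?X + (1 - z) powr (1 - q) * (1 / w) powr q * real n * ?Y))
     \<le> 2 powr (q - 1) * Aq powr q * (?X + s powr q * ?Y)"
    by (rule convexity_weights[where X = ?X and Y = ?Y and s = s, OF q0(2) A0 A'0 _ _ n1(2) _ _ s(1) Aq1 c_le])
       (use dom(3) w(1) in auto)
  define v where "v i = E i (\<lambda>x. lam i x * u x)" for i
  note sob = lam_u_sobolev[OF \<rho> q0(2) u]
  have v: "v i \<in> sobolev UNIV q" "Lp_norm UNIV q (v i) \<le> A * Lp_norm (D i) q (\<lambda>x. lam i x * u x)"
    "grad_norm UNIV q (v i) \<le> A' * grad_norm (D i) q (\<lambda>x. lam i x * u x)" for i
  proof -
    have *: "v i \<in> sobolev UNIV q" "Lp_norm UNIV q (v i) \<le> a i * Lp_norm (D i) q (\<lambda>x. lam i x * u x)"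
      "grad_norm UNIV q (v i) \<le> a' i * grad_norm (D i) q (\<lambda>x. lam i x * u x)"
      using ext[OF sob[of i]] by (auto simp: v_def E_def)
    show "v i \<in> sobolev UNIV q" by (rule *(1))
    show "Lp_norm UNIV q (v i) \<le> A * Lp_norm (D i) q (\<lambda>x. lam i x * u x)"
      by (rule order_trans[OF *(2) mult_right_mono[OF aA(1) Lp_norm_nonneg]])
    show "grad_norm UNIV q (v i) \<le> A' * grad_norm (D i) q (\<lambda>x. lam i x * u x)"
      by (rule order_trans[OF *(3) mult_right_mono[OF aA(2) grad_norm_nonneg]])
  qed
  obtain w' where w': "w' \<in> sobolev UNIV q" "\<And>x. x \<in> \<Omega> \<Longrightarrow> w' x = u x"
    and grad: "grad_norm UNIV q w' powr q \<le> 2 powr (q - 1) * Aq powr q * (?X + s powr q * ?Y)"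
  proof (rule extension_bound[OF \<rho> q0(2) u v(1) _ less_imp_le[OF A0] v(2) less_imp_le[OF A'0] v(3) tz(3,4,1,2)])
    show "v i x = lam i x * u x" if "x \<in> D i" for i x using E[OF that] by (simp add: v_def)
    fix w' assume w': "w' \<in> sobolev UNIV q" "\<And>x. x \<in> \<Omega> \<Longrightarrow> w' x = u x"
      "grad_norm UNIV q w' powr q \<le> ?X + real N powr q *
      (t powr (1 - q) * (2 * (1 / w) * A) powr q * DIM((real ^ 'm) \<times> real) * ?Y +
       (1 - t) powr (1 - q) * A' powr q * (z powr (1 - q) * ?X +
         (1 - z) powr (1 - q) * (1 / w) powr q * DIM((real ^ 'm) \<times> real) * ?Y))"
    show thesis by (rule that[OF w'(1,2) order_trans[OF w'(3) le[unfolded n]]])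
  qed
  have "grad_norm UNIV q w' = (grad_norm UNIV q w' powr q) powr (1 / q)"
    using q0 by (simp add: powr_powr grad_norm_nonneg)
  also have "\<dots> \<le> (2 powr (q - 1) * Aq powr q * (?X + s powr q * ?Y)) powr (1 / q)"
    using grad q0 by (intro powr_mono2) auto
  also have "\<dots> = 2 powr ((q - 1) / q) * Aq * sobolev_norm \<Omega> q \<sigma> u"
  proof -
    have "0 \<le> Aq" using Aq1 NA' by linarith
    then show ?thesis using q0 \<sigma> by (simp add: powr_mult powr_powr sobolev_norm_def s(2))
  qed
  finally have gw: "grad_norm UNIV q w' \<le> 2 powr ((q - 1) / q) * Aq * sobolev_norm \<Omega> q \<sigma> u" .
  have w'p: "w' \<in> Lp_space UNIV p" using T[OF w'(1)] by blast
  then have "w' \<in> Lp_space \<Omega> p" using p1 by (intro Lp_space_restrict[OF w'p]) auto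
  then have up: "u \<in> Lp_space \<Omega> p" using Lp_space_cong[of \<Omega> w' u p] w'(2) by blast
  have "Lp_norm \<Omega> p u = Lp_norm \<Omega> p w'" using w'(2) by (intro Lp_norm_cong) simp
  also have "\<dots> \<le> Lp_norm UNIV p w'" using p1 by (intro Lp_norm_mono w'p) auto
  also have "\<dots> \<le> T * grad_norm UNIV q w'" using T[OF w'(1)] by blast
  also have "\<dots> \<le> T * (2 powr ((q - 1) / q) * Aq * sobolev_norm \<Omega> q \<sigma> u)"
    using gw T0 by (intro mult_left_mono) auto
  finally show "u \<in> Lp_space \<Omega> p \<and>
      Lp_norm \<Omega> p u \<le> (2 powr ((q - 1) / q) * T * Aq) * sobolev_norm \<Omega> q \<sigma> u"
    using up by (simp add: mult_ac)
qed

end
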